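(* Let $\Psi_{RABC}$ be a quantum state (possibly mixed). For every $\varepsilon,\delta\in(0,1)$ there exists an $n$ large enough such that for any $(q,\varepsilon)$-quantum state redistribution protocol for $\Psi_{RABC}^{\otimes n}$, there exists an $(n(N-\delta),8\varepsilon)$-QSR simulation (using that protocol) for any $N$ satisfying $$N\le I(R:C|B)_\Psi.$$
   Context: Finite-dimensional Hilbert spaces, base-2 logarithms. $I(A:B)_\rho=S(\rho_A)+S(\rho_B)-S(\rho_{AB})$ and $I(A:B|C)_\rho=I(A:BC)_\rho-I(A:C)_\rho$. Purified distance: $P(\rho,\sigma)=\sqrt{1-\|\sqrt\rho\sqrt\sigma\|_1^2}$. Quantum state redistribution: for a state $\Psi_{RABC}$ (Reference $R$, Alice $AC$, Bob $B$), a $(q,\varepsilon)$-quantum state redistribution protocol consists of a shared entangled pure state $|\theta\rangle_{E_AE_B}$ (Alice $E_A$, Bob $E_B$), an encoding isometry $V:\mathcal H_{ACE_A}\to\mathcal H_{AQT_A}$ by Alice (the register $Q$ is then sent to Bob), and a decoding isometry $W:\mathcal H_{QBE_B}\to\mathcal H_{BCT_B}$ by Bob, such that $$P\big(\mathrm{Tr}_{T_AT_B}(WV(\Psi_{RABC}\otimes\theta_{E_AE_B})V^\dagger W^\dagger),\Psi_{RABC}\big)\le\varepsilon;$$ $q=\log|Q|$ is the number of qubits communicated. QSR simulation: given a state $\Psi_{RABC}$ and a quantum state redistribution protocol $\mathcal P$ for it, an $(N,\varepsilon)$-QSR simulation (entanglement assisted simulation of $N$ bits of classical communication by one use of $\mathcal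 P$) consists of: an entangled state $|\omega\rangle_{S_AS_B}$ shared between Alice ($S_A$) and Bob ($S_B$); for every message $m\in[1:2^N]$ given in a register $M$, Alice chooses registers $A(m)C(m)$ (from her register $S_A$) holding the state $\Psi_{A(m)C(m)}$ and runs $\mathcal P$ (Alice's part), so that the message register $Q(m)$ of $\mathcal P$ is obtained by Bob; and a decoding map $\mathcal D:\mathcal L(S_BQ(m))\to\mathcal L(M')$ by Bob such that $\Pr[M'\ne m\mid M=m]\le\varepsilon$. *)

theory Defs
  imports
    Complex_Main
    "HOL-Library.Countable_Set"
    "HOL-Library.NList"
    "HOL-Computational_Algebra.Fundamental_Theorem_Algebra"
    "Jordan_Normal_Form.Char_Poly"
begin

section \<open>Operators on finite-dimensional Hilbert spaces\<close>

text \<open>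
  A finite set \<open>X\<close> of labels stands for the Hilbert space with orthonormal basis \<open>X\<close>.  A linear map
  from the space of \<open>X\<close> to the space of \<open>Y\<close> is given by its matrix entries \<open>M y x\<close>; entries outside
  \<open>Y \<times> X\<close> carry no meaning.  The tensor product of spaces is the product of the label sets, so that
  registers are addressed by tuple patterns.
\<close>

type_synonym ('y, 'x) operator = "'y \<Rightarrow> 'x \<Rightarrow> complex"

definition adj :: "('y, 'x) operator \<Rightarrow> ('x, 'y) operator" where
  "adj M = (\<lambda>x y. cnj (M y x))"

definition op_mult :: "'y set \<Rightarrow> ('z, 'y) operator \<Rightarrow> ('y, 'x) operator \<Rightarrow> ('z, 'x) operator" where
  "op_mult Y M N = (\<lambda>z x. \<Sum>y\<in>Y. M z y * N y x)"

text \<open>\<open>conj_by X M \<rho>\<close> is \<open>M \<rho> M\<^sup>\<dagger>\<close>, where \<open>\<rho>\<close> acts on \<open>X\<close>.\<close>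

definition conj_by :: "'x set \<Rightarrow> ('y, 'x) operator \<Rightarrow> ('x, 'x) operator \<Rightarrow> ('y, 'y) operator" where
  "conj_by X M \<rho> = op_mult X (op_mult X M \<rho>) (adj M)"

definition op_trace :: "'x set \<Rightarrow> ('x, 'x) operator \<Rightarrow> complex" where
  "op_trace X \<rho> = (\<Sum>x\<in>X. \<rho> x x)"

definition ptrace_snd :: "'y set \<Rightarrow> ('x \<times> 'y, 'x \<times> 'y) operator \<Rightarrow> ('x, 'x) operator" where
  "ptrace_snd Y \<rho> = (\<lambda>x x'. \<Sum>y\<in>Y. \<rho> (x, y) (x', y))"

definition ptrace_fst :: "'x set \<Rightarrow> ('x \<times> 'y, 'x \<times> 'y) operator \<Rightarrow> ('y, 'y) operator" where
  "ptrace_fst X \<rho> = (\<lambda>y y'. \<Sum>x\<in>X. \<rho> (x, y) (x, y'))"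

definition isometry_op :: "'x set \<Rightarrow> 'y set \<Rightarrow> ('y, 'x) operator \<Rightarrow> bool" where
  "isometry_op X Y M \<longleftrightarrow>
     (\<forall>x\<in>X. \<forall>x'\<in>X. op_mult Y (adj M) M x x' = of_bool (x = x'))"

definition unit_vec_on :: "'x set \<Rightarrow> ('x \<Rightarrow> complex) \<Rightarrow> bool" where
  "unit_vec_on X v \<longleftrightarrow> (\<Sum>x\<in>X. (cmod (v x))\<^sup>2) = 1"

definition positive_op :: "'x set \<Rightarrow> ('x, 'x) operator \<Rightarrow> bool" where
  "positive_op X M \<longleftrightarrow>
     (\<forall>v. let q = (\<Sum>x\<in>X. \<Sum>x'\<in>X. cnj (v x) * M x x' * v x') in q \<in> \<real> \<and> Re q \<ge> 0)"

definition density_op :: "'x set \<Rightarrow> ('x, 'x) operator \<Rightarrow> bool" where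
  "density_op X \<rho> \<longleftrightarrow> positive_op X \<rho> \<and> op_trace X \<rho> = 1"

text \<open>The positive square root of a positive operator; its entries on \<open>X\<close> are uniquely determined.\<close>

definition op_sqrt :: "'x set \<Rightarrow> ('x, 'x) operator \<Rightarrow> ('x, 'x) operator" where
  "op_sqrt X \<rho> = (SOME \<sigma>. positive_op X \<sigma> \<and> (\<forall>x\<in>X. \<forall>x'\<in>X. op_mult X \<sigma> \<sigma> x x' = \<rho> x x'))"

definition trace_norm :: "'x set \<Rightarrow> ('x, 'x) operator \<Rightarrow> real" where
  "trace_norm X M = Re (op_trace X (op_sqrt X (op_mult X (adj M) M)))"

definition purified_distance ::
  "'x set \<Rightarrow> ('x, 'x) operator \<Rightarrow> ('x, 'x) operator \<Rightarrow> real" where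
  "purified_distance X \<rho> \<sigma> =
     sqrt (1 - (trace_norm X (op_mult X (op_sqrt X \<rho>) (op_sqrt X \<sigma>)))\<^sup>2)"


section \<open>Entropic quantities\<close>

text \<open>The characteristic polynomial does not depend on the enumeration of \<open>X\<close> chosen here.\<close>

definition mat_of_op :: "'x set \<Rightarrow> ('x, 'x) operator \<Rightarrow> complex mat" where
  "mat_of_op X \<rho> =
     mat (card X) (card X) (\<lambda>(i, j). \<rho> (from_nat_into X i) (from_nat_into X j))"

text \<open>The sum ranges over the eigenvalues with multiplicity; an eigenvalue 0 contributes 0.\<close>

definition entropy :: "'x set \<Rightarrow> ('x, 'x) operator \<Rightarrow> real" where
  "entropy X \<rho> = (\<Sum>z\<in>#proots (char_poly (mat_of_op X \<rho>)). - (Re z * log 2 (Re z)))"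

definition mutual_info :: "'x set \<Rightarrow> 'y set \<Rightarrow> ('x \<times> 'y, 'x \<times> 'y) operator \<Rightarrow> real" where
  "mutual_info X Y \<rho> =
     entropy X (ptrace_snd Y \<rho>) + entropy Y (ptrace_fst X \<rho>) - entropy (X \<times> Y) \<rho>"

text \<open>\<open>I(X:Y|Z) = I(X:YZ) - I(X:Z)\<close> for a state on \<open>X \<times> Y \<times> Z\<close>.\<close>

definition cond_mutual_info ::
  "'x set \<Rightarrow> 'y set \<Rightarrow> 'z set \<Rightarrow> ('x \<times> 'y \<times> 'z, 'x \<times> 'y \<times> 'z) operator \<Rightarrow> real" where
  "cond_mutual_info X Y Z \<rho> =
     mutual_info X (Y \<times> Z) \<rho>
     - mutual_info X Z (\<lambda>(x, z) (x', z'). \<Sum>y\<in>Y. \<rho> (x, y, z) (x', y, z'))"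


section \<open>States on registers R, A, B, C\<close>

type_synonym ('r, 'a, 'b, 'c) rabc_op = "('r \<times> 'a \<times> 'b \<times> 'c, 'r \<times> 'a \<times> 'b \<times> 'c) operator"

text \<open>Marginal on \<open>RCB\<close>, in this order.\<close>

definition marg_RCB :: "'a set \<Rightarrow> ('r, 'a, 'b, 'c) rabc_op \<Rightarrow> ('r \<times> 'c \<times> 'b, 'r \<times> 'c \<times> 'b) operator" where
  "marg_RCB A \<Psi> = (\<lambda>(r, c, b) (r', c', b'). \<Sum>a\<in>A. \<Psi> (r, a, b, c) (r', a, b', c'))"

definition marg_AC :: "'r set \<Rightarrow> 'b set \<Rightarrow> ('r, 'a, 'b, 'c) rabc_op \<Rightarrow> ('a \<times> 'c, 'a \<times> 'c) operator" where
  "marg_AC R B \<Psi> = (\<lambda>(a, c) (a', c'). \<Sum>r\<in>R. \<Sum>b\<in>B. \<Psi> (r, a, b, c) (r, a', b, c'))"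

definition info_R_C_given_B :: "('r::finite, 'a::finite, 'b::finite, 'c::finite) rabc_op \<Rightarrow> real" where
  "info_R_C_given_B \<Psi> = cond_mutual_info UNIV UNIV UNIV (marg_RCB UNIV \<Psi>)"

text \<open>
  \<open>\<Psi>\<^sup>\<otimes>\<^sup>n\<close>, with the \<open>n\<close> copies of each register collected into one register: the register \<open>R\<^sup>n\<close> has the
  lists of length \<open>n\<close> as basis labels, and likewise for \<open>A\<close>, \<open>B\<close>, \<open>C\<close>.
\<close>

definition tensor_pow ::
  "nat \<Rightarrow> ('r, 'a, 'b, 'c) rabc_op \<Rightarrow> ('r list, 'a list, 'b list, 'c list) rabc_op" where
  "tensor_pow n \<Psi> = (\<lambda>(rs, as, bs, cs) (rs', as', bs', cs').
     \<Prod>i<n. \<Psi> (rs ! i, as ! i, bs ! i, cs ! i) (rs' ! i, as' ! i, bs' ! i, cs' ! i))"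


section \<open>Quantum state redistribution\<close>

text \<open>
  The registers \<open>E\<^sub>A, E\<^sub>B, Q, T\<^sub>A, T\<^sub>B\<close> of a protocol are given by their dimensions; a register of
  dimension \<open>d\<close> has basis \<open>{..<d}\<close>.  The encoding maps \<open>A C E\<^sub>A\<close> to \<open>A Q T\<^sub>A\<close>, the decoding maps
  \<open>Q B E\<^sub>B\<close> to \<open>B C T\<^sub>B\<close>.
\<close>

record ('a, 'b, 'c) protocol =
  dim_EA :: nat
  dim_EB :: nat
  dim_Q :: nat
  dim_TA :: nat
  dim_TB :: nat
  theta :: "nat \<times> nat \<Rightarrow> complex"
  enc :: "('a \<times> nat \<times> nat, 'a \<times> 'c \<times> nat) operator"
  dec :: "('b \<times> 'c \<times> nat, nat \<times> 'b \<times> nat) operator"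

definition with_theta ::
  "('a, 'b, 'c) protocol \<Rightarrow> ('r, 'a, 'b, 'c) rabc_op
   \<Rightarrow> ('r \<times> 'a \<times> 'b \<times> 'c \<times> nat \<times> nat, 'r \<times> 'a \<times> 'b \<times> 'c \<times> nat \<times> nat) operator" where
  "with_theta P \<Psi> = (\<lambda>(r, a, b, c, eA, eB) (r', a', b', c', eA', eB').
     \<Psi> (r, a, b, c) (r', a', b', c') * (theta P (eA, eB) * cnj (theta P (eA', eB'))))"

text \<open>The encoding and the decoding, tensored with the identity on the registers they do not touch.\<close>

definition enc_full ::
  "('a, 'b, 'c) protocol
   \<Rightarrow> ('r \<times> 'a \<times> nat \<times> nat \<times> 'b \<times> nat, 'r \<times> 'a \<times> 'b \<times> 'c \<times> nat \<times> nat) operator" where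
  "enc_full P = (\<lambda>(r, a, q, tA, b, eB) (r', a', b', c', eA', eB').
     of_bool (r = r' \<and> b = b' \<and> eB = eB') * enc P (a, q, tA) (a', c', eA'))"

definition dec_full ::
  "('a, 'b, 'c) protocol
   \<Rightarrow> ('r \<times> 'a \<times> 'b \<times> 'c \<times> nat \<times> nat, 'r \<times> 'a \<times> nat \<times> nat \<times> 'b \<times> nat) operator" where
  "dec_full P = (\<lambda>(r, a, b, c, tA, tB) (r', a', q', tA', b', eB').
     of_bool (r = r' \<and> a = a' \<and> tA = tA') * dec P (b, c, tB) (q', b', eB'))"

definition protocol_output ::
  "'r set \<Rightarrow> 'a set \<Rightarrow> 'b set \<Rightarrow> 'c set \<Rightarrow> ('r, 'a, 'b, 'c) rabc_op \<Rightarrow> ('a, 'b, 'c) protocol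
   \<Rightarrow> ('r, 'a, 'b, 'c) rabc_op" where
  "protocol_output R A B C \<Psi> P =
    (let \<rho>1 = conj_by (R \<times> A \<times> B \<times> C \<times> {..<dim_EA P} \<times> {..<dim_EB P}) (enc_full P) (with_theta P \<Psi>);
         \<rho>2 = conj_by (R \<times> A \<times> {..<dim_Q P} \<times> {..<dim_TA P} \<times> B \<times> {..<dim_EB P}) (dec_full P) \<rho>1
     in (\<lambda>(r, a, b, c) (r', a', b', c').
           \<Sum>tA<dim_TA P. \<Sum>tB<dim_TB P. \<rho>2 (r, a, b, c, tA, tB) (r', a', b', c', tA, tB)))"

definition qsr_protocol ::
  "'r set \<Rightarrow> 'a set \<Rightarrow> 'b set \<Rightarrow> 'c set \<Rightarrow> ('r, 'a, 'b, 'c) rabc_op \<Rightarrow> real \<Rightarrow> real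
   \<Rightarrow> ('a, 'b, 'c) protocol \<Rightarrow> bool" where
  "qsr_protocol R A B C \<Psi> q \<epsilon> P \<longleftrightarrow>
     unit_vec_on ({..<dim_EA P} \<times> {..<dim_EB P}) (theta P) \<and>
     isometry_op (A \<times> C \<times> {..<dim_EA P}) (A \<times> {..<dim_Q P} \<times> {..<dim_TA P}) (enc P) \<and>
     isometry_op ({..<dim_Q P} \<times> B \<times> {..<dim_EB P}) (B \<times> C \<times> {..<dim_TB P}) (dec P) \<and>
     purified_distance (R \<times> A \<times> B \<times> C) (protocol_output R A B C \<Psi> P) \<Psi> \<le> \<epsilon> \<and>
     q = log 2 (real (dim_Q P))"


section \<open>Quantum channels\<close>

text \<open>
  Linear, completely positive and trace preserving maps from operators on \<open>X\<close> to operators on \<open>Y\<close>.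
  That the entries of \<open>D \<rho>\<close> on \<open>Y\<close> depend on \<open>\<rho>\<close> only through its entries on \<open>X\<close> follows from these
  three conditions: if \<open>\<rho>\<close> vanishes on \<open>X\<close>, then \<open>D \<rho>\<close> is positive with trace 0.
\<close>

definition channel ::
  "'x set \<Rightarrow> 'y set \<Rightarrow> (('x, 'x) operator \<Rightarrow> ('y, 'y) operator) \<Rightarrow> bool" where
  "channel X Y D \<longleftrightarrow>
     (\<forall>\<rho> \<sigma> \<alpha> \<beta>. \<forall>y\<in>Y. \<forall>y'\<in>Y.
        D (\<lambda>x x'. \<alpha> * \<rho> x x' + \<beta> * \<sigma> x x') y y' = \<alpha> * D \<rho> y y' + \<beta> * D \<sigma> y y') \<and>
     (\<forall>(k::nat) (\<rho> :: (nat \<times> 'x, nat \<times> 'x) operator). positive_op ({..<k} \<times> X) \<rho> \<longrightarrow>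
        positive_op ({..<k} \<times> Y) (\<lambda>(i, y) (i', y'). D (\<lambda>x x'. \<rho> (i, x) (i', x')) y y')) \<and>
     (\<forall>\<rho>. op_trace Y (D \<rho>) = op_trace X \<rho>)"


section \<open>QSR simulation\<close>

text \<open>
  The messages \<open>1, \<dots>, \<lfloor>2\<^sup>N\<rfloor>\<close>.  For \<open>N < 0\<close> there is a single message, so that the message register
  is never the zero space.
\<close>

definition messages :: "real \<Rightarrow> nat set" where
  "messages N = {1..max 1 (nat \<lfloor>2 powr N\<rfloor>)}"

text \<open>
  The resources of a simulation.  Alice's register \<open>S\<^sub>A\<close> consists of \<open>num_pairs\<close> pairs of registers, each
  a copy of \<open>AC\<close>, a register \<open>E\<^sub>A\<close>, and a further register of dimension \<open>dim_GA\<close>; Bob's register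
  \<open>S\<^sub>B\<close> consists of a register \<open>E\<^sub>B\<close> and a further register of dimension \<open>dim_GB\<close>.  The shared pure
  state \<open>omega\<close> has basis labels \<open>((zs, eA, g), (eB, s))\<close>, where \<open>zs\<close> lists the labels of the pairs.
  For message \<open>m\<close> Alice uses the pair number \<open>slot m\<close> as \<open>A(m)C(m)\<close>.
\<close>

record ('a, 'c) simulation =
  num_pairs :: nat
  dim_GA :: nat
  dim_GB :: nat
  omega :: "(('a \<times> 'c) list \<times> nat \<times> nat) \<times> (nat \<times> nat) \<Rightarrow> complex"
  slot :: "nat \<Rightarrow> nat"
  decoder :: "((nat \<times> nat) \<times> nat, (nat \<times> nat) \<times> nat) operator \<Rightarrow> (nat, nat) operator"

definition space_SA :: "'a set \<Rightarrow> 'c set \<Rightarrow> ('a, 'b, 'c) protocol \<Rightarrow> ('a, 'c) simulation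
    \<Rightarrow> (('a \<times> 'c) list \<times> nat \<times> nat) set" where
  "space_SA A C P S = nlists (num_pairs S) (A \<times> C) \<times> {..<dim_EA P} \<times> {..<dim_GA S}"

definition space_SB :: "('a, 'b, 'c) protocol \<Rightarrow> ('a, 'c) simulation \<Rightarrow> (nat \<times> nat) set" where
  "space_SB P S = {..<dim_EB P} \<times> {..<dim_GB S}"

text \<open>
  Marginal of \<open>omega\<close> on \<open>A(m)C(m)E\<^sub>A\<close> and \<open>S\<^sub>B\<close>.  The registers of \<open>S\<^sub>A\<close> traced out here take no
  part in the protocol.
\<close>

definition selected_state ::
  "'a set \<Rightarrow> 'c set \<Rightarrow> ('a, 'c) simulation \<Rightarrow> nat
   \<Rightarrow> (('a \<times> 'c \<times> nat) \<times> (nat \<times> nat), ('a \<times> 'c \<times> nat) \<times> (nat \<times> nat)) operator" where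
  "selected_state A C S m = (\<lambda>((a, c, eA), sB) ((a', c', eA'), sB').
     \<Sum>zs | zs \<in> nlists (num_pairs S) (A \<times> C) \<and> zs ! slot S m = (a, c). \<Sum>g<dim_GA S.
       omega S ((zs, eA, g), sB) * cnj (omega S ((zs[slot S m := (a', c')], eA', g), sB')))"

text \<open>State of \<open>S\<^sub>B Q(m)\<close> after Alice has applied the encoding of the protocol and sent \<open>Q(m)\<close>.\<close>

definition received_state ::
  "'a set \<Rightarrow> 'c set \<Rightarrow> ('a, 'b, 'c) protocol \<Rightarrow> ('a, 'c) simulation \<Rightarrow> nat
   \<Rightarrow> ((nat \<times> nat) \<times> nat, (nat \<times> nat) \<times> nat) operator" where
  "received_state A C P S m =
    (let V = (\<lambda>((a, q, tA), sB) ((a', c', eA'), sB').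
                of_bool (sB = sB') * enc P (a, q, tA) (a', c', eA'));
         \<rho> = conj_by ((A \<times> C \<times> {..<dim_EA P}) \<times> space_SB P S) V (selected_state A C S m)
     in (\<lambda>(sB, q) (sB', q').
           \<Sum>a\<in>A. \<Sum>tA<dim_TA P. \<rho> ((a, q, tA), sB) ((a, q', tA), sB')))"

text \<open>
  \<open>S\<close> simulates \<open>N\<close> bits with error at most \<open>\<epsilon>\<close> by one use of \<open>P\<close>, where \<open>\<psi>\<close> is the state of \<open>AC\<close> on
  which \<open>P\<close> is meant to be run.  Using \<open>P\<close> includes using its entangled state \<open>theta\<close>, which is why
  \<open>A(m)C(m)E\<^sub>AE\<^sub>B\<close> is required to be in the state \<open>\<psi> \<otimes> \<theta>\<close>.
\<close>

definition qsr_simulation ::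
  "'a set \<Rightarrow> 'c set \<Rightarrow> ('a \<times> 'c, 'a \<times> 'c) operator \<Rightarrow> ('a, 'b, 'c) protocol \<Rightarrow> real \<Rightarrow> real
   \<Rightarrow> ('a, 'c) simulation \<Rightarrow> bool" where
  "qsr_simulation A C \<psi> P N \<epsilon> S \<longleftrightarrow>
     unit_vec_on (space_SA A C P S \<times> space_SB P S) (omega S) \<and>
     channel (space_SB P S \<times> {..<dim_Q P}) (messages N) (decoder S) \<and>
     (\<forall>m\<in>messages N.
        slot S m < num_pairs S \<and>
        (\<forall>a\<in>A. \<forall>c\<in>C. \<forall>eA<dim_EA P. \<forall>eB<dim_EB P.
         \<forall>a'\<in>A. \<forall>c'\<in>C. \<forall>eA'<dim_EA P. \<forall>eB'<dim_EB P.
           (\<Sum>s<dim_GB S. selected_state A C S m ((a, c, eA), (eB, s)) ((a', c', eA'), (eB', s)))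
           = \<psi> (a, c) (a', c') * (theta P (eA, eB) * cnj (theta P (eA', eB')))) \<and>
        (\<Sum>m'\<in>messages N - {m}. Re (decoder S (received_state A C P S m) m' m')) \<le> \<epsilon>)"

end

theory Submission
  imports Defs "HOL-Analysis.L2_Norm"
begin

text \<open>
  Bob holds, for every message \<open>m\<close>, systems \<open>R(m)B(m)\<close> (and the purifying system of \<open>\<Psi>\<close>) such that
  \<open>A(m)C(m)R(m)B(m)\<close> is in the state \<open>\<Psi>\<^sup>\<otimes>\<^sup>n\<close>; the pairs for different messages are independent.  After Alice has
  run the protocol on the pair \<open>m\<close>, Bob tests for each \<open>k\<close> whether the register \<open>Q\<close> belongs to his systems
  \<open>R(k)B(k)\<close>: he decodes \<open>Q\<close> with \<open>B(k)E\<^sub>B\<close> and checks whether \<open>R(k)C B(k)\<close> looks typical for \<open>\<Psi>\<^sub>R\<^sub>C\<^sub>B\<close>.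

  For \<open>k = m\<close> the decoded state is within purified distance \<open>\<epsilon>\<close> of \<open>\<Psi>\<^sup>\<otimes>\<^sup>n\<close>, so the test fails with probability
  about \<open>\<epsilon>\<^sup>2\<close>.  For \<open>k \<noteq> m\<close> the systems \<open>R(k)B(k)\<close> are independent of \<open>QE\<^sub>B\<close>.  Up to typical projections,
  \<open>\<Psi>\<^sub>R\<^sub>B \<le> 2\<^bsup>n(S(B) - S(RB))\<^esup> (1\<^sub>R \<otimes> \<Psi>\<^sub>B)\<close>, so that Bob's state after the decoding is at most
  \<open>2\<^bsup>n(S(B) - S(RB))\<^esup> (1\<^sub>R \<otimes> \<omega>\<^sub>C\<^sub>B)\<close> for some state \<open>\<omega>\<close>, and the test accepts \<open>1\<^sub>R \<otimes> \<omega>\<^sub>C\<^sub>B\<close> with weight at most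
  \<open>2\<^bsup>n(S(RCB) - S(CB))\<^esup>\<close> whatever \<open>\<omega>\<close> is.  Together this is \<open>2\<^bsup>-n I(R:C|B)\<^esup>\<close>; the entropy of \<open>R\<close> cancels in
  \<open>I(R:C|B)\<close> and never enters.  Hence the \<open>2\<^bsup>n(N - \<delta>)\<^esup>\<close> wrong tests accept with vanishing total probability, and
  performing the tests one after the other identifies \<open>m\<close> with error at most \<open>7\<epsilon>\<^sup>2 \<le> 8\<epsilon>\<close>.
\<close>

section \<open>Linear algebra over label sets\<close>

text \<open>The protocol is a black box, known only through its isometries and one inequality on a
  purified distance. The bound for a wrong pair must therefore hold for whatever Bob decodes, and
  the threshold \<open>n0\<close> depends on \<open>\<Psi>\<close>, \<open>\<epsilon>\<close> and
  \<open>\<delta>\<close> alone.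

  The typical projections of a joint state and of its marginal need not commute. The test is
  therefore not a projection but the effect \<open>M\<^sup>\<dagger> M\<close> of a contraction
  \<open>M\<close>, and the order of the two projections matters: \<open>N\<close> puts the joint
  projection next to the state, \<open>L\<close> puts it in the middle of
  \<open>L\<^sup>\<dagger> L\<close>.

  States are carried as finite families of vectors \<open>f j\<close>, with \<open>\<rho>\<close>
  the sum of the \<open>f j (f j)\<^sup>\<dagger>\<close> (\<open>gram\<close>). Traces become sums
  of squared norms, operator inequalities become inequalities between such sums, closeness becomes
  an l2 distance of families, and a partial trace only moves a label from the argument of a vector
  to its index.\<close>

definition norm_sq :: "'x set \<Rightarrow> ('x \<Rightarrow> complex) \<Rightarrow> real" where
  "norm_sq X v = (\<Sum>x\<in>X. (cmod (v x))\<^sup>2)"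

definition ip :: "'x set \<Rightarrow> ('x \<Rightarrow> complex) \<Rightarrow> ('x \<Rightarrow> complex) \<Rightarrow> complex" where
  "ip X u v = (\<Sum>x\<in>X. cnj (u x) * v x)"

definition op_app :: "'x set \<Rightarrow> ('y, 'x) operator \<Rightarrow> ('x \<Rightarrow> complex) \<Rightarrow> 'y \<Rightarrow> complex" where
  "op_app X M v = (\<lambda>y. \<Sum>x\<in>X. M y x * v x)"

text \<open>An operator that leaves a register alone has a Kronecker delta in its entries there;
  these rules sum it out.\<close>

lemma sum_of_bool:
  fixes f :: "'x \<Rightarrow> 'a::semiring_1"
  assumes "finite A"
  shows "(\<Sum>y\<in>A. of_bool (x = y) * f y) = (if x \<in> A then f x else 0)"
    and "(\<Sum>y\<in>A. of_bool (y = x) * f y) = (if x \<in> A then f x else 0)"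
    and "(\<Sum>y\<in>A. f y * of_bool (x = y)) = (if x \<in> A then f x else 0)"
    and "(\<Sum>y\<in>A. f y * of_bool (y = x)) = (if x \<in> A then f x else 0)"
proof -
  have "of_bool (x = y) * f y = (if y = x then f y else 0)" "f y * of_bool (x = y) = (if y = x then f y else 0)"
    "of_bool (y = x) * f y = (if y = x then f y else 0)" "f y * of_bool (y = x) = (if y = x then f y else 0)" for y
    by auto
  then show "(\<Sum>y\<in>A. of_bool (x = y) * f y) = (if x \<in> A then f x else 0)"
    "(\<Sum>y\<in>A. of_bool (y = x) * f y) = (if x \<in> A then f x else 0)"
    "(\<Sum>y\<in>A. f y * of_bool (x = y)) = (if x \<in> A then f x else 0)"
    "(\<Sum>y\<in>A. f y * of_bool (y = x)) = (if x \<in> A then f x else 0)"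
    using assms by (simp_all only: sum.delta)
qed

lemma norm_sq_nonneg [simp]: "0 \<le> norm_sq X v"
  by (simp add: norm_sq_def sum_nonneg)

lemma ip_self: "ip X v v = of_real (norm_sq X v)"
  by (simp add: ip_def norm_sq_def complex_norm_square mult.commute del: of_real_power)

lemma ip_cnj: "cnj (ip X u v) = ip X v u"
  by (simp add: ip_def mult.commute)

lemma ip_diff_right: "ip X u (\<lambda>x. v x - w x) = ip X u v - ip X u w"
  by (simp add: ip_def algebra_simps sum_subtractf)

lemma ip_diff_left: "ip X (\<lambda>x. v x - w x) u = ip X v u - ip X w u"
  by (simp add: ip_def algebra_simps sum_subtractf)

lemma ip_scale_right: "ip X u (\<lambda>x. c * v x) = c * ip X u v"
  by (simp add: ip_def sum_distrib_left mult_ac)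

lemma ip_scale_left: "ip X (\<lambda>x. c * v x) u = cnj c * ip X v u"
  by (simp add: ip_def sum_distrib_left mult_ac)

lemma ip_sum_right: "ip X u (\<lambda>x. \<Sum>k\<in>K. f k x) = (\<Sum>k\<in>K. ip X u (f k))"
  by (simp add: ip_def sum_distrib_left sum.swap[of _ K])

lemma ip_cong: "(\<And>x. x \<in> X \<Longrightarrow> u x = u' x) \<Longrightarrow> (\<And>x. x \<in> X \<Longrightarrow> v x = v' x) \<Longrightarrow> ip X u v = ip X u' v'"
  by (simp add: ip_def)

lemma norm_sq_cong: "(\<And>x. x \<in> X \<Longrightarrow> u x = u' x) \<Longrightarrow> norm_sq X u = norm_sq X u'"
  by (simp add: norm_sq_def)

lemma op_app_cong: "(\<And>x. x \<in> X \<Longrightarrow> u x = u' x) \<Longrightarrow> op_app X M u = op_app X M u'"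
  by (simp add: op_app_def)

lemma norm_sq_scale: "norm_sq X (\<lambda>x. c * v x) = (cmod c)\<^sup>2 * norm_sq X v"
  by (simp add: norm_sq_def norm_mult power_mult_distrib sum_distrib_left)

lemma norm_sq_eq_0_iff: "finite X \<Longrightarrow> norm_sq X v = 0 \<longleftrightarrow> (\<forall>x\<in>X. v x = 0)"
  by (simp add: norm_sq_def sum_nonneg_eq_0_iff)

lemma op_app_add: "op_app X M (\<lambda>x. v x + w x) = (\<lambda>y. op_app X M v y + op_app X M w y)"
  by (simp add: op_app_def algebra_simps sum.distrib)

lemma op_app_diff: "op_app X M (\<lambda>x. v x - w x) = (\<lambda>y. op_app X M v y - op_app X M w y)"
  by (simp add: op_app_def algebra_simps sum_subtractf)

lemma op_app_scale: "op_app X M (\<lambda>x. c * v x) = (\<lambda>y. c * op_app X M v y)"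
  by (simp add: op_app_def sum_distrib_left mult_ac)

lemma op_app_mult: "op_app X (op_mult Y M N) v = op_app Y M (op_app X N v)"
  by (rule ext)
    (simp add: op_app_def op_mult_def sum_distrib_left sum_distrib_right sum.swap[of _ X] mult.assoc)

lemma ip_op_app: "ip Y w (op_app X M v) = ip X (op_app Y (adj M) w) v"
  by (simp add: ip_def op_app_def adj_def sum_distrib_left sum_distrib_right sum.swap[of _ X Y] mult_ac)

lemma ip_adj_mult: "ip X v (op_app X (op_mult Y (adj M) M) v) = of_real (norm_sq Y (op_app X M v))"
  unfolding op_app_mult by (subst ip_op_app) (simp add: adj_def ip_self)

lemma sqrt_norm_sq: "sqrt (norm_sq X v) = L2_set (\<lambda>x. cmod (v x)) X"
  by (simp add: norm_sq_def L2_set_def)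

lemma Cauchy_Schwarz_ip: "cmod (ip X u v) \<le> sqrt (norm_sq X u) * sqrt (norm_sq X v)"
proof -
  have "cmod (ip X u v) \<le> (\<Sum>x\<in>X. \<bar>cmod (u x)\<bar> * \<bar>cmod (v x)\<bar>)"
    unfolding ip_def by (rule order_trans[OF norm_sum]) (simp add: norm_mult)
  also have "\<dots> \<le> L2_set (\<lambda>x. cmod (u x)) X * L2_set (\<lambda>x. cmod (v x)) X"
    by (rule L2_set_mult_ineq)
  finally show ?thesis by (simp add: sqrt_norm_sq)
qed

lemma norm_sq_triangle:
  "sqrt (norm_sq X (\<lambda>x. u x + v x)) \<le> sqrt (norm_sq X u) + sqrt (norm_sq X v)"
proof -
  have "L2_set (\<lambda>x. cmod (u x + v x)) X \<le> L2_set (\<lambda>x. cmod (u x) + cmod (v x)) X"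
    by (rule L2_set_mono) (auto simp: norm_triangle_ineq)
  also have "\<dots> \<le> L2_set (\<lambda>x. cmod (u x)) X + L2_set (\<lambda>x. cmod (v x)) X"
    by (rule L2_set_triangle_ineq)
  finally show ?thesis by (simp add: sqrt_norm_sq)
qed

lemma norm_sq_triangle_diff:
  "sqrt (norm_sq X u) \<le> sqrt (norm_sq X v) + sqrt (norm_sq X (\<lambda>x. u x - v x))"
  using norm_sq_triangle[of X v "\<lambda>x. u x - v x"] by simp

text \<open>Gaussian elimination, one equation at a time: an unknown \<open>k0\<close> with a
  nonzero coefficient is solved for and inserted into the other equations. The dimension counts of
  the spectral theorem below come from here.\<close>

lemma homogeneous_system:
  fixes a :: "'x \<Rightarrow> 'k \<Rightarrow> complex"
  assumes "finite X" "finite K" "card X < card K"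
  shows "\<exists>c. (\<exists>k\<in>K. c k \<noteq> 0) \<and> (\<forall>x\<in>X. (\<Sum>k\<in>K. a x k * c k) = 0)"
  using assms
proof (induction X arbitrary: K a rule: finite_induct)
  case empty
  then have "K \<noteq> {}" by auto
  then show ?case by (intro exI[of _ "\<lambda>_. 1"]) auto
next
  case (insert x X)
  show ?case
  proof (cases "\<forall>k\<in>K. a x k = 0")
    case True
    obtain c where "\<exists>k\<in>K. c k \<noteq> 0" "\<forall>y\<in>X. (\<Sum>k\<in>K. a y k * c k) = 0"
      using insert.IH[of K a] insert.prems insert.hyps by auto
    with True show ?thesis by (intro exI[of _ c]) auto
  next
    case False
    then obtain k0 where k0: "k0 \<in> K" "a x k0 \<noteq> 0" by auto
    let ?K = "K - {k0}"
    have "card X < card ?K" using insert.prems insert.hyps k0 by auto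
    then obtain c where c: "\<exists>k\<in>?K. c k \<noteq> 0"
      "\<forall>y\<in>X. (\<Sum>k\<in>?K. (a y k - a y k0 * a x k / a x k0) * c k) = 0"
      using insert.IH[of ?K "\<lambda>y k. a y k - a y k0 * a x k / a x k0"] insert.prems by auto
    let ?s = "- (\<Sum>k\<in>?K. a x k * c k) / a x k0"
    let ?c = "c(k0 := ?s)"
    have split: "(\<Sum>k\<in>K. a y k * ?c k) = a y k0 * ?s + (\<Sum>k\<in>?K. a y k * c k)" for y
      using insert.prems k0(1) by (subst sum.remove[of K k0]) auto
    have "(\<Sum>k\<in>K. a y k * ?c k) = 0" if "y \<in> insert x X" for y
    proof (cases "y = x")
      case True
      then show ?thesis using k0 by (simp only: split) simp
    next
      case False
      then have "(\<Sum>k\<in>?K. (a y k - a y k0 * a x k / a x k0) * c k) = 0" using c that by auto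
      moreover have "(\<Sum>k\<in>?K. (a y k - a y k0 * a x k / a x k0) * c k)
          = (\<Sum>k\<in>?K. a y k * c k) + a y k0 * ?s"
      proof -
        have "a y k0 * ?s = - (\<Sum>k\<in>?K. a y k0 * a x k / a x k0 * c k)"
          by (simp add: sum_distrib_left sum_divide_distrib mult_ac)
        then show ?thesis by (simp only: left_diff_distrib sum_subtractf) simp
      qed
      ultimately show ?thesis by (simp only: split) simp
    qed
    moreover have "\<exists>k\<in>K. ?c k \<noteq> 0" using c(1) by auto
    ultimately show ?thesis by (intro exI[of _ ?c]) blast
  qed
qed

section \<open>Orthonormal families and their completeness\<close>

definition orthonormal_on :: "'x set \<Rightarrow> nat \<Rightarrow> (nat \<Rightarrow> 'x \<Rightarrow> complex) \<Rightarrow> bool" where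
  "orthonormal_on X k u \<longleftrightarrow> (\<forall>i<k. \<forall>j<k. ip X (u i) (u j) = of_bool (i = j))"

text \<open>More vectors than coordinates would admit a linear dependence, and the inner product
  with \<open>u j\<close> isolates its coefficient \<open>c j\<close>.\<close>

lemma orthonormal_on_le_card:
  assumes "finite X" "orthonormal_on X k u"
  shows "k \<le> card X"
proof (rule ccontr)
  assume "\<not> k \<le> card X"
  then obtain c where c: "\<exists>i<k. c i \<noteq> 0" "\<forall>x\<in>X. (\<Sum>i<k. u i x * c i) = 0"
    using homogeneous_system[of X "{..<k}" "\<lambda>x i. u i x"] assms(1) by auto
  have "c j = 0" if "j < k" for j
  proof -
    have "ip X (u j) (\<lambda>x. \<Sum>i<k. c i * u i x) = (\<Sum>i<k. c i * ip X (u j) (u i))"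
      by (simp add: ip_sum_right ip_scale_right)
    also have "\<dots> = (\<Sum>i<k. if i = j then c i else 0)"
      using assms(2) that by (intro sum.cong) (auto simp: orthonormal_on_def)
    also have "\<dots> = c j" using that by simp
    finally show ?thesis using c(2) by (simp add: ip_def mult.commute)
  qed
  with c(1) show False by auto
qed

lemma orthonormal_on_Suc:
  assumes "orthonormal_on X k u" "\<And>i. i < k \<Longrightarrow> ip X (u i) v = 0" "norm_sq X v \<noteq> 0"
  shows "orthonormal_on X (Suc k) (u(k := \<lambda>x. of_real (1 / sqrt (norm_sq X v)) * v x))"
proof -
  let ?c = "complex_of_real (1 / sqrt (norm_sq X v))"
  have 1: "ip X (u i) (\<lambda>x. ?c * v x) = 0" "ip X (\<lambda>x. ?c * v x) (u i) = 0" if "i < k" for i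
    using assms(2)[OF that] ip_cnj[of X "u i" v] by (simp_all only: ip_scale_right ip_scale_left) auto
  have "norm_sq X v > 0" using assms(3) norm_sq_nonneg[of X v] by linarith
  then have 2: "ip X (\<lambda>x. ?c * v x) (\<lambda>x. ?c * v x) = 1"
    unfolding ip_self norm_sq_scale by (simp add: power_divide norm_divide)
  show ?thesis
    unfolding orthonormal_on_def using 1 2 assms(1)
    by (auto simp: orthonormal_on_def less_Suc_eq simp del: of_real_divide)
qed

lemma orthogonal_vector_exists:
  assumes "finite X" "k < card X"
  shows "\<exists>v. norm_sq X v \<noteq> 0 \<and> (\<forall>i<k. ip X (u i) v = 0)"
proof -
  obtain c where "\<exists>x\<in>X. c x \<noteq> 0" "\<forall>i<k. (\<Sum>x\<in>X. cnj (u i x) * c x) = 0"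
    using homogeneous_system[of "{..<k}" X "\<lambda>i x. cnj (u i x)"] assms by auto
  then show ?thesis using assms(1) by (intro exI[of _ c]) (auto simp: norm_sq_eq_0_iff ip_def)
qed

text \<open>The part \<open>r\<close> of the basis vector at \<open>y\<close> that is orthogonal to
  the whole family must vanish: otherwise it could be normalised and appended, against the bound on
  the length of orthonormal families.\<close>

lemma orthonormal_on_complete:
  assumes "finite X" "orthonormal_on X (card X) u" "x \<in> X" "y \<in> X"
  shows "(\<Sum>i<card X. u i x * cnj (u i y)) = of_bool (x = y)"
proof -
  define r where "r = (\<lambda>x. of_bool (x = y) - (\<Sum>i<card X. cnj (u i y) * u i x))"
  have "ip X (u j) r = 0" if "j < card X" for j
  proof -
    have "ip X (u j) r = cnj (u j y) - (\<Sum>i<card X. cnj (u i y) * ip X (u j) (u i))"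
      unfolding r_def using assms(1,4)
      by (simp add: ip_diff_right ip_sum_right ip_scale_right) (simp add: ip_def of_bool_def if_distrib sum.delta cong: if_cong)
    also have "(\<Sum>i<card X. cnj (u i y) * ip X (u j) (u i)) = (\<Sum>i<card X. if i = j then cnj (u i y) else 0)"
      using assms(2) that by (intro sum.cong) (auto simp: orthonormal_on_def)
    finally show ?thesis using that by simp
  qed
  then have "norm_sq X r = 0"
    using orthonormal_on_Suc[OF assms(2), of r] orthonormal_on_le_card[OF assms(1), of "Suc (card X)"]
    by (metis not_less_eq_eq order_refl)
  then have "r x = 0" using assms by (simp add: norm_sq_eq_0_iff)
  then show ?thesis by (simp add: r_def mult.commute)
qed

section \<open>Polynomials in an operator and the eigenvectors of Hermitian operators\<close>

definition poly_op :: "'x set \<Rightarrow> ('x, 'x) operator \<Rightarrow> complex poly \<Rightarrow> ('x \<Rightarrow> complex) \<Rightarrow> 'x \<Rightarrow> complex" where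
  "poly_op X M p v = fold_coeffs (\<lambda>a f x. a * v x + op_app X M f x) p (\<lambda>_. 0)"

lemma poly_op_0 [simp]: "poly_op X M 0 v = (\<lambda>_. 0)"
  by (simp add: poly_op_def)

lemma poly_op_pCons:
  "poly_op X M (pCons a p) v = (\<lambda>x. a * v x + op_app X M (poly_op X M p v) x)"
  by (cases "a = 0 \<and> p = 0") (auto simp: poly_op_def op_app_def)

lemma poly_op_app: "poly_op X M p (op_app X M v) = op_app X M (poly_op X M p v)"
  by (induction p) (simp_all add: poly_op_pCons op_app_add op_app_scale, simp add: op_app_def)

lemma poly_op_diff: "poly_op X M p (\<lambda>x. v x - w x) = (\<lambda>x. poly_op X M p v x - poly_op X M p w x)"
  by (induction p) (simp_all add: poly_op_pCons op_app_diff algebra_simps)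

lemma poly_op_scale: "poly_op X M p (\<lambda>x. c * v x) = (\<lambda>x. c * poly_op X M p v x)"
  by (induction p) (simp_all add: poly_op_pCons op_app_scale algebra_simps)

lemma poly_op_smult: "poly_op X M (Polynomial.smult c p) v = (\<lambda>x. c * poly_op X M p v x)"
  by (induction p) (simp_all add: poly_op_pCons op_app_scale algebra_simps)

lemma poly_op_add: "poly_op X M (p + q) v = (\<lambda>x. poly_op X M p v x + poly_op X M q v x)"
proof (induction p arbitrary: q)
  case 0
  then show ?case by simp
next
  case (pCons a p)
  obtain b r where q: "q = pCons b r" by (cases q)
  show ?case unfolding q by (simp add: poly_op_pCons pCons.IH op_app_add algebra_simps)
qed

lemma poly_op_sum: "poly_op X M (\<Sum>k\<in>K. f k) v x = (\<Sum>k\<in>K. poly_op X M (f k) v x)"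
  by (induction K rule: infinite_finite_induct) (simp_all add: poly_op_add)

text \<open>Splitting off a root \<open>z\<close> leaves \<open>q(M)\<close> applied to
  \<open>(M - z) v\<close>; this drives the descent on the degree in the search for an
  eigenvector.\<close>

lemma poly_op_linear_factor:
  "poly_op X M ([:- z, 1:] * q) v = poly_op X M q (\<lambda>x. op_app X M v x - z * v x)"
proof -
  have "[:- z, 1:] * q = Polynomial.smult (- z) q + pCons 0 q"
    by simp
  then show ?thesis
    by (simp only: poly_op_add poly_op_smult poly_op_pCons poly_op_diff poly_op_app poly_op_scale) simp
qed

lemma op_app_adj_hermitian:
  assumes "\<And>x y. x \<in> X \<Longrightarrow> y \<in> X \<Longrightarrow> M y x = cnj (M x y)" "x \<in> X"
  shows "op_app X (adj M) v x = op_app X M v x"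
  unfolding op_app_def adj_def
proof (rule sum.cong[OF refl])
  fix y assume "y \<in> X"
  then show "cnj (M y x) * v y = M x y * v y" by (subst assms(1)[OF assms(2)]) simp_all
qed

text \<open>The orthogonal complement of the eigenvectors found so far is invariant under
  \<open>M\<close>. The vectors \<open>v\<close>, \<open>M v\<close>, \<open>M\<^sup>2 v\<close>,
  ... in it are dependent, so some polynomial annihilates \<open>v\<close>. Its linear factors are
  applied in turn: either \<open>(M - z) w\<close> vanishes and \<open>w\<close> is an eigenvector,
  or \<open>(M - z) w\<close> is nonzero, still in the complement, and annihilated by a polynomial
  of smaller degree.\<close>

lemma eigenvector_in_complement:
  assumes X: "finite X" and herm: "\<And>x y. x \<in> X \<Longrightarrow> y \<in> X \<Longrightarrow> M y x = cnj (M x y)"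
    and eig: "\<And>i x. i < k \<Longrightarrow> x \<in> X \<Longrightarrow> op_app X M (u i) x = l i * u i x"
    and v: "norm_sq X v \<noteq> 0" "\<And>i. i < k \<Longrightarrow> ip X (u i) v = 0"
  shows "\<exists>w z. norm_sq X w \<noteq> 0 \<and> (\<forall>i<k. ip X (u i) w = 0) \<and> (\<forall>x\<in>X. op_app X M w x = z * w x)"
proof -
  have invariant: "ip X (u i) (op_app X M w) = 0" if "i < k" "ip X (u i) w = 0" for i w
  proof -
    have "ip X (u i) (op_app X M w) = ip X (op_app X (adj M) (u i)) w" by (rule ip_op_app)
    also have "\<dots> = ip X (\<lambda>x. l i * u i x) w"
    proof (rule ip_cong)
      fix x assume "x \<in> X"
      have "op_app X (adj M) (u i) x = op_app X M (u i) x"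
        by (rule op_app_adj_hermitian[OF herm \<open>x \<in> X\<close>])
      then show "op_app X (adj M) (u i) x = l i * u i x" using eig that \<open>x \<in> X\<close> by simp
    qed simp
    finally show ?thesis using that by (simp add: ip_scale_left)
  qed
  have step: "\<exists>w z. norm_sq X w \<noteq> 0 \<and> (\<forall>i<k. ip X (u i) w = 0) \<and> (\<forall>x\<in>X. op_app X M w x = z * w x)"
    if "degree p = n" "p \<noteq> 0" "\<forall>x\<in>X. poly_op X M p w x = 0"
      "norm_sq X w \<noteq> 0" "\<forall>i<k. ip X (u i) w = 0" for n p w
    using that
  proof (induction n arbitrary: p w)
    case 0
    then obtain c where "p = [:c:]" "c \<noteq> 0" by (metis degree_eq_zeroE pCons_eq_0_iff)
    then have "\<forall>x\<in>X. w x = 0" using 0 by (simp add: poly_op_pCons op_app_def)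
    then show ?case using 0 X by (simp add: norm_sq_eq_0_iff)
  next
    case (Suc n)
    then obtain z where "poly p z = 0"
      using fundamental_theorem_of_algebra[of p] constant_degree[of p] by auto
    then obtain q where q: "p = [:- z, 1:] * q" using poly_eq_0_iff_dvd by (auto simp: dvd_def)
    then have dq: "degree q = n" "q \<noteq> 0" using Suc.prems(1,2)
      by (auto simp: degree_mult_eq simp del: mult_pCons_left)
    let ?w = "\<lambda>x. op_app X M w x - z * w x"
    show ?case
    proof (cases "norm_sq X ?w = 0")
      case True
      then show ?thesis using Suc.prems X by (intro exI[of _ w] exI[of _ z]) (simp add: norm_sq_eq_0_iff)
    next
      case False
      have "\<forall>x\<in>X. poly_op X M q ?w x = 0" using Suc.prems(3) by (simp only: q poly_op_linear_factor)
      moreover have "\<forall>i<k. ip X (u i) ?w = 0"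
        using Suc.prems(5) by (simp add: ip_diff_right ip_scale_right invariant)
      ultimately show ?thesis using Suc.IH[OF dq(1) dq(2)] False by blast
    qed
  qed
  obtain c where c: "\<exists>j\<in>{..card X}. c j \<noteq> 0"
      "\<forall>x\<in>X. (\<Sum>j\<in>{..card X}. poly_op X M (Polynomial.monom 1 j) v x * c j) = 0"
    using homogeneous_system[of X "{..card X}" "\<lambda>x j. poly_op X M (Polynomial.monom 1 j) v x"] X by auto
  let ?p = "\<Sum>j\<le>card X. Polynomial.smult (c j) (Polynomial.monom 1 j)"
  have "\<forall>x\<in>X. poly_op X M ?p v x = 0"
    using c(2) by (simp add: poly_op_sum poly_op_smult mult.commute)
  moreover have "?p \<noteq> 0"
  proof -
    obtain j where "j \<le> card X" "c j \<noteq> 0" using c(1) by auto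
    then have "coeff ?p j \<noteq> 0" by (simp add: coeff_sum if_distrib sum.delta cong: if_cong)
    then show ?thesis by auto
  qed
  ultimately show ?thesis using step[of ?p "degree ?p" v] v by blast
qed

lemma hermitian_eigenvalue_real:
  assumes herm: "\<And>x y. x \<in> X \<Longrightarrow> y \<in> X \<Longrightarrow> M y x = cnj (M x y)"
    and "\<forall>x\<in>X. op_app X M w x = z * w x" "norm_sq X w \<noteq> 0"
  shows "z \<in> \<real>"
proof -
  have "z * ip X w w = ip X w (op_app X M w)"
    unfolding ip_scale_right[symmetric] using assms(2) by (intro ip_cong) auto
  also have "\<dots> = ip X (op_app X (adj M) w) w" by (rule ip_op_app)
  also have "\<dots> = ip X (op_app X M w) w"
    by (intro ip_cong op_app_adj_hermitian[OF herm]) simp_all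
  also have "\<dots> = cnj z * ip X w w"
    unfolding ip_scale_left[symmetric] using assms(2) by (intro ip_cong) auto
  finally have "z = cnj z" using assms(3) by (simp add: ip_self)
  then show ?thesis by (metis Reals_cnj_iff)
qed

lemma hermitian_eigenbasis:
  assumes X: "finite X" and herm: "\<And>x y. x \<in> X \<Longrightarrow> y \<in> X \<Longrightarrow> M y x = cnj (M x y)"
  shows "\<exists>u (l :: nat \<Rightarrow> real). orthonormal_on X (card X) u \<and>
    (\<forall>i<card X. \<forall>x\<in>X. op_app X M (u i) x = of_real (l i) * u i x)"
proof -
  have "\<exists>u (l :: nat \<Rightarrow> real). orthonormal_on X k u \<and>
    (\<forall>i<k. \<forall>x\<in>X. op_app X M (u i) x = of_real (l i) * u i x)" if "k \<le> card X" for k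
    using that
  proof (induction k)
    case 0
    then show ?case by (simp add: orthonormal_on_def)
  next
    case (Suc k)
    then obtain u and l :: "nat \<Rightarrow> real" where u: "orthonormal_on X k u"
      and l: "\<forall>i<k. \<forall>x\<in>X. op_app X M (u i) x = of_real (l i) * u i x" by (meson Suc_leD)
    obtain v where v: "norm_sq X v \<noteq> 0" "\<forall>i<k. ip X (u i) v = 0"
      using orthogonal_vector_exists[OF X, of k u] Suc.prems by auto
    have "\<exists>w z. norm_sq X w \<noteq> 0 \<and> (\<forall>i<k. ip X (u i) w = 0) \<and> (\<forall>x\<in>X. op_app X M w x = z * w x)"
      by (rule eigenvector_in_complement[OF X, where v = v and l = "\<lambda>i. of_real (l i)"])
        (use herm l v in blast)+
    then obtain w z where w: "norm_sq X w \<noteq> 0" "\<And>i. i < k \<Longrightarrow> ip X (u i) w = 0"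
      "\<forall>x\<in>X. op_app X M w x = z * w x" by blast
    have "z \<in> \<real>" by (rule hermitian_eigenvalue_real[OF _ w(3,1)]) (use herm in blast)
    then obtain z' where z': "z = of_real z'" by (rule Reals_cases)
    let ?c = "complex_of_real (1 / sqrt (norm_sq X w))"
    let ?u = "u(k := \<lambda>x. ?c * w x)"
    have "orthonormal_on X (Suc k) ?u" by (rule orthonormal_on_Suc[OF u w(2,1)])
    moreover have "op_app X M (?u i) x = of_real ((l(k := z')) i) * ?u i x" if "i < Suc k" "x \<in> X" for i x
    proof (cases "i = k")
      case True
      then show ?thesis using w(3) z' that(2) by (simp only: fun_upd_same op_app_scale) simp
    next
      case False
      then show ?thesis using l that by simp
    qed
    ultimately show ?case by (intro exI[of _ ?u] exI[of _ "l(k := z')"]) blast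
  qed
  then show ?thesis by blast
qed

section \<open>Positive operators\<close>

text \<open>The index set is arbitrary because the eigenvectors of a tensor power are indexed by
  lists. Orthonormality and completeness are both recorded, so that neither has to be recovered from
  a dimension count.\<close>

definition eigensystem ::
  "'x set \<Rightarrow> 'i set \<Rightarrow> ('i \<Rightarrow> 'x \<Rightarrow> complex) \<Rightarrow> ('i \<Rightarrow> real) \<Rightarrow> ('x, 'x) operator \<Rightarrow> bool" where
  "eigensystem X I u p \<rho> \<longleftrightarrow>
     (\<forall>i\<in>I. \<forall>j\<in>I. ip X (u i) (u j) = of_bool (i = j)) \<and>
     (\<forall>x\<in>X. \<forall>y\<in>X. (\<Sum>i\<in>I. u i x * cnj (u i y)) = of_bool (x = y)) \<and>
     (\<forall>x\<in>X. \<forall>y\<in>X. \<rho> x y = (\<Sum>i\<in>I. of_real (p i) * (u i x * cnj (u i y))))"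

text \<open>\<open>\<rho>\<close> is the mixture of the unnormalised vectors \<open>f j\<close>;
  equivalently, the \<open>f j\<close> are the branches of a purification by a register with basis
  \<open>J\<close>. One \<open>\<rho>\<close> has many such families.\<close>

definition gram :: "'x set \<Rightarrow> 'j set \<Rightarrow> ('j \<Rightarrow> 'x \<Rightarrow> complex) \<Rightarrow> ('x, 'x) operator \<Rightarrow> bool" where
  "gram X J f \<rho> \<longleftrightarrow> (\<forall>x\<in>X. \<forall>y\<in>X. \<rho> x y = (\<Sum>j\<in>J. f j x * cnj (f j y)))"

lemma positive_op_iff:
  "positive_op X M \<longleftrightarrow> (\<forall>v. ip X v (op_app X M v) \<in> \<real> \<and> 0 \<le> Re (ip X v (op_app X M v)))"
  by (simp add: positive_op_def ip_def op_app_def Let_def sum_distrib_left mult.assoc)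

lemma op_app_cong_op:
  "(\<And>x. x \<in> X \<Longrightarrow> M y x = M' y x) \<Longrightarrow> op_app X M v y = op_app X M' v y"
  by (simp add: op_app_def)

lemma op_app_basis: "finite X \<Longrightarrow> x \<in> X \<Longrightarrow> op_app X M (\<lambda>y. of_bool (y = x)) z = M z x"
  by (simp add: op_app_def of_bool_def if_distrib sum.delta cong: if_cong)

lemma ip_basis: "finite X \<Longrightarrow> x \<in> X \<Longrightarrow> ip X (\<lambda>y. of_bool (y = x)) v = v x"
  by (simp add: ip_def of_bool_def if_distrib if_distribR sum.delta cong: if_cong)

lemma gram_ip:
  assumes "gram X J f \<rho>"
  shows "ip X v (op_app X \<rho> v) = of_real (\<Sum>j\<in>J. (cmod (ip X v (f j)))\<^sup>2)"
proof -
  have "ip X v (op_app X \<rho> v) = (\<Sum>x\<in>X. \<Sum>y\<in>X. \<Sum>j\<in>J. cnj (v x) * f j x * (cnj (f j y) * v y))"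
    unfolding ip_def op_app_def using assms
    by (simp add: gram_def sum_distrib_left sum_distrib_right mult_ac)
  also have "\<dots> = (\<Sum>x\<in>X. \<Sum>j\<in>J. \<Sum>y\<in>X. cnj (v x) * f j x * (cnj (f j y) * v y))"
    by (intro sum.cong refl, rule sum.swap)
  also have "\<dots> = (\<Sum>j\<in>J. \<Sum>x\<in>X. \<Sum>y\<in>X. cnj (v x) * f j x * (cnj (f j y) * v y))"
    by (rule sum.swap)
  also have "\<dots> = (\<Sum>j\<in>J. ip X v (f j) * ip X (f j) v)"
    by (simp add: ip_def sum_product)
  also have "\<dots> = (\<Sum>j\<in>J. of_real ((cmod (ip X v (f j)))\<^sup>2))"
    by (simp add: complex_norm_square ip_cnj del: of_real_power)
  finally show ?thesis by simp
qed

lemma gram_positive: "gram X J f \<rho> \<Longrightarrow> positive_op X \<rho>"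
  by (simp add: positive_op_iff gram_ip sum_nonneg)

lemma eigensystem_gram:
  assumes "eigensystem X I u p \<rho>" "\<And>i. i \<in> I \<Longrightarrow> 0 \<le> p i"
  shows "gram X I (\<lambda>i x. of_real (sqrt (p i)) * u i x) \<rho>"
  unfolding gram_def
proof (intro ballI)
  fix x y assume "x \<in> X" "y \<in> X"
  have sq: "complex_of_real (sqrt (p i)) * complex_of_real (sqrt (p i)) = of_real (p i)" if "i \<in> I" for i
    using assms(2)[OF that] by (simp flip: of_real_mult)
  have "\<rho> x y = (\<Sum>i\<in>I. of_real (p i) * (u i x * cnj (u i y)))"
    using assms(1) \<open>x \<in> X\<close> \<open>y \<in> X\<close> by (simp add: eigensystem_def)
  also have "\<dots> = (\<Sum>i\<in>I. of_real (sqrt (p i)) * u i x * cnj (of_real (sqrt (p i)) * u i y))"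
    by (rule sum.cong[OF refl], subst sq[symmetric]) (simp_all add: mult_ac)
  finally show "\<rho> x y = (\<Sum>i\<in>I. of_real (sqrt (p i)) * u i x * cnj (of_real (sqrt (p i)) * u i y))" .
qed

text \<open>The quadratic form is real at the basis vector \<open>x\<close> plus \<open>c\<close>
  times the basis vector \<open>y\<close>. The values \<open>c = 1\<close> and
  \<open>c = \<i>\<close> yield the imaginary and the real part of the claim.\<close>

lemma positive_op_hermitian:
  assumes "finite X" "positive_op X M" "x \<in> X" "y \<in> X"
  shows "M y x = cnj (M x y)"
proof -
  have diag: "M z z \<in> \<real>" if "z \<in> X" for z
    using assms(2)[unfolded positive_op_iff, THEN spec[of _ "\<lambda>w. of_bool (w = z)"]] assms(1) that
    by (simp add: op_app_basis ip_basis)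
  have pair: "M x x + cnj c * c * M y y + c * M x y + cnj c * M y x \<in> \<real>" if "x \<noteq> y" for c
  proof -
    let ?v = "\<lambda>z. if z = x then 1 else if z = y then c else 0"
    have sup: "(\<Sum>z\<in>X. g z * ?v z) = g x + g y * c" "(\<Sum>z\<in>X. cnj (?v z) * g z) = g x + cnj c * g y" for g
    proof -
      have "(\<Sum>z\<in>X. g z * ?v z) = (\<Sum>z\<in>{x, y}. g z * ?v z)"
        using assms by (intro sum.mono_neutral_right) auto
      then show "(\<Sum>z\<in>X. g z * ?v z) = g x + g y * c" using that by simp
      have "(\<Sum>z\<in>X. cnj (?v z) * g z) = (\<Sum>z\<in>{x, y}. cnj (?v z) * g z)"
        using assms by (intro sum.mono_neutral_right) auto
      then show "(\<Sum>z\<in>X. cnj (?v z) * g z) = g x + cnj c * g y" using that by simp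
    qed
    have "ip X ?v (op_app X M ?v) \<in> \<real>" using assms(2) by (simp add: positive_op_iff)
    then show ?thesis unfolding ip_def op_app_def sup by (simp add: algebra_simps)
  qed
  show ?thesis
  proof (cases "x = y")
    case True
    then show ?thesis using diag[OF assms(3)] by (auto elim: Reals_cases)
  next
    case False
    have "Im (M x x) = 0" "Im (M y y) = 0" using diag assms by (auto simp: complex_is_Real_iff)
    with pair[OF False, of 1] pair[OF False, of \<i>] show ?thesis
      by (auto simp: complex_is_Real_iff complex_eq_iff)
  qed
qed

lemma eigensystem_exists:
  assumes X: "finite X" and herm: "\<And>x y. x \<in> X \<Longrightarrow> y \<in> X \<Longrightarrow> M y x = cnj (M x y)"
  shows "\<exists>u p. eigensystem X {..<card X} u p M"
proof -
  obtain u and l :: "nat \<Rightarrow> real" where u: "orthonormal_on X (card X) u"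
    and l: "\<And>i x. i < card X \<Longrightarrow> x \<in> X \<Longrightarrow> op_app X M (u i) x = of_real (l i) * u i x"
    using hermitian_eigenbasis[of X M] assms by blast
  have complete: "(\<Sum>i<card X. u i x * cnj (u i y)) = of_bool (x = y)" if "x \<in> X" "y \<in> X" for x y
    by (rule orthonormal_on_complete[OF X u that])
  have "M x y = (\<Sum>i<card X. of_real (l i) * (u i x * cnj (u i y)))" if "x \<in> X" "y \<in> X" for x y
  proof -
    have "M x y = (\<Sum>z\<in>X. M x z * of_bool (z = y))"
      using X that by (simp add: of_bool_def if_distrib sum.delta cong: if_cong)
    also have "\<dots> = (\<Sum>z\<in>X. M x z * (\<Sum>i<card X. u i z * cnj (u i y)))"
      using that by (simp add: complete)
    also have "\<dots> = (\<Sum>i<card X. op_app X M (u i) x * cnj (u i y))"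
      by (simp add: op_app_def sum_distrib_left sum_distrib_right sum.swap[of _ X] mult.assoc)
    also have "\<dots> = (\<Sum>i<card X. of_real (l i) * (u i x * cnj (u i y)))"
      using that by (simp add: l mult.assoc)
    finally show ?thesis .
  qed
  then have "eigensystem X {..<card X} u l M"
    unfolding eigensystem_def using u complete by (auto simp: orthonormal_on_def)
  then show ?thesis by blast
qed

lemma eigensystem_eigenvector:
  assumes "eigensystem X I u p M" "i \<in> I" "finite I" "x \<in> X"
  shows "op_app X M (u i) x = of_real (p i) * u i x"
proof -
  have "op_app X M (u i) x = (\<Sum>y\<in>X. (\<Sum>j\<in>I. of_real (p j) * (u j x * cnj (u j y))) * u i y)"
    unfolding op_app_def using assms(1,4) by (simp add: eigensystem_def)
  also have "\<dots> = (\<Sum>j\<in>I. of_real (p j) * u j x * ip X (u j) (u i))"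
    by (simp add: ip_def sum_distrib_left sum_distrib_right sum.swap[of _ X] mult.assoc)
  also have "\<dots> = (\<Sum>j\<in>I. if j = i then of_real (p j) * u j x else 0)"
    using assms by (intro sum.cong) (auto simp: eigensystem_def)
  finally show ?thesis using assms by simp
qed

lemma eigensystem_ip:
  assumes "eigensystem X I u p M" "i \<in> I" "finite I"
  shows "ip X (u i) (op_app X M (u i)) = of_real (p i)"
proof -
  have "ip X (u i) (op_app X M (u i)) = ip X (u i) (\<lambda>x. of_real (p i) * u i x)"
    by (rule ip_cong) (auto simp: eigensystem_eigenvector[OF assms])
  then show ?thesis using assms by (simp add: ip_scale_right eigensystem_def)
qed

lemma positive_op_eigensystem:
  assumes "finite X" "positive_op X M"
  shows "\<exists>u p. eigensystem X {..<card X} u p M \<and> (\<forall>i<card X. 0 \<le> p i)"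
proof -
  obtain u p where "eigensystem X {..<card X} u p M"
    using eigensystem_exists[OF assms(1), of M] positive_op_hermitian[OF assms] by blast
  moreover have "0 \<le> p i" if "i < card X" for i
    using eigensystem_ip[OF calculation, of i] assms(2) that unfolding positive_op_iff
    by (metis Re_complex_of_real finite_lessThan lessThan_iff)
  ultimately show ?thesis by blast
qed

lemma positive_op_gram:
  assumes "finite X" "positive_op X M"
  shows "\<exists>f. gram X {..<card X} f M"
proof -
  obtain u p where "eigensystem X {..<card X} u p M" "\<And>i. i \<in> {..<card X} \<Longrightarrow> 0 \<le> p i"
    using positive_op_eigensystem[OF assms] by auto
  from eigensystem_gram[OF this] show ?thesis by blast
qed

text \<open>\<open>op_sqrt\<close> is chosen by \<open>SOME\<close>; the roots of the eigenvalues
  supply a witness, and these two properties are what later proofs use of it.\<close>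

lemma op_sqrt_properties:
  assumes "finite X" "positive_op X \<rho>"
  shows "positive_op X (op_sqrt X \<rho>)"
    and "\<And>x y. x \<in> X \<Longrightarrow> y \<in> X \<Longrightarrow> op_mult X (op_sqrt X \<rho>) (op_sqrt X \<rho>) x y = \<rho> x y"
proof -
  obtain u p where up: "eigensystem X {..<card X} u p \<rho>" "\<And>i. i < card X \<Longrightarrow> 0 \<le> p i"
    using positive_op_eigensystem[OF assms] by blast
  define \<sigma> where "\<sigma> = (\<lambda>x y. \<Sum>i<card X. of_real (sqrt (p i)) * (u i x * cnj (u i y)))"
  have "eigensystem X {..<card X} u (\<lambda>i. sqrt (p i)) \<sigma>"
    using up(1) by (simp add: eigensystem_def \<sigma>_def)
  then have pos: "positive_op X \<sigma>"
    by (rule gram_positive[OF eigensystem_gram]) (simp add: up(2))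
  have "op_mult X \<sigma> \<sigma> x y = \<rho> x y" if "x \<in> X" "y \<in> X" for x y
  proof -
    have "op_mult X \<sigma> \<sigma> x y = (\<Sum>i<card X. \<Sum>j<card X. \<Sum>z\<in>X.
        of_real (sqrt (p i)) * (u i x * cnj (u i z)) * (of_real (sqrt (p j)) * (u j z * cnj (u j y))))"
      unfolding op_mult_def \<sigma>_def sum_product
      by (subst sum.swap, rule sum.cong[OF refl], rule sum.swap)
    also have "\<dots> = (\<Sum>i<card X. \<Sum>j<card X.
        of_real (sqrt (p i)) * u i x * (of_real (sqrt (p j)) * cnj (u j y)) * ip X (u i) (u j))"
      by (simp add: ip_def sum_distrib_left mult_ac)
    also have "\<dots> = (\<Sum>i<card X. \<Sum>j<card X.
        if j = i then of_real (sqrt (p i)) * u i x * (of_real (sqrt (p j)) * cnj (u j y)) else 0)"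
      using up(1) by (intro sum.cong) (auto simp: eigensystem_def)
    also have "\<dots> = (\<Sum>i<card X. (of_real (sqrt (p i)) * of_real (sqrt (p i))) * (u i x * cnj (u i y)))"
      by (simp add: mult_ac)
    also have "\<dots> = (\<Sum>i<card X. of_real (p i) * (u i x * cnj (u i y)))"
      using up(2) by (intro sum.cong refl) (simp flip: of_real_mult)
    also have "\<dots> = \<rho> x y" using up that by (simp add: eigensystem_def)
    finally show ?thesis .
  qed
  with pos have "\<exists>\<sigma>. positive_op X \<sigma> \<and> (\<forall>x\<in>X. \<forall>y\<in>X. op_mult X \<sigma> \<sigma> x y = \<rho> x y)" by blast
  then have *: "positive_op X (op_sqrt X \<rho>) \<and> (\<forall>x\<in>X. \<forall>y\<in>X. op_mult X (op_sqrt X \<rho>) (op_sqrt X \<rho>) x y = \<rho> x y)"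
    unfolding op_sqrt_def by (rule someI_ex)
  then show "positive_op X (op_sqrt X \<rho>)"
    "\<And>x y. x \<in> X \<Longrightarrow> y \<in> X \<Longrightarrow> op_mult X (op_sqrt X \<rho>) (op_sqrt X \<rho>) x y = \<rho> x y" by auto
qed

lemma op_sqrt_gram:
  assumes "finite X" "positive_op X \<rho>"
  shows "gram X X (\<lambda>j x. op_sqrt X \<rho> x j) \<rho>"
  unfolding gram_def
proof (intro ballI)
  fix x y assume xy: "x \<in> X" "y \<in> X"
  have "\<rho> x y = (\<Sum>j\<in>X. op_sqrt X \<rho> x j * op_sqrt X \<rho> j y)"
    using op_sqrt_properties(2)[OF assms xy] by (simp add: op_mult_def)
  also have "\<dots> = (\<Sum>j\<in>X. op_sqrt X \<rho> x j * cnj (op_sqrt X \<rho> y j))"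
    using positive_op_hermitian[OF assms(1) op_sqrt_properties(1)[OF assms] xy(2)]
    by (intro sum.cong) auto
  finally show "\<rho> x y = (\<Sum>j\<in>X. op_sqrt X \<rho> x j * cnj (op_sqrt X \<rho> y j))" .
qed

lemma gram_sum_norm_sq:
  assumes "gram X J f \<rho>"
  shows "of_real (\<Sum>j\<in>J. norm_sq Y (op_app X M (f j)))
    = (\<Sum>y\<in>Y. \<Sum>x\<in>X. \<Sum>x'\<in>X. M y x * \<rho> x x' * cnj (M y x'))"
proof -
  have "(\<Sum>y\<in>Y. \<Sum>x\<in>X. \<Sum>x'\<in>X. M y x * \<rho> x x' * cnj (M y x'))
      = (\<Sum>y\<in>Y. \<Sum>x\<in>X. \<Sum>x'\<in>X. \<Sum>j\<in>J. M y x * f j x * cnj (M y x' * f j x'))"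
    using assms by (intro sum.cong refl) (simp add: gram_def sum_distrib_left sum_distrib_right mult_ac)
  also have "\<dots> = (\<Sum>y\<in>Y. \<Sum>x\<in>X. \<Sum>j\<in>J. \<Sum>x'\<in>X. M y x * f j x * cnj (M y x' * f j x'))"
    by (intro sum.cong refl, rule sum.swap)
  also have "\<dots> = (\<Sum>y\<in>Y. \<Sum>j\<in>J. \<Sum>x\<in>X. \<Sum>x'\<in>X. M y x * f j x * cnj (M y x' * f j x'))"
    by (intro sum.cong refl, rule sum.swap)
  also have "\<dots> = (\<Sum>j\<in>J. \<Sum>y\<in>Y. \<Sum>x\<in>X. \<Sum>x'\<in>X. M y x * f j x * cnj (M y x' * f j x'))"
    by (rule sum.swap)
  also have "\<dots> = (\<Sum>j\<in>J. ip Y (op_app X M (f j)) (op_app X M (f j)))"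
    by (simp add: ip_def op_app_def sum_product mult.commute)
  finally show ?thesis by (simp add: ip_self)
qed

text \<open>Both sides are the trace of \<open>M \<rho> M\<^sup>\<dagger>\<close>, which does not
  see how \<open>\<rho>\<close> is split into vectors. This is how weights are moved from one family
  to another.\<close>

lemma gram_norm_sq_unique:
  assumes "gram X J f \<rho>" "gram X K g \<rho>"
  shows "(\<Sum>j\<in>J. norm_sq Y (op_app X M (f j))) = (\<Sum>k\<in>K. norm_sq Y (op_app X M (g k)))"
  using gram_sum_norm_sq[OF assms(1), of Y M] gram_sum_norm_sq[OF assms(2), of Y M] by (metis of_real_eq_iff)

section \<open>Bessel's inequality, the trace norm and the fidelity\<close>

lemma Bessel_inequality:
  assumes I: "finite I" and on: "\<And>i j. i \<in> I \<Longrightarrow> j \<in> I \<Longrightarrow> ip X (w i) (w j) = of_bool (i = j)"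
  shows "(\<Sum>i\<in>I. (cmod (ip X (w i) v))\<^sup>2) \<le> norm_sq X v"
proof -
  let ?c = "\<lambda>i. ip X (w i) v"
  let ?s = "\<lambda>x. \<Sum>i\<in>I. ?c i * w i x"
  let ?r = "\<lambda>x. v x - ?s x"
  have orth: "ip X (w j) ?r = 0" if "j \<in> I" for j
  proof -
    have "ip X (w j) ?s = (\<Sum>i\<in>I. ?c i * ip X (w j) (w i))"
      by (simp add: ip_sum_right ip_scale_right)
    also have "\<dots> = (\<Sum>i\<in>I. if i = j then ?c i else 0)"
      using on that by (intro sum.cong) auto
    finally show ?thesis using I that by (simp add: ip_diff_right)
  qed
  have "ip X ?r ?s = (\<Sum>i\<in>I. ?c i * ip X ?r (w i))"
    by (simp add: ip_sum_right ip_scale_right)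
  also have "\<dots> = 0"
    by (intro sum.neutral ballI, subst ip_cnj[symmetric]) (simp only: orth complex_cnj_zero mult_zero_right)
  finally have "of_real (norm_sq X ?r) = ip X ?r v"
    by (simp add: ip_self[symmetric] ip_diff_right)
  also have "\<dots> = cnj (ip X v ?r)" by (simp add: ip_cnj)
  also have "ip X v ?r = ip X v v - (\<Sum>i\<in>I. ?c i * ip X v (w i))"
    by (simp only: ip_diff_right ip_sum_right ip_scale_right)
  also have "(\<Sum>i\<in>I. ?c i * ip X v (w i)) = (\<Sum>i\<in>I. of_real ((cmod (?c i))\<^sup>2))"
    by (rule sum.cong[OF refl], subst ip_cnj[of X _ v, symmetric]) (simp add: complex_norm_square del: of_real_power)
  finally have "complex_of_real (norm_sq X ?r) = of_real (norm_sq X v - (\<Sum>i\<in>I. (cmod (?c i))\<^sup>2))"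
    by (simp add: ip_self)
  then have "norm_sq X ?r = norm_sq X v - (\<Sum>i\<in>I. (cmod (?c i))\<^sup>2)" by (simp only: of_real_eq_iff)
  then show ?thesis using norm_sq_nonneg[of X ?r] by linarith
qed

text \<open>The right-hand side is the squared Hilbert-Schmidt norm of \<open>N\<close>; the claim
  is Bessel's inequality for the conjugated rows of \<open>N\<close>, summed over the rows.\<close>

lemma Bessel_op:
  assumes "finite I" "\<And>i j. i \<in> I \<Longrightarrow> j \<in> I \<Longrightarrow> ip X (w i) (w j) = of_bool (i = j)"
  shows "(\<Sum>i\<in>I. norm_sq Y (op_app X N (w i))) \<le> (\<Sum>x\<in>X. norm_sq Y (\<lambda>y. N y x))"
proof -
  have "(\<Sum>i\<in>I. norm_sq Y (op_app X N (w i))) = (\<Sum>y\<in>Y. \<Sum>i\<in>I. (cmod (ip X (w i) (\<lambda>x. cnj (N y x))))\<^sup>2)"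
  proof -
    have "cmod (op_app X N (w i) y) = cmod (ip X (w i) (\<lambda>x. cnj (N y x)))" for i y
      by (subst complex_mod_cnj[symmetric]) (simp add: op_app_def ip_def mult.commute)
    then show ?thesis unfolding norm_sq_def by (subst sum.swap) simp
  qed
  also have "\<dots> \<le> (\<Sum>y\<in>Y. norm_sq X (\<lambda>x. cnj (N y x)))"
    by (intro sum_mono Bessel_inequality assms)
  also have "\<dots> = (\<Sum>x\<in>X. norm_sq Y (\<lambda>y. N y x))"
    by (simp add: norm_sq_def) (rule sum.swap)
  finally show ?thesis .
qed

lemma sum_ip_le:
  "(\<Sum>i\<in>I. cmod (ip Y (a i) (b i))) \<le> sqrt (\<Sum>i\<in>I. norm_sq Y (a i)) * sqrt (\<Sum>i\<in>I. norm_sq Y (b i))"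
proof -
  have "(\<Sum>i\<in>I. cmod (ip Y (a i) (b i))) \<le> (\<Sum>i\<in>I. \<bar>sqrt (norm_sq Y (a i))\<bar> * \<bar>sqrt (norm_sq Y (b i))\<bar>)"
    by (intro sum_mono order_trans[OF Cauchy_Schwarz_ip]) simp
  also have "\<dots> \<le> L2_set (\<lambda>i. sqrt (norm_sq Y (a i))) I * L2_set (\<lambda>i. sqrt (norm_sq Y (b i))) I"
    by (rule L2_set_mult_ineq)
  finally show ?thesis by (simp add: L2_set_def)
qed

text \<open>A polar decomposition of \<open>K\<close>, restricted to its support.\<close>

lemma trace_norm_representation:
  assumes X: "finite X"
  obtains I :: "nat set" and u w where "finite I"
    "\<And>i j. i \<in> I \<Longrightarrow> j \<in> I \<Longrightarrow> ip X (u i) (u j) = of_bool (i = j)"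
    "\<And>i j. i \<in> I \<Longrightarrow> j \<in> I \<Longrightarrow> ip X (w i) (w j) = of_bool (i = j)"
    "of_real (trace_norm X K) = (\<Sum>i\<in>I. ip X (w i) (op_app X K (u i)))"
    "0 \<le> trace_norm X K"
proof -
  let ?A = "op_mult X (adj K) K"
  let ?S = "op_sqrt X ?A"
  have "gram X X (\<lambda>j x. cnj (K j x)) ?A" by (simp add: gram_def op_mult_def adj_def)
  then have A: "positive_op X ?A" by (rule gram_positive)
  note S = op_sqrt_properties[OF X A]
  obtain u s where us: "eigensystem X {..<card X} u s ?S" "\<And>i. i < card X \<Longrightarrow> 0 \<le> s i"
    using positive_op_eigensystem[OF X S(1)] by blast
  have on: "ip X (u i) (u j) = of_bool (i = j)" if "i < card X" "j < card X" for i j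
    using us(1) that by (simp add: eigensystem_def)
  have eig: "op_app X ?S (u i) x = of_real (s i) * u i x" if "i < card X" "x \<in> X" for i x
    using eigensystem_eigenvector[OF us(1)] that by simp
  have Au: "op_app X ?A (u i) x = of_real ((s i)\<^sup>2) * u i x" if "i < card X" "x \<in> X" for i x
  proof -
    have "op_app X ?A (u i) x = op_app X (op_mult X ?S ?S) (u i) x"
      using S(2) that by (intro op_app_cong_op) simp
    also have "\<dots> = op_app X ?S (\<lambda>x. of_real (s i) * u i x) x"
      unfolding op_app_mult using eig that by (intro fun_cong[OF op_app_cong]) auto
    also have "\<dots> = of_real ((s i)\<^sup>2) * u i x"
      using eig that by (simp add: op_app_scale power2_eq_square)
    finally show ?thesis .
  qed
  have KK: "ip X (op_app X K (u i)) (op_app X K (u j)) = of_real ((s j)\<^sup>2) * of_bool (i = j)"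
    if "i < card X" "j < card X" for i j
  proof -
    have "ip X (op_app X K (u i)) (op_app X K (u j)) = ip X (op_app X (adj K) (op_app X K (u i))) (u j)"
      by (rule ip_op_app)
    also have "\<dots> = ip X (\<lambda>x. of_real ((s i)\<^sup>2) * u i x) (u j)"
      unfolding op_app_mult[symmetric] using Au that by (intro ip_cong) auto
    also have "\<dots> = of_real ((s i)\<^sup>2) * ip X (u i) (u j)"
      by (simp add: ip_scale_left del: of_real_power)
    finally show ?thesis using on that by auto
  qed
  \<comment> \<open>The \<open>s i\<close> are the singular values of \<open>K\<close>. Where
    \<open>s i = 0\<close>, \<open>K\<close> annihilates \<open>u i\<close>, so restricting to
    positive values loses nothing and allows the images of the \<open>u i\<close> to be
    normalised.\<close>
  let ?I = "{i. i < card X \<and> 0 < s i}"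
  let ?w = "\<lambda>i x. of_real (1 / s i) * op_app X K (u i) x"
  have tr: "op_trace X ?S = of_real (\<Sum>i<card X. s i)"
  proof -
    have "op_trace X ?S = (\<Sum>x\<in>X. \<Sum>i<card X. of_real (s i) * (u i x * cnj (u i x)))"
      unfolding op_trace_def using us(1) by (simp add: eigensystem_def)
    also have "\<dots> = (\<Sum>i<card X. of_real (s i) * ip X (u i) (u i))"
      by (subst sum.swap) (simp add: ip_def sum_distrib_left mult_ac)
    finally show ?thesis using on by simp
  qed
  then have T: "trace_norm X K = (\<Sum>i<card X. s i)" unfolding trace_norm_def by simp
  show thesis
  proof
    show "finite ?I" by simp
    show "ip X (u i) (u j) = of_bool (i = j)" if "i \<in> ?I" "j \<in> ?I" for i j using on that by simp
    show "ip X (?w i) (?w j) = of_bool (i = j)" if "i \<in> ?I" "j \<in> ?I" for i j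
      using that unfolding ip_scale_left ip_scale_right by (simp add: KK power2_eq_square)
    have "(\<Sum>i\<in>?I. ip X (?w i) (op_app X K (u i))) = (\<Sum>i\<in>?I. of_real (s i))"
      unfolding ip_scale_left by (intro sum.cong refl) (simp add: KK power2_eq_square)
    also have "\<dots> = (\<Sum>i<card X. of_real (s i))"
      using us(2) by (intro sum.mono_neutral_left) force+
    finally show "of_real (trace_norm X K) = (\<Sum>i\<in>?I. ip X (?w i) (op_app X K (u i)))"
      by (simp add: T)
    show "0 \<le> trace_norm X K" unfolding T using us(2) by (intro sum_nonneg) auto
  qed
qed

lemma norm_sq_basis_expansion:
  assumes "gram X J f \<rho>" "finite X" "positive_op X \<rho>"
  shows "(\<Sum>x\<in>X. norm_sq Y (\<lambda>y. op_mult X M (op_sqrt X \<rho>) y x)) = (\<Sum>j\<in>J. norm_sq Y (op_app X M (f j)))"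
proof -
  have "(\<lambda>y. op_mult X M (op_sqrt X \<rho>) y x) = op_app X M (\<lambda>z. op_sqrt X \<rho> z x)" for x
    by (simp add: op_mult_def op_app_def)
  then show ?thesis
    using gram_norm_sq_unique[OF op_sqrt_gram[OF assms(2,3)] assms(1), of Y M] by simp
qed

text \<open>High fidelity forces \<open>\<rho>\<close> to pass any contraction \<open>M\<close> that
  barely disturbs \<open>\<sigma>\<close>. The trace norm is a sum of overlaps of
  \<open>a = \<surd>\<rho> w\<close> and \<open>b = \<surd>\<sigma> u\<close>, and each equals
  \<open><M a, M b> + <a, (1 - M\<^sup>\<dagger> M) b>\<close>. Cauchy-Schwarz bounds the two sums,
  and Bessel's inequality compares the factors with the families \<open>g\<close> and
  \<open>f\<close>. One inequality thus does the work of both monotonicity of the fidelity and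
  gentle measurement.\<close>

lemma fidelity_test:
  assumes X: "finite X" and g: "gram X J g \<rho>" and f: "gram X E f \<sigma>"
    and g1: "(\<Sum>j\<in>J. norm_sq X (g j)) = 1" and f1: "(\<Sum>e\<in>E. norm_sq X (f e)) = 1"
    and M: "\<And>v. norm_sq Y (op_app X M v) \<le> norm_sq X v"
    and P: "purified_distance X \<rho> \<sigma> \<le> \<epsilon>" and eps: "0 < \<epsilon>"
  shows "sqrt (1 - \<epsilon>\<^sup>2) \<le> sqrt (\<Sum>j\<in>J. norm_sq Y (op_app X M (g j)))
    + sqrt (\<Sum>e\<in>E. norm_sq X (\<lambda>x. f e x - op_app Y (adj M) (op_app X M (f e)) x))"
proof -
  note pr = gram_positive[OF g] and ps = gram_positive[OF f]
  let ?R = "op_sqrt X \<rho>" and ?S = "op_sqrt X \<sigma>"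
  let ?one = "\<lambda>x y. of_bool (x = y) :: complex"
  let ?N = "\<lambda>x y. ?one x y - op_mult Y (adj M) M x y"
  have one: "op_app X ?one v x = v x" if "x \<in> X" for v x
    using X that by (simp add: op_app_def sum_of_bool)
  have N: "op_app X ?N v x = v x - op_app Y (adj M) (op_app X M v) x" if "x \<in> X" for v x
  proof -
    have "op_app X ?N v x = op_app X ?one v x - op_app X (op_mult Y (adj M) M) v x"
      unfolding op_app_def left_diff_distrib sum_subtractf ..
    then show ?thesis by (simp only: one[OF that] op_app_mult)
  qed
  obtain I :: "nat set" and u w where I: "finite I"
    and u: "\<And>i j. i \<in> I \<Longrightarrow> j \<in> I \<Longrightarrow> ip X (u i) (u j) = of_bool (i = j)"
    and w: "\<And>i j. i \<in> I \<Longrightarrow> j \<in> I \<Longrightarrow> ip X (w i) (w j) = of_bool (i = j)"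
    and T: "of_real (trace_norm X (op_mult X ?R ?S)) = (\<Sum>i\<in>I. ip X (w i) (op_app X (op_mult X ?R ?S) (u i)))"
    and T0: "0 \<le> trace_norm X (op_mult X ?R ?S)"
    by (rule trace_norm_representation[OF X, of "op_mult X ?R ?S"]) (rule that)
  let ?a = "\<lambda>i. op_app X ?R (w i)" and ?b = "\<lambda>i. op_app X ?S (u i)"
  let ?T = "trace_norm X (op_mult X ?R ?S)"
  have Rherm: "\<And>x y. x \<in> X \<Longrightarrow> y \<in> X \<Longrightarrow> ?R y x = cnj (?R x y)"
    by (rule positive_op_hermitian[OF X op_sqrt_properties(1)[OF X pr]])
  have split: "ip X (w i) (op_app X (op_mult X ?R ?S) (u i))
      = ip Y (op_app X M (?a i)) (op_app X M (?b i)) + ip X (?a i) (op_app X ?N (?b i))" for i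
  proof -
    have "ip X (w i) (op_app X (op_mult X ?R ?S) (u i)) = ip X (op_app X (adj ?R) (w i)) (?b i)"
      unfolding op_app_mult by (rule ip_op_app)
    also have "\<dots> = ip X (?a i) (?b i)"
      by (rule ip_cong[OF op_app_adj_hermitian[OF Rherm]]) simp_all
    also have "\<dots> = ip X (?a i) (op_app Y (adj M) (op_app X M (?b i))) + ip X (?a i) (op_app X ?N (?b i))"
      unfolding ip_def sum.distrib[symmetric] distrib_left[symmetric] by (intro sum.cong refl) (simp add: N)
    also have "ip X (?a i) (op_app Y (adj M) (op_app X M (?b i))) = ip Y (op_app X M (?a i)) (op_app X M (?b i))"
      by (subst ip_op_app) (simp add: adj_def)
    finally show ?thesis .
  qed
  have bessel: "(\<Sum>i\<in>I. norm_sq Z (op_app X L (op_app X ?R (w i)))) \<le> (\<Sum>j\<in>J. norm_sq Z (op_app X L (g j)))"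
    for Z :: "'z set" and L :: "('z, 'a) operator"
    using Bessel_op[OF I w, where Y = Z and N = "op_mult X L ?R"] norm_sq_basis_expansion[OF g X pr, where Y = Z and M = L]
    by (simp add: op_app_mult)
  have bessel': "(\<Sum>i\<in>I. norm_sq Z (op_app X L (op_app X ?S (u i)))) \<le> (\<Sum>e\<in>E. norm_sq Z (op_app X L (f e)))"
    for Z :: "'z set" and L :: "('z, 'a) operator"
    using Bessel_op[OF I u, where Y = Z and N = "op_mult X L ?S"] norm_sq_basis_expansion[OF f X ps, where Y = Z and M = L]
    by (simp add: op_app_mult)
  have id: "norm_sq X (op_app X ?one v) = norm_sq X v" for v
    using one by (rule norm_sq_cong)
  have "?T = cmod (of_real ?T)" using T0 by simp
  also have "\<dots> \<le> (\<Sum>i\<in>I. cmod (ip Y (op_app X M (?a i)) (op_app X M (?b i))))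
      + (\<Sum>i\<in>I. cmod (ip X (?a i) (op_app X ?N (?b i))))"
    unfolding T split sum.distrib[symmetric]
    by (rule order_trans[OF norm_sum]) (intro sum_mono norm_triangle_ineq)
  also have "\<dots> \<le> sqrt (\<Sum>i\<in>I. norm_sq Y (op_app X M (?a i))) * sqrt (\<Sum>i\<in>I. norm_sq Y (op_app X M (?b i)))
      + sqrt (\<Sum>i\<in>I. norm_sq X (?a i)) * sqrt (\<Sum>i\<in>I. norm_sq X (op_app X ?N (?b i)))"
    by (intro add_mono sum_ip_le)
  also have "\<dots> \<le> sqrt (\<Sum>j\<in>J. norm_sq Y (op_app X M (g j))) * 1
      + 1 * sqrt (\<Sum>e\<in>E. norm_sq X (op_app X ?N (f e)))"
  proof (intro add_mono mult_mono real_sqrt_ge_zero sum_nonneg)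
    show "sqrt (\<Sum>i\<in>I. norm_sq Y (op_app X M (?a i))) \<le> sqrt (\<Sum>j\<in>J. norm_sq Y (op_app X M (g j)))"
      using bessel by simp
    have "(\<Sum>i\<in>I. norm_sq Y (op_app X M (?b i))) \<le> (\<Sum>e\<in>E. norm_sq Y (op_app X M (f e)))" by (rule bessel')
    also have "\<dots> \<le> (\<Sum>e\<in>E. norm_sq X (f e))" by (intro sum_mono M)
    finally show "sqrt (\<Sum>i\<in>I. norm_sq Y (op_app X M (?b i))) \<le> 1" using f1 by simp
    show "sqrt (\<Sum>i\<in>I. norm_sq X (?a i)) \<le> 1" using bessel[of X ?one] g1 by (simp add: id)
    show "sqrt (\<Sum>i\<in>I. norm_sq X (op_app X ?N (?b i))) \<le> sqrt (\<Sum>e\<in>E. norm_sq X (op_app X ?N (f e)))"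
      using bessel' by simp
  qed auto
  also have "\<dots> = sqrt (\<Sum>j\<in>J. norm_sq Y (op_app X M (g j)))
    + sqrt (\<Sum>e\<in>E. norm_sq X (\<lambda>x. f e x - op_app Y (adj M) (op_app X M (f e)) x))"
    using norm_sq_cong[OF N, of X] by simp
  finally have upper: "?T \<le> sqrt (\<Sum>j\<in>J. norm_sq Y (op_app X M (g j)))
    + sqrt (\<Sum>e\<in>E. norm_sq X (\<lambda>x. f e x - op_app Y (adj M) (op_app X M (f e)) x))" .
  \<comment> \<open>\<open>sqrt\<close> of a negative number is negative, so the hypothesis
    \<open>P\<close> can be squared only where \<open>1 - ?T\<^sup>2\<close> is nonnegative;
    elsewhere the claim is trivial.\<close>
  have "1 - ?T\<^sup>2 \<le> \<epsilon>\<^sup>2"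
  proof (cases "0 \<le> 1 - ?T\<^sup>2")
    case True
    have "sqrt (1 - ?T\<^sup>2) \<le> \<epsilon>" using P by (simp add: purified_distance_def)
    then have "(sqrt (1 - ?T\<^sup>2))\<^sup>2 \<le> \<epsilon>\<^sup>2" using True by (intro power_mono) auto
    then show ?thesis using True by simp
  next
    case False
    then show ?thesis using zero_le_power2[of \<epsilon>] by linarith
  qed
  then have "sqrt (1 - \<epsilon>\<^sup>2) \<le> sqrt (?T\<^sup>2)" by (intro real_sqrt_le_mono) simp
  then show ?thesis using T0 upper by simp
qed

section \<open>Entropy\<close>

text \<open>With the eigenvectors as columns of \<open>U\<close> and with \<open>V\<close> its
  adjoint, the matrix of \<open>\<rho>\<close> is similar to the diagonal matrix of the
  \<open>p i\<close>. Similar matrices share the characteristic polynomial, so its roots are the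
  \<open>p i\<close> with multiplicity.\<close>

lemma entropy_eigensystem:
  assumes X: "finite X" and es: "eigensystem X {..<card X} u p \<rho>"
  shows "entropy X \<rho> = (\<Sum>i<card X. - (p i * log 2 (p i)))"
proof -
  let ?n = "card X"
  let ?e = "from_nat_into X"
  define U where "U = mat ?n ?n (\<lambda>(i, j). u j (?e i))"
  define V where "V = mat ?n ?n (\<lambda>(i, j). cnj (u i (?e j)))"
  define D where "D = mat ?n ?n (\<lambda>(i, j). if i = j then complex_of_real (p i) else 0)"
  have bij: "bij_betw ?e {..<?n} X" using bij_betw_from_nat_into_finite[OF X] .
  then have e: "?e i \<in> X" if "i < ?n" for i using that by (auto simp: bij_betw_def)
  have inj: "?e i = ?e j \<longleftrightarrow> i = j" if "i < ?n" "j < ?n" for i j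
    using bij that by (auto simp: bij_betw_def inj_on_def)
  have sumX: "(\<Sum>i<?n. g (?e i)) = (\<Sum>x\<in>X. g x)" for g :: "'a \<Rightarrow> complex"
    by (rule sum.reindex_bij_betw[OF bij])
  have UV: "U * V = 1\<^sub>m ?n"
    by (rule eq_matI)
      (use es e inj in \<open>auto simp: U_def V_def scalar_prod_def atLeast0LessThan eigensystem_def\<close>)
  have VU: "V * U = 1\<^sub>m ?n"
  proof (rule eq_matI)
    fix i j assume ij: "i < dim_row (1\<^sub>m ?n :: complex mat)" "j < dim_col (1\<^sub>m ?n :: complex mat)"
    then have "(V * U) $$ (i, j) = (\<Sum>k<?n. cnj (u i (?e k)) * u j (?e k))"
      by (simp add: U_def V_def scalar_prod_def atLeast0LessThan)
    also have "\<dots> = ip X (u i) (u j)" unfolding ip_def by (rule sumX)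
    finally show "(V * U) $$ (i, j) = 1\<^sub>m ?n $$ (i, j)" using es ij by (simp add: eigensystem_def)
  qed (simp_all add: U_def V_def)
  have A: "mat_of_op X \<rho> = U * D * V"
  proof (rule eq_matI)
    fix i j assume "i < dim_row (U * D * V)" "j < dim_col (U * D * V)"
    then have ij: "i < ?n" "j < ?n" by (simp_all add: U_def V_def)
    have UD: "(U * D) $$ (i, k) = u k (?e i) * of_real (p k)" if "k < ?n" for k
      using that ij by (simp add: U_def D_def scalar_prod_def atLeast0LessThan if_distrib sum.delta cong: if_cong)
    have "(U * D * V) $$ (i, j) = (\<Sum>k<?n. (U * D) $$ (i, k) * V $$ (k, j))"
      using ij by (simp add: U_def V_def D_def scalar_prod_def atLeast0LessThan)
    also have "\<dots> = (\<Sum>k<?n. of_real (p k) * (u k (?e i) * cnj (u k (?e j))))"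
      using ij by (intro sum.cong refl) (simp add: UD, simp add: V_def)
    also have "\<dots> = \<rho> (?e i) (?e j)" using es e ij by (simp add: eigensystem_def)
    finally show "mat_of_op X \<rho> $$ (i, j) = (U * D * V) $$ (i, j)" using ij by (simp add: mat_of_op_def)
  qed (simp_all add: mat_of_op_def U_def V_def)
  have "similar_mat_wit (mat_of_op X \<rho>) D U V"
    by (rule similar_mat_witI[OF UV VU A]) (auto simp: mat_of_op_def D_def U_def V_def)
  then have "char_poly (mat_of_op X \<rho>) = char_poly D"
    by (intro char_poly_similar) (auto simp: similar_mat_def)
  also have "\<dots> = (\<Prod>a\<leftarrow>diag_mat D. [:- a, 1:])"
    by (rule char_poly_upper_triangular[of _ ?n]) (auto simp: D_def upper_triangular_def)
  also have "diag_mat D = map (\<lambda>i. of_real (p i)) [0..<?n]"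
    by (rule nth_equalityI) (auto simp: diag_mat_def D_def)
  finally have cp: "char_poly (mat_of_op X \<rho>) = (\<Prod>i\<leftarrow>[0..<?n]. [:- complex_of_real (p i), 1:])"
    by (simp add: comp_def)
  have "proots (\<Prod>i\<leftarrow>xs. [:- complex_of_real (p i), 1:]) = mset (map (\<lambda>i. of_real (p i)) xs)" for xs :: "nat list"
  proof (induction xs)
    case (Cons a xs)
    have "(\<Prod>i\<leftarrow>xs. [:- complex_of_real (p i), 1:]) \<noteq> 0" by (auto simp: prod_list_zero_iff)
    then show ?case using Cons by (simp add: proots_mult del: mult_pCons_left)
  qed simp
  then have "entropy X \<rho> = (\<Sum>i\<leftarrow>[0..<?n]. - (p i * log 2 (p i)))"
    unfolding entropy_def cp by (simp add: comp_def sum_mset_sum_list flip: mset_map)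
  then show ?thesis by (simp add: interv_sum_list_conv_sum_set_nat atLeast0LessThan)
qed

section \<open>Sequential decoding\<close>

text \<open>The trace of \<open>T \<rho>\<close>: for a state \<open>\<rho>\<close>, the probability
  of the outcome with effect \<open>T\<close>.\<close>

definition born :: "'x set \<Rightarrow> ('x, 'x) operator \<Rightarrow> ('x, 'x) operator \<Rightarrow> complex" where
  "born X T \<rho> = (\<Sum>x\<in>X. \<Sum>y\<in>X. T x y * \<rho> y x)"

definition effect :: "'x set \<Rightarrow> ('x, 'x) operator \<Rightarrow> bool" where
  "effect X T \<longleftrightarrow> positive_op X T \<and> (\<forall>v. Re (ip X v (op_app X T v)) \<le> norm_sq X v)"

lemma born_gram:
  assumes "gram X W f \<rho>"
  shows "born X T \<rho> = (\<Sum>w\<in>W. ip X (f w) (op_app X T (f w)))"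
proof -
  have "born X T \<rho> = (\<Sum>x\<in>X. \<Sum>y\<in>X. \<Sum>w\<in>W. cnj (f w x) * (T x y * f w y))"
    using assms by (simp add: born_def gram_def sum_distrib_left mult_ac)
  also have "\<dots> = (\<Sum>x\<in>X. \<Sum>w\<in>W. \<Sum>y\<in>X. cnj (f w x) * (T x y * f w y))"
    by (intro sum.cong refl, rule sum.swap)
  also have "\<dots> = (\<Sum>w\<in>W. \<Sum>x\<in>X. \<Sum>y\<in>X. cnj (f w x) * (T x y * f w y))"
    by (rule sum.swap)
  finally show ?thesis by (simp add: ip_def op_app_def sum_distrib_left)
qed

lemma gram_trace:
  assumes "gram X W f \<rho>"
  shows "op_trace X \<rho> = of_real (\<Sum>w\<in>W. norm_sq X (f w))"
proof -
  have "op_trace X \<rho> = (\<Sum>x\<in>X. \<Sum>w\<in>W. cnj (f w x) * f w x)"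
    using assms by (simp add: op_trace_def gram_def mult.commute)
  also have "\<dots> = (\<Sum>w\<in>W. ip X (f w) (f w))"
    unfolding ip_def by (rule sum.swap)
  finally show ?thesis by (simp add: ip_self)
qed

text \<open>With \<open>T\<close> a sum of \<open>f j (f j)\<^sup>\<dagger>\<close>, the form
  \<open><u, T v>\<close> is the ordinary inner product of the coordinate vectors
  \<open><f j, u>\<close> and \<open><f j, v>\<close>.\<close>

lemma positive_Cauchy_Schwarz:
  assumes "finite X" "positive_op X T"
  shows "cmod (ip X u (op_app X T v)) \<le> sqrt (Re (ip X u (op_app X T u))) * sqrt (Re (ip X v (op_app X T v)))"
proof -
  obtain f where f: "gram X {..<card X} f T" using positive_op_gram[OF assms] by blast
  let ?n = "{..<card X}"
  have "ip X u (op_app X T v) = (\<Sum>x\<in>X. \<Sum>y\<in>X. \<Sum>j\<in>?n. (cnj (u x) * f j x) * (cnj (f j y) * v y))"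
    using f by (simp add: ip_def op_app_def gram_def sum_distrib_left sum_distrib_right mult_ac)
  also have "\<dots> = (\<Sum>x\<in>X. \<Sum>j\<in>?n. \<Sum>y\<in>X. (cnj (u x) * f j x) * (cnj (f j y) * v y))"
    by (intro sum.cong refl, rule sum.swap)
  also have "\<dots> = (\<Sum>j\<in>?n. \<Sum>x\<in>X. \<Sum>y\<in>X. (cnj (u x) * f j x) * (cnj (f j y) * v y))"
    by (rule sum.swap)
  also have "\<dots> = (\<Sum>j\<in>?n. ip X u (f j) * ip X (f j) v)" by (simp add: ip_def sum_product)
  finally have eq: "ip X u (op_app X T v) = (\<Sum>j\<in>?n. ip X u (f j) * ip X (f j) v)" .
  have sq: "Re (ip X w (op_app X T w)) = (\<Sum>j\<in>?n. (cmod (ip X w (f j)))\<^sup>2)" for w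
    unfolding gram_ip[OF f] by simp
  have "cmod (ip X u (op_app X T v)) \<le> (\<Sum>j\<in>?n. \<bar>cmod (ip X u (f j))\<bar> * \<bar>cmod (ip X v (f j))\<bar>)"
    unfolding eq by (rule order_trans[OF norm_sum]) (simp add: norm_mult, subst (2) ip_cnj[symmetric], simp)
  also have "\<dots> \<le> L2_set (\<lambda>j. cmod (ip X u (f j))) ?n * L2_set (\<lambda>j. cmod (ip X v (f j))) ?n"
    by (rule L2_set_mult_ineq)
  finally show ?thesis by (simp add: sq L2_set_def)
qed

text \<open>This is \<open>T\<^sup>2 \<le> T\<close>. Cauchy-Schwarz for the form of
  \<open>T\<close>, applied to \<open>T v\<close> and \<open>v\<close>, bounds the squared norm of
  \<open>T v\<close> by that norm times the root of \<open><v, T v>\<close>; one norm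
  cancels.\<close>

lemma effect_norm_sq_le:
  assumes "finite X" "effect X T"
  shows "norm_sq X (op_app X T v) \<le> Re (ip X v (op_app X T v))"
proof -
  let ?w = "op_app X T v"
  have pos: "0 \<le> Re (ip X u (op_app X T u))" for u using assms(2) by (simp add: effect_def positive_op_iff)
  have "norm_sq X ?w = cmod (ip X ?w (op_app X T v))" by (simp add: ip_self)
  also have "\<dots> \<le> sqrt (Re (ip X ?w (op_app X T ?w))) * sqrt (Re (ip X v ?w))"
    by (rule positive_Cauchy_Schwarz) (use assms in \<open>auto simp: effect_def\<close>)
  also have "\<dots> \<le> sqrt (norm_sq X ?w) * sqrt (Re (ip X v ?w))"
    using assms(2) pos by (intro mult_right_mono real_sqrt_le_mono) (auto simp: effect_def)
  finally have "sqrt (norm_sq X ?w) * sqrt (norm_sq X ?w) \<le> sqrt (norm_sq X ?w) * sqrt (Re (ip X v ?w))" by simp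
  then have "sqrt (norm_sq X ?w) \<le> sqrt (Re (ip X v ?w)) \<or> norm_sq X ?w = 0"
    using norm_sq_nonneg[of X ?w] by (smt (verit) mult_le_cancel_left_pos real_sqrt_gt_0_iff)
  then show ?thesis using pos by auto
qed

text \<open>This is \<open>(1 - T)\<^sup>2 \<le> 1 - T\<close>: a failed test with Kraus operator
  \<open>1 - T\<close> removes at least the weight that \<open>T\<close> accepts.\<close>

lemma effect_complement_norm_sq:
  assumes "finite X" "effect X T"
  shows "norm_sq X (\<lambda>x. v x - op_app X T v x) \<le> norm_sq X v - Re (ip X v (op_app X T v))"
proof -
  let ?w = "op_app X T v"
  have "complex_of_real (norm_sq X (\<lambda>x. v x - ?w x)) = ip X v v - ip X v ?w - (ip X ?w v - ip X ?w ?w)"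
    by (simp only: ip_self[symmetric] ip_diff_left ip_diff_right)
  then have "norm_sq X (\<lambda>x. v x - ?w x) = Re (ip X v v - ip X v ?w - (ip X ?w v - ip X ?w ?w))"
    by (metis Re_complex_of_real)
  also have "\<dots> = norm_sq X v - Re (ip X v ?w) - Re (ip X ?w v) + norm_sq X ?w" by (simp add: ip_self)
  also have "Re (ip X ?w v) = Re (ip X v ?w)" by (subst ip_cnj[symmetric]) simp
  finally show ?thesis using effect_norm_sq_le[OF assms, of v] by linarith
qed

text \<open>The outcome is recorded in a classical register. For complete positivity each
  \<open>L m\<close> is split into vectors \<open>f m l\<close>; the quadratic form of the output at
  \<open>v\<close> is then a sum of quadratic forms of \<open>\<rho>\<close> at the vectors with
  entries \<open>v (i, m) * f m l x\<close>.\<close>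

lemma povm_channel:
  assumes X: "finite X" and Y: "finite Y" and pos: "\<And>m. m \<in> Y \<Longrightarrow> positive_op X (L m)"
    and one: "\<And>x y. x \<in> X \<Longrightarrow> y \<in> X \<Longrightarrow> (\<Sum>m\<in>Y. L m x y) = of_bool (x = y)"
  shows "channel X Y (\<lambda>\<rho> m m'. of_bool (m = m') * born X (L m) \<rho>)"
  unfolding channel_def
proof (intro conjI allI ballI impI)
  fix \<rho> \<sigma> :: "('a, 'a) operator" and \<alpha> \<beta> and m m' assume "m \<in> Y" "m' \<in> Y"
  show "of_bool (m = m') * born X (L m) (\<lambda>x x'. \<alpha> * \<rho> x x' + \<beta> * \<sigma> x x')
    = \<alpha> * (of_bool (m = m') * born X (L m) \<rho>) + \<beta> * (of_bool (m = m') * born X (L m) \<sigma>)"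
    by (simp add: born_def distrib_left sum.distrib sum_distrib_left mult_ac)
next
  fix k :: nat and \<rho> :: "(nat \<times> 'a, nat \<times> 'a) operator"
  assume \<rho>: "positive_op ({..<k} \<times> X) \<rho>"
  let ?K = "{..<k}"
  let ?D = "\<lambda>(i, y) (i', y'). of_bool (y = y') * born X (L y) (\<lambda>x x'. \<rho> (i, x) (i', x'))"
  have "\<exists>f. gram X {..<card X} f (L m)" if "m \<in> Y" for m by (rule positive_op_gram[OF X pos[OF that]])
  then obtain f where f: "\<And>m. m \<in> Y \<Longrightarrow> gram X {..<card X} (f m) (L m)" by metis
  let ?J = "{..<card X}"
  have "ip (?K \<times> Y) v (op_app (?K \<times> Y) ?D v)
    = (\<Sum>m\<in>Y. \<Sum>l\<in>?J. ip (?K \<times> X) (\<lambda>(i, x). v (i, m) * f m l x) (op_app (?K \<times> X) \<rho> (\<lambda>(i, x). v (i, m) * f m l x)))" for v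
  proof -
    have "ip (?K \<times> Y) v (op_app (?K \<times> Y) ?D v)
      = (\<Sum>i\<in>?K. \<Sum>m\<in>Y. \<Sum>i'\<in>?K. \<Sum>m'\<in>Y. of_bool (m = m') * (cnj (v (i, m)) * born X (L m) (\<lambda>x x'. \<rho> (i, x) (i', x')) * v (i', m')))"
      by (simp add: ip_def op_app_def sum.cartesian_product' sum_distrib_left mult_ac)
    also have "\<dots> = (\<Sum>i\<in>?K. \<Sum>m\<in>Y. \<Sum>i'\<in>?K. cnj (v (i, m)) * born X (L m) (\<lambda>x x'. \<rho> (i, x) (i', x')) * v (i', m))"
      by (intro sum.cong refl) (simp add: sum_of_bool[OF Y])
    also have "\<dots> = (\<Sum>m\<in>Y. \<Sum>i\<in>?K. \<Sum>i'\<in>?K. cnj (v (i, m)) * born X (L m) (\<lambda>x x'. \<rho> (i, x) (i', x')) * v (i', m))"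
      by (rule sum.swap)
    also have "\<dots> = (\<Sum>m\<in>Y. \<Sum>l\<in>?J. ip (?K \<times> X) (\<lambda>(i, x). v (i, m) * f m l x) (op_app (?K \<times> X) \<rho> (\<lambda>(i, x). v (i, m) * f m l x)))"
    proof (rule sum.cong[OF refl])
      fix m assume m: "m \<in> Y"
      let ?t = "\<lambda>l i y i' x. cnj (v (i, m) * f m l y) * (\<rho> (i, y) (i', x) * (v (i', m) * f m l x))"
      have "(\<Sum>i\<in>?K. \<Sum>i'\<in>?K. cnj (v (i, m)) * born X (L m) (\<lambda>x x'. \<rho> (i, x) (i', x')) * v (i', m))
        = (\<Sum>i\<in>?K. \<Sum>i'\<in>?K. \<Sum>x\<in>X. \<Sum>y\<in>X. \<Sum>l\<in>?J. ?t l i y i' x)"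
        using f[OF m] by (intro sum.cong refl) (simp add: born_def gram_def sum_distrib_left sum_distrib_right mult_ac)
      also have "\<dots> = (\<Sum>i\<in>?K. \<Sum>i'\<in>?K. \<Sum>x\<in>X. \<Sum>l\<in>?J. \<Sum>y\<in>X. ?t l i y i' x)"
        by (intro sum.cong refl, rule sum.swap)
      also have "\<dots> = (\<Sum>i\<in>?K. \<Sum>i'\<in>?K. \<Sum>l\<in>?J. \<Sum>x\<in>X. \<Sum>y\<in>X. ?t l i y i' x)"
        by (intro sum.cong refl, rule sum.swap)
      also have "\<dots> = (\<Sum>i\<in>?K. \<Sum>l\<in>?J. \<Sum>i'\<in>?K. \<Sum>x\<in>X. \<Sum>y\<in>X. ?t l i y i' x)"
        by (rule sum.cong[OF refl], rule sum.swap)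
      also have "\<dots> = (\<Sum>l\<in>?J. \<Sum>i\<in>?K. \<Sum>i'\<in>?K. \<Sum>x\<in>X. \<Sum>y\<in>X. ?t l i y i' x)"
        by (rule sum.swap)
      also have "\<dots> = (\<Sum>l\<in>?J. \<Sum>i\<in>?K. \<Sum>i'\<in>?K. \<Sum>y\<in>X. \<Sum>x\<in>X. ?t l i y i' x)"
        by (rule sum.cong[OF refl], rule sum.cong[OF refl], rule sum.cong[OF refl], rule sum.swap)
      also have "\<dots> = (\<Sum>l\<in>?J. \<Sum>i\<in>?K. \<Sum>y\<in>X. \<Sum>i'\<in>?K. \<Sum>x\<in>X. ?t l i y i' x)"
        by (rule sum.cong[OF refl], rule sum.cong[OF refl], rule sum.swap)
      finally show "(\<Sum>i\<in>?K. \<Sum>i'\<in>?K. cnj (v (i, m)) * born X (L m) (\<lambda>x x'. \<rho> (i, x) (i', x')) * v (i', m))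
        = (\<Sum>l\<in>?J. ip (?K \<times> X) (\<lambda>(i, x). v (i, m) * f m l x) (op_app (?K \<times> X) \<rho> (\<lambda>(i, x). v (i, m) * f m l x)))"
        by (simp add: ip_def op_app_def sum.cartesian_product' sum_distrib_left)
    qed
    finally show ?thesis .
  qed
  then show "positive_op (?K \<times> Y) ?D"
    using \<rho> unfolding positive_op_iff by (auto intro!: sum_nonneg sum_in_Reals simp: Re_sum)
next
  fix \<rho>
  have "op_trace Y (\<lambda>m m'. of_bool (m = m') * born X (L m) \<rho>) = (\<Sum>x\<in>X. \<Sum>y\<in>X. \<Sum>m\<in>Y. L m x y * \<rho> y x)"
    by (simp add: op_trace_def born_def) (subst sum.swap, intro sum.cong refl, rule sum.swap)
  also have "\<dots> = (\<Sum>x\<in>X. \<Sum>y\<in>X. of_bool (x = y) * \<rho> y x)"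
    by (intro sum.cong refl) (simp add: one sum_distrib_right[symmetric])
  also have "\<dots> = op_trace X \<rho>" by (simp add: sum_of_bool[OF X] op_trace_def)
  finally show "op_trace Y (\<lambda>m m'. of_bool (m = m') * born X (L m) \<rho>) = op_trace X \<rho>" .
qed

text \<open>Using \<open>1 - T\<close> as the Kraus operator of a failed test, instead of \<open>\<surd>(1 - T)\<close>, avoids operator
  roots; success then has the larger effect \<open>1 - (1 - T)\<^sup>2 \<ge> T\<close>.\<close>

primrec reject :: "'x set \<Rightarrow> (nat \<Rightarrow> ('x, 'x) operator) \<Rightarrow> nat \<Rightarrow> ('x, 'x) operator" where
  "reject X T 0 = (\<lambda>x y. of_bool (x = y))"
| "reject X T (Suc k) = (\<lambda>x y. reject X T k x y - op_mult X (T (Suc k)) (reject X T k) x y)"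

declare reject.simps [simp del]

lemma op_app_reject_0: "finite X \<Longrightarrow> x \<in> X \<Longrightarrow> op_app X (reject X T 0) v x = v x"
  by (simp add: reject.simps op_app_def sum_of_bool)

lemma op_app_reject_Suc:
  "op_app X (reject X T (Suc k)) v x
    = op_app X (reject X T k) v x - op_app X (T (Suc k)) (op_app X (reject X T k) v) x"
  unfolding op_app_mult[symmetric] by (simp add: reject.simps op_app_def left_diff_distrib sum_subtractf)

section \<open>Norms and overlaps along a sequence of failed tests\<close>

lemma norm_sq_family: "(\<Sum>w\<in>W. norm_sq X (u w)) = norm_sq (W \<times> X) (\<lambda>(w, x). u w x)"
  by (simp add: norm_sq_def sum.cartesian_product split_def)

lemma norm_sq_family_triangle_diff:
  "sqrt (\<Sum>w\<in>W. norm_sq X (u w)) \<le> sqrt (\<Sum>w\<in>W. norm_sq X (v w)) + sqrt (\<Sum>w\<in>W. norm_sq X (\<lambda>x. u w x - v w x))"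
  using norm_sq_triangle_diff[of "W \<times> X" "\<lambda>(w, x). u w x" "\<lambda>(w, x). v w x"]
  by (simp add: norm_sq_family split_def)

context
  fixes X :: "'x set" and T :: "nat \<Rightarrow> ('x, 'x) operator" and K :: nat
    and W :: "'w set" and f :: "'w \<Rightarrow> 'x \<Rightarrow> complex" and E :: real
  assumes X: "finite X"
    and T: "\<And>k. k \<in> {1..K} \<Longrightarrow> effect X (T k)"
    and f1: "(\<Sum>w\<in>W. norm_sq X (f w)) = 1"
begin

abbreviation (input) "rej k w \<equiv> op_app X (reject X T k) (f w)"
abbreviation (input) "accept k u \<equiv> (\<Sum>w\<in>W. Re (ip X (u w) (op_app X (T k) (u w))))"

lemma accept_nonneg: "k \<in> {1..K} \<Longrightarrow> 0 \<le> accept k u"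
  using T by (auto intro!: sum_nonneg simp: effect_def positive_op_iff)

lemma rej_0: "norm_sq X (rej 0 w) = norm_sq X (f w)" "ip X u (rej 0 w) = ip X u (f w)"
  by (rule norm_sq_cong, rule op_app_reject_0[OF X], simp)
    (rule ip_cong, simp, rule op_app_reject_0[OF X], simp)

lemma rej_Suc_norm_sq:
  assumes "Suc k \<in> {1..K}"
  shows "(\<Sum>w\<in>W. norm_sq X (rej (Suc k) w)) \<le> (\<Sum>w\<in>W. norm_sq X (rej k w)) - accept (Suc k) (rej k)"
  unfolding sum_subtractf[symmetric] op_app_reject_Suc[abs_def]
  by (intro sum_mono effect_complement_norm_sq X T assms)

text \<open>Every failed test loses at least its acceptance weight, and the total weight starts at
  1. Hence the acceptance weights met along the way sum to at most 1, however many tests there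
  are.\<close>

lemma rej_norm_sq_le:
  "k \<le> K \<Longrightarrow> (\<Sum>w\<in>W. norm_sq X (rej k w)) + (\<Sum>j<k. accept (Suc j) (rej j)) \<le> 1"
proof (induction k)
  case 0
  then show ?case using f1 by (simp only: rej_0) simp
next
  case (Suc k)
  then show ?case using rej_Suc_norm_sq[of k] by simp
qed

text \<open>The weak measurements disturb the state little: the overlap decreases in step \<open>k\<close> by at most
  \<open>\<surd>\<langle>f, T\<^sub>k f\<rangle> \<cdot> \<surd>(norm lost in step k)\<close>, and the total loss of norm is at most 1.\<close>

lemma rej_overlap:
  assumes "k \<le> K" and E: "(\<Sum>j<k. accept (Suc j) f) \<le> E"
  shows "1 - sqrt E \<le> Re (\<Sum>w\<in>W. ip X (f w) (rej k w))"
proof -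
  let ?o = "\<lambda>k. Re (\<Sum>w\<in>W. ip X (f w) (rej k w))"
  let ?a = "\<lambda>j. sqrt (accept (Suc j) f)" and ?b = "\<lambda>j. sqrt (accept (Suc j) (rej j))"
  have step: "?o j - ?o (Suc j) \<le> ?a j * ?b j" if "j < K" for j
  proof -
    have e: "effect X (T (Suc j))" using T that by auto
    have "?o j - ?o (Suc j) = (\<Sum>w\<in>W. Re (ip X (f w) (op_app X (T (Suc j)) (rej j w))))"
      unfolding op_app_reject_Suc[abs_def] ip_diff_right by (simp add: sum_subtractf)
    also have "\<dots> \<le> (\<Sum>w\<in>W. \<bar>sqrt (Re (ip X (f w) (op_app X (T (Suc j)) (f w))))\<bar> *
        \<bar>sqrt (Re (ip X (rej j w) (op_app X (T (Suc j)) (rej j w))))\<bar>)"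
    proof (rule sum_mono)
      fix w
      have "Re (ip X (f w) (op_app X (T (Suc j)) (rej j w))) \<le> cmod (ip X (f w) (op_app X (T (Suc j)) (rej j w)))"
        by (rule complex_Re_le_cmod)
      also have "\<dots> \<le> sqrt (Re (ip X (f w) (op_app X (T (Suc j)) (f w)))) *
        sqrt (Re (ip X (rej j w) (op_app X (T (Suc j)) (rej j w))))"
        using e by (intro positive_Cauchy_Schwarz X) (simp add: effect_def)
      also have "\<dots> \<le> \<bar>sqrt (Re (ip X (f w) (op_app X (T (Suc j)) (f w))))\<bar> *
        \<bar>sqrt (Re (ip X (rej j w) (op_app X (T (Suc j)) (rej j w))))\<bar>"
        unfolding abs_mult[symmetric] by (rule abs_ge_self)
      finally show "Re (ip X (f w) (op_app X (T (Suc j)) (rej j w)))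
        \<le> \<bar>sqrt (Re (ip X (f w) (op_app X (T (Suc j)) (f w))))\<bar> *
        \<bar>sqrt (Re (ip X (rej j w) (op_app X (T (Suc j)) (rej j w))))\<bar>" .
    qed
    also have "\<dots> \<le> L2_set (\<lambda>w. sqrt (Re (ip X (f w) (op_app X (T (Suc j)) (f w))))) W *
        L2_set (\<lambda>w. sqrt (Re (ip X (rej j w) (op_app X (T (Suc j)) (rej j w))))) W"
      by (rule L2_set_mult_ineq)
    also have "\<dots> = ?a j * ?b j"
      using e by (simp add: L2_set_def effect_def positive_op_iff)
    finally show ?thesis .
  qed
  have "?o 0 = 1" using f1 by (simp only: rej_0 ip_self of_real_sum[symmetric]) simp
  moreover have "(\<Sum>j<k. ?o j - ?o (Suc j)) = ?o 0 - ?o k" by (rule sum_lessThan_telescope')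
  ultimately have "1 - ?o k = (\<Sum>j<k. ?o j - ?o (Suc j))" by linarith
  also have "\<dots> \<le> (\<Sum>j<k. \<bar>?a j\<bar> * \<bar>?b j\<bar>)"
  proof (rule sum_mono)
    fix j assume "j \<in> {..<k}"
    then have "?o j - ?o (Suc j) \<le> ?a j * ?b j" using step assms by simp
    also have "\<dots> \<le> \<bar>?a j\<bar> * \<bar>?b j\<bar>" unfolding abs_mult[symmetric] by (rule abs_ge_self)
    finally show "?o j - ?o (Suc j) \<le> \<bar>?a j\<bar> * \<bar>?b j\<bar>" .
  qed
  also have "\<dots> \<le> L2_set ?a {..<k} * L2_set ?b {..<k}" by (rule L2_set_mult_ineq)
  also have "\<dots> = sqrt (\<Sum>j<k. accept (Suc j) f) * sqrt (\<Sum>j<k. accept (Suc j) (rej j))"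
    unfolding L2_set_def using accept_nonneg assms(1) by (simp add: Suc_le_eq)
  also have "\<dots> \<le> sqrt E * 1"
  proof (intro mult_mono real_sqrt_le_mono E)
    have "0 \<le> (\<Sum>w\<in>W. norm_sq X (rej k w))" by (simp add: sum_nonneg)
    then have "(\<Sum>j<k. accept (Suc j) (rej j)) \<le> 1" using rej_norm_sq_le[OF assms(1)] by linarith
    then show "sqrt (\<Sum>j<k. accept (Suc j) (rej j)) \<le> 1" by simp
    have "0 \<le> (\<Sum>j<k. accept (Suc j) f)" by (rule sum_nonneg, rule accept_nonneg) (use assms(1) in auto)
    then show "0 \<le> sqrt E" using E by simp
    show "0 \<le> sqrt (\<Sum>j<k. accept (Suc j) (rej j))"
      by (rule real_sqrt_ge_zero, rule sum_nonneg, rule accept_nonneg) (use assms(1) in auto)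
  qed
  finally show ?thesis by simp
qed

text \<open>Test \<open>k + 1\<close> succeeds with the weight lost between \<open>rej k\<close> and
  \<open>rej (Suc k)\<close>. The overlap bound shows that the first weight is at least
  \<open>1 - 2 * sqrt E\<close> and that \<open>rej k\<close> is within squared distance
  \<open>2 * sqrt E\<close> of \<open>f\<close>. The second weight is estimated on \<open>f\<close>,
  where it is at most \<open>1 - accept (Suc k) f\<close>; the contraction \<open>1 - T\<close> does
  not enlarge the distance.\<close>

lemma sequential_success:
  assumes "k < K" and E: "(\<Sum>j<k. accept (Suc j) f) \<le> E"
  shows "1 - ((\<Sum>w\<in>W. norm_sq X (rej k w)) - (\<Sum>w\<in>W. norm_sq X (rej (Suc k) w)))
    \<le> 2 * sqrt E + (sqrt (1 - accept (Suc k) f) + sqrt (2 * sqrt E))\<^sup>2"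
proof -
  let ?N = "\<Sum>w\<in>W. norm_sq X (rej k w)"
  let ?o = "Re (\<Sum>w\<in>W. ip X (f w) (rej k w))"
  have E0: "0 \<le> E"
    by (rule order_trans[OF _ E], rule sum_nonneg, rule accept_nonneg) (use assms(1) in auto)
  have e: "effect X (T (Suc k))" using T assms by auto
  have o: "1 - sqrt E \<le> ?o" using rej_overlap E assms(1) by simp
  have N1: "?N \<le> 1"
  proof -
    have "0 \<le> (\<Sum>j<k. accept (Suc j) (rej j))" by (rule sum_nonneg, rule accept_nonneg) (use assms(1) in auto)
    then show ?thesis using rej_norm_sq_le[of k] assms(1) by simp
  qed
  have N0: "0 \<le> ?N" by (simp add: sum_nonneg)
  have "?o \<le> cmod (\<Sum>w\<in>W. ip X (f w) (rej k w))" by (rule complex_Re_le_cmod)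
  also have "\<dots> \<le> (\<Sum>w\<in>W. cmod (ip X (f w) (rej k w)))" by (rule norm_sum)
  also have "\<dots> \<le> sqrt (\<Sum>w\<in>W. norm_sq X (f w)) * sqrt ?N" by (rule sum_ip_le)
  finally have "?o \<le> sqrt ?N" using f1 by simp
  with o have "1 - sqrt E \<le> sqrt ?N" by simp
  \<comment> \<open>Linearising the square at 1 keeps the bound valid even where
    \<open>1 - sqrt E\<close> is negative.\<close>
  moreover have "2 * sqrt ?N - 1 \<le> ?N"
    using zero_le_power2[of "sqrt ?N - 1"] N0 by (simp add: power2_diff)
  ultimately have lower: "1 - 2 * sqrt E \<le> ?N" by linarith
  have "(\<Sum>w\<in>W. norm_sq X (\<lambda>x. rej k w x - f w x)) = ?N - 2 * ?o + 1"
  proof -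
    have "norm_sq X (\<lambda>x. rej k w x - f w x) = norm_sq X (rej k w) - 2 * Re (ip X (f w) (rej k w)) + norm_sq X (f w)" for w
    proof -
      have "complex_of_real (norm_sq X (\<lambda>x. rej k w x - f w x))
        = ip X (rej k w) (rej k w) - ip X (rej k w) (f w) - (ip X (f w) (rej k w) - ip X (f w) (f w))"
        by (simp only: ip_self[symmetric] ip_diff_left ip_diff_right)
      then have "norm_sq X (\<lambda>x. rej k w x - f w x)
        = Re (ip X (rej k w) (rej k w) - ip X (rej k w) (f w) - (ip X (f w) (rej k w) - ip X (f w) (f w)))"
        by (metis Re_complex_of_real)
      moreover have "Re (ip X (rej k w) (f w)) = Re (ip X (f w) (rej k w))" by (subst ip_cnj[symmetric]) simp
      ultimately show ?thesis by (simp add: ip_self)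
    qed
    then show ?thesis using f1 by (simp add: sum.distrib sum_subtractf sum_distrib_left)
  qed
  also have "\<dots> \<le> 2 * sqrt E" using o N1 by linarith
  finally have dist: "(\<Sum>w\<in>W. norm_sq X (\<lambda>x. rej k w x - f w x)) \<le> 2 * sqrt E" .
  let ?Y = "\<lambda>v x. v x - op_app X (T (Suc k)) v x"
  have Y: "norm_sq X (?Y v) \<le> norm_sq X v - Re (ip X v (op_app X (T (Suc k)) v))" for v
    by (rule effect_complement_norm_sq[OF X e])
  have Y': "norm_sq X (?Y v) \<le> norm_sq X v" for v
    using Y[of v] e by (auto simp: effect_def positive_op_iff intro: order_trans)
  have "sqrt (\<Sum>w\<in>W. norm_sq X (rej (Suc k) w)) = sqrt (\<Sum>w\<in>W. norm_sq X (?Y (rej k w)))"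
    unfolding op_app_reject_Suc[abs_def] ..
  also have "\<dots> \<le> sqrt (\<Sum>w\<in>W. norm_sq X (?Y (f w)))
      + sqrt (\<Sum>w\<in>W. norm_sq X (\<lambda>x. ?Y (rej k w) x - ?Y (f w) x))"
    by (rule norm_sq_family_triangle_diff)
  also have "\<dots> = sqrt (\<Sum>w\<in>W. norm_sq X (?Y (f w)))
      + sqrt (\<Sum>w\<in>W. norm_sq X (?Y (\<lambda>x. rej k w x - f w x)))"
    by (simp add: op_app_diff algebra_simps)
  also have "\<dots> \<le> sqrt (1 - accept (Suc k) f) + sqrt (2 * sqrt E)"
  proof (intro add_mono real_sqrt_le_mono)
    have "(\<Sum>w\<in>W. norm_sq X (?Y (f w))) \<le> (\<Sum>w\<in>W. norm_sq X (f w) - Re (ip X (f w) (op_app X (T (Suc k)) (f w))))"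
      by (intro sum_mono Y)
    then show "(\<Sum>w\<in>W. norm_sq X (?Y (f w))) \<le> 1 - accept (Suc k) f" using f1 by (simp add: sum_subtractf)
    have "(\<Sum>w\<in>W. norm_sq X (?Y (\<lambda>x. rej k w x - f w x))) \<le> (\<Sum>w\<in>W. norm_sq X (\<lambda>x. rej k w x - f w x))"
      by (intro sum_mono Y')
    then show "(\<Sum>w\<in>W. norm_sq X (?Y (\<lambda>x. rej k w x - f w x))) \<le> 2 * sqrt E" using dist by linarith
  qed
  finally have "(sqrt (\<Sum>w\<in>W. norm_sq X (rej (Suc k) w)))\<^sup>2 \<le> (sqrt (1 - accept (Suc k) f) + sqrt (2 * sqrt E))\<^sup>2"
    by (intro power_mono) (auto intro: sum_nonneg)
  then have "(\<Sum>w\<in>W. norm_sq X (rej (Suc k) w)) \<le> (sqrt (1 - accept (Suc k) f) + sqrt (2 * sqrt E))\<^sup>2"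
    by (simp add: sum_nonneg)
  with lower show ?thesis by linarith
qed

end

lemma reject_norm_sq_decreasing:
  assumes "finite X" "effect X (T (Suc k))"
  shows "norm_sq X (op_app X (reject X T (Suc k)) v) \<le> norm_sq X (op_app X (reject X T k) v)"
proof -
  have "norm_sq X (op_app X (reject X T (Suc k)) v) \<le> norm_sq X (op_app X (reject X T k) v)
      - Re (ip X (op_app X (reject X T k) v) (op_app X (T (Suc k)) (op_app X (reject X T k) v)))"
    unfolding op_app_reject_Suc[abs_def] by (rule effect_complement_norm_sq[OF assms])
  then show ?thesis using assms(2) by (auto simp: effect_def positive_op_iff intro: order_trans)
qed

text \<open>Test \<open>1, 2, \<dots>\<close> in turn until one succeeds; if none does, answer 1.\<close>

definition sequential_povm :: "'x set \<Rightarrow> (nat \<Rightarrow> ('x, 'x) operator) \<Rightarrow> nat \<Rightarrow> nat \<Rightarrow> ('x, 'x) operator" where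
  "sequential_povm X T K m = (let G = \<lambda>k. op_mult X (adj (reject X T k)) (reject X T k) in
     (\<lambda>x y. G (m - 1) x y - G m x y + of_bool (m = 1) * G K x y))"

lemma sequential_povm_ip:
  "ip X v (op_app X (sequential_povm X T K m) v) = of_real (norm_sq X (op_app X (reject X T (m - 1)) v)
     - norm_sq X (op_app X (reject X T m) v) + of_bool (m = 1) * norm_sq X (op_app X (reject X T K) v))"
proof -
  let ?G = "\<lambda>k. op_mult X (adj (reject X T k)) (reject X T k)"
  have "op_app X (sequential_povm X T K m) v
      = (\<lambda>x. op_app X (?G (m - 1)) v x - op_app X (?G m) v x + of_bool (m = 1) * op_app X (?G K) v x)"
    by (simp add: sequential_povm_def op_app_def Let_def distrib_right left_diff_distrib sum.distrib sum_subtractf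
        sum_distrib_left mult.assoc)
  then have "ip X v (op_app X (sequential_povm X T K m) v)
      = ip X v (op_app X (?G (m - 1)) v) - ip X v (op_app X (?G m) v) + of_bool (m = 1) * ip X v (op_app X (?G K) v)"
    by (simp add: ip_def distrib_left right_diff_distrib sum.distrib sum_subtractf sum_distrib_left mult_ac)
  then show ?thesis by (simp only: ip_adj_mult) simp
qed

text \<open>The effects of the answers telescope to the identity once the weight of failing all
  tests is assigned to answer 1. That assignment can only raise the probability of a correct answer,
  which is at least the weight lost in test \<open>m\<close>. Only the tests before \<open>m\<close>
  have disturbed the state by then, so \<open>E\<close> bounds the sum over these alone.\<close>

lemma sequential_decoding:
  fixes T :: "nat \<Rightarrow> ('x, 'x) operator"
  assumes X: "finite X" and K: "1 \<le> K" and T: "\<And>k. k \<in> {1..K} \<Longrightarrow> effect X (T k)"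
  defines "D \<equiv> \<lambda>\<rho> m m'. of_bool (m = m') * born X (sequential_povm X T K m) \<rho>"
  shows "channel X {1..K} D"
    and "\<And>\<rho> m E. positive_op X \<rho> \<Longrightarrow> op_trace X \<rho> = 1 \<Longrightarrow> m \<in> {1..K} \<Longrightarrow>
      (\<Sum>k\<in>{1..<m}. Re (born X (T k) \<rho>)) \<le> E \<Longrightarrow>
      (\<Sum>m'\<in>{1..K} - {m}. Re (D \<rho> m' m'))
        \<le> 2 * sqrt E + (sqrt (1 - Re (born X (T m) \<rho>)) + sqrt (2 * sqrt E))\<^sup>2"
proof -
  let ?G = "\<lambda>k. op_mult X (adj (reject X T k)) (reject X T k)"
  let ?L = "sequential_povm X T K"
  have pos: "positive_op X (?L m)" if m: "m \<in> {1..K}" for m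
  proof -
    obtain k where k: "m = Suc k" using m by (cases m) auto
    have "norm_sq X (op_app X (reject X T (Suc k)) v) \<le> norm_sq X (op_app X (reject X T k) v)" for v
      using reject_norm_sq_decreasing[OF X, of T k v] T[of m] m k by simp
    then show ?thesis unfolding positive_op_iff sequential_povm_ip by (simp add: k)
  qed
  have one: "(\<Sum>m\<in>{1..K}. ?L m x y) = of_bool (x = y)" if "x \<in> X" "y \<in> X" for x y
  proof -
    have "(\<Sum>m\<in>{1..K}. ?L m x y) = (\<Sum>m\<in>{1..K}. ?G (m - 1) x y - ?G m x y) + (\<Sum>m\<in>{1..K}. of_bool (m = 1) * ?G K x y)"
      by (simp add: sequential_povm_def Let_def sum.distrib)
    also have "(\<Sum>m\<in>{1..K}. of_bool (m = 1) * ?G K x y) = ?G K x y"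
      using K by (simp add: sum_of_bool)
    also have "(\<Sum>m\<in>{1..K}. ?G (m - 1) x y - ?G m x y) = (\<Sum>k<K. ?G k x y - ?G (Suc k) x y)"
      by (rule sum.reindex_bij_witness[of _ Suc "\<lambda>m. m - 1"]) auto
    also have "\<dots> = ?G 0 x y - ?G K x y" by (rule sum_lessThan_telescope')
    also have "?G 0 x y = of_bool (x = y)"
      using X that by (simp add: op_mult_def adj_def reject.simps sum_of_bool)
    finally show ?thesis by simp
  qed
  show ch: "channel X {1..K} D"
    unfolding D_def by (rule povm_channel[OF X _ pos one]) simp
  fix \<rho> m E
  assume \<rho>: "positive_op X \<rho>" "op_trace X \<rho> = 1" and m: "m \<in> {1..K}"
    and E: "(\<Sum>k\<in>{1..<m}. Re (born X (T k) \<rho>)) \<le> E"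
  obtain f where f: "gram X {..<card X} f \<rho>" using positive_op_gram[OF X \<rho>(1)] by blast
  let ?W = "{..<card X}"
  obtain k where k: "m = Suc k" using m by (cases m) auto
  have f1: "(\<Sum>w\<in>?W. norm_sq X (f w)) = 1"
    using gram_trace[OF f] \<rho>(2) by (metis of_real_eq_1_iff)
  have b: "Re (born X (T j) \<rho>) = (\<Sum>w\<in>?W. Re (ip X (f w) (op_app X (T j) (f w))))" for j
    by (simp add: born_gram[OF f])
  have "(\<Sum>j<k. Re (born X (T (Suc j)) \<rho>)) \<le> E"
  proof -
    have "(\<Sum>j<k. Re (born X (T (Suc j)) \<rho>)) = (\<Sum>k\<in>{1..<m}. Re (born X (T k) \<rho>))"
      by (rule sum.reindex_bij_witness[of _ "\<lambda>m. m - 1" Suc]) (auto simp: k)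
    then show ?thesis using E by simp
  qed
  then have *: "1 - ((\<Sum>w\<in>?W. norm_sq X (op_app X (reject X T k) (f w)))
      - (\<Sum>w\<in>?W. norm_sq X (op_app X (reject X T (Suc k)) (f w))))
    \<le> 2 * sqrt E + (sqrt (1 - Re (born X (T m) \<rho>)) + sqrt (2 * sqrt E))\<^sup>2"
    unfolding b k by (intro sequential_success[OF X T f1, of K]) (use m k in auto)
  have "Re (D \<rho> m m) = (\<Sum>w\<in>?W. norm_sq X (op_app X (reject X T k) (f w))
     - norm_sq X (op_app X (reject X T (Suc k)) (f w)) + of_bool (m = 1) * norm_sq X (op_app X (reject X T K) (f w)))"
    unfolding D_def by (simp add: born_gram[OF f] sequential_povm_ip k)
  also have "\<dots> \<ge> (\<Sum>w\<in>?W. norm_sq X (op_app X (reject X T k) (f w))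
     - norm_sq X (op_app X (reject X T (Suc k)) (f w)))"
    by (intro sum_mono) simp
  finally have success: "(\<Sum>w\<in>?W. norm_sq X (op_app X (reject X T k) (f w)))
      - (\<Sum>w\<in>?W. norm_sq X (op_app X (reject X T (Suc k)) (f w))) \<le> Re (D \<rho> m m)"
    by (simp add: sum_subtractf)
  have "op_trace {1..K} (D \<rho>) = 1" using ch \<rho>(2) by (simp add: channel_def)
  then have "(\<Sum>m'\<in>{1..K}. Re (D \<rho> m' m')) = 1" unfolding op_trace_def by (metis Re_sum one_complex.sel(1))
  then have "(\<Sum>m'\<in>{1..K} - {m}. Re (D \<rho> m' m')) = 1 - Re (D \<rho> m m)"
    using m by (simp add: sum_diff1)
  with * success show "(\<Sum>m'\<in>{1..K} - {m}. Re (D \<rho> m' m'))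
        \<le> 2 * sqrt E + (sqrt (1 - Re (born X (T m) \<rho>)) + sqrt (2 * sqrt E))\<^sup>2" by linarith
qed

section \<open>The test for one pair\<close>

lemma norm_sq_Times: "norm_sq (X \<times> Z) v = (\<Sum>z\<in>Z. norm_sq X (\<lambda>x. v (x, z)))"
  unfolding norm_sq_def sum.cartesian_product' by (rule sum.swap)

lemma norm_sq_Times': "norm_sq (X \<times> Z) v = (\<Sum>x\<in>X. norm_sq Z (\<lambda>z. v (x, z)))"
  unfolding norm_sq_def sum.cartesian_product' ..

lemma isometry_ip:
  assumes "finite X" "isometry_op X Y M"
  shows "ip Y (op_app X M u) (op_app X M v) = ip X u v"
proof -
  have "ip Y (op_app X M u) (op_app X M v) = ip X (op_app Y (adj M) (op_app X M u)) v"
    by (rule ip_op_app)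
  also have "\<dots> = ip X u v"
  proof (rule ip_cong)
    fix x assume x: "x \<in> X"
    have "op_app Y (adj M) (op_app X M u) x = (\<Sum>x'\<in>X. op_mult Y (adj M) M x x' * u x')"
      unfolding op_app_mult[symmetric] by (simp add: op_app_def)
    also have "\<dots> = (\<Sum>x'\<in>X. of_bool (x = x') * u x')"
      using assms(2) x by (simp add: isometry_op_def)
    also have "\<dots> = u x" using assms(1) x by (simp add: sum_of_bool)
    finally show "op_app Y (adj M) (op_app X M u) x = u x" .
  qed simp
  finally show ?thesis .
qed

lemma isometry_norm_sq:
  assumes "finite X" "isometry_op X Y M"
  shows "norm_sq Y (op_app X M v) = norm_sq X v"
  using isometry_ip[OF assms, of v v] by (simp add: ip_self)

definition op_lift :: "('y, 'x) operator \<Rightarrow> ('y \<times> 'z, 'x \<times> 'z) operator" where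
  "op_lift M = (\<lambda>(y, z) (x, z'). of_bool (z = z') * M y x)"

lemma op_app_lift:
  assumes "finite Z" "z \<in> Z"
  shows "op_app (X \<times> Z) (op_lift M) v (y, z) = op_app X M (\<lambda>x. v (x, z)) y"
  using assms by (simp add: op_app_def op_lift_def sum.cartesian_product' sum_of_bool mult.assoc)

lemma norm_sq_lift:
  assumes "finite Z"
  shows "norm_sq (Y \<times> Z) (op_app (X \<times> Z) (op_lift M) v) = (\<Sum>z\<in>Z. norm_sq Y (op_app X M (\<lambda>x. v (x, z))))"
  unfolding norm_sq_Times using assms by (intro sum.cong refl norm_sq_cong) (simp add: op_app_lift)

lemma lift_contraction:
  assumes "finite Z" "\<And>v. norm_sq Y (op_app X M v) \<le> norm_sq X v"
  shows "norm_sq (Y \<times> Z) (op_app (X \<times> Z) (op_lift M) v) \<le> norm_sq (X \<times> Z) v"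
  unfolding norm_sq_lift[OF assms(1)] unfolding norm_sq_Times by (intro sum_mono assms)

lemma conj_by_gram:
  assumes "gram X J f \<rho>"
  shows "conj_by X M \<rho> y y' = (\<Sum>j\<in>J. op_app X M (f j) y * cnj (op_app X M (f j) y'))"
proof -
  have "conj_by X M \<rho> y y' = (\<Sum>x'\<in>X. \<Sum>x\<in>X. \<Sum>j\<in>J. M y x * f j x * cnj (M y' x' * f j x'))"
    using assms by (simp add: conj_by_def op_mult_def adj_def gram_def sum_distrib_left sum_distrib_right mult_ac)
  also have "\<dots> = (\<Sum>x'\<in>X. \<Sum>j\<in>J. \<Sum>x\<in>X. M y x * f j x * cnj (M y' x' * f j x'))"
    by (rule sum.cong[OF refl], rule sum.swap)
  also have "\<dots> = (\<Sum>j\<in>J. \<Sum>x'\<in>X. \<Sum>x\<in>X. M y x * f j x * cnj (M y' x' * f j x'))"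
    by (rule sum.swap)
  also have "\<dots> = (\<Sum>j\<in>J. \<Sum>x\<in>X. \<Sum>x'\<in>X. M y x * f j x * cnj (M y' x' * f j x'))"
    by (rule sum.cong[OF refl], rule sum.swap)
  finally show ?thesis by (simp add: op_app_def sum_product)
qed

text \<open>\<open>\<Phi> e\<close> are the branches of a purification of the state \<open>\<Psi>\<close> by a system with labels \<open>E\<close>.\<close>

locale redistribution =
  fixes R :: "'r set" and A :: "'a set" and B :: "'b set" and C :: "'c set" and E :: "'e set"
    and \<Phi> :: "'e \<Rightarrow> 'r \<times> 'a \<times> 'b \<times> 'c \<Rightarrow> complex" and \<Psi> :: "('r, 'a, 'b, 'c) rabc_op"
    and P :: "('a, 'b, 'c) protocol" and q \<epsilon> :: real
  assumes fin [simp]: "finite R" "finite A" "finite B" "finite C" "finite E"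
    and gram_Psi: "gram (R \<times> A \<times> B \<times> C) E \<Phi> \<Psi>"
    and Phi_1: "(\<Sum>e\<in>E. norm_sq (R \<times> A \<times> B \<times> C) (\<Phi> e)) = 1"
    and qsr: "qsr_protocol R A B C \<Psi> q \<epsilon> P"
    and eps: "0 < \<epsilon>"
begin

abbreviation "EA \<equiv> {..<dim_EA P}"
abbreviation "EB \<equiv> {..<dim_EB P}"
abbreviation "Q \<equiv> {..<dim_Q P}"
abbreviation "TA \<equiv> {..<dim_TA P}"
abbreviation "TB \<equiv> {..<dim_TB P}"

abbreviation "In \<equiv> (R \<times> B) \<times> (Q \<times> EB)"
abbreviation "Out \<equiv> (R \<times> C \<times> B) \<times> TB"

text \<open>This family, \<open>branch_B\<close> and \<open>branch_RCB\<close> hold the same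
  amplitudes \<open>\<Phi>\<close> in different groupings: the registers in the index are the ones
  traced out, so each family is an ensemble for the marginal in its name.\<close>

definition branch_RB :: "'a \<times> 'c \<times> 'e \<Rightarrow> 'r \<times> 'b \<Rightarrow> complex" where
  "branch_RB = (\<lambda>(a, c, e) (r, b). \<Phi> e (r, a, b, c))"

definition branch_B :: "'r \<times> 'a \<times> 'c \<times> 'e \<Rightarrow> 'b \<Rightarrow> complex" where
  "branch_B = (\<lambda>(r, a, c, e) b. \<Phi> e (r, a, b, c))"

definition branch_RCB :: "'a \<times> 'e \<Rightarrow> 'r \<times> 'c \<times> 'b \<Rightarrow> complex" where
  "branch_RCB = (\<lambda>(a, e) (r, c, b). \<Phi> e (r, a, b, c))"

text \<open>The state after Alice's encoding. The registers \<open>A\<close> and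
  \<open>T\<^sub>A\<close> that stay with her and the purifying \<open>E\<close> are in the index;
  \<open>R B Q E\<^sub>B\<close>, on which Bob tests, are in the argument.\<close>

definition encoded :: "'a \<times> nat \<times> 'e \<Rightarrow> ('r \<times> 'b) \<times> (nat \<times> nat) \<Rightarrow> complex" where
  "encoded = (\<lambda>(a, tA, e) ((r, b), (x, eB)).
     op_app (A \<times> C \<times> EA) (enc P) (\<lambda>(a', c', eA). \<Phi> e (r, a', b, c') * theta P (eA, eB)) (a, x, tA))"

definition dec_op :: "(('r \<times> 'c \<times> 'b) \<times> nat, ('r \<times> 'b) \<times> (nat \<times> nat)) operator" where
  "dec_op = (\<lambda>((r, c, b), tB) ((r', b'), (x, eB)). of_bool (r = r') * dec P (b, c, tB) (x, b', eB))"

lemma theta_1: "(\<Sum>x\<in>EA \<times> EB. (cmod (theta P x))\<^sup>2) = 1"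
  and enc_iso: "isometry_op (A \<times> C \<times> EA) (A \<times> Q \<times> TA) (enc P)"
  and dec_iso: "isometry_op (Q \<times> B \<times> EB) (B \<times> C \<times> TB) (dec P)"
  and dist: "purified_distance (R \<times> A \<times> B \<times> C) (protocol_output R A B C \<Psi> P) \<Psi> \<le> \<epsilon>"
  using qsr by (simp_all add: qsr_protocol_def unit_vec_on_def)

lemma branch_B_1: "(\<Sum>j\<in>R \<times> A \<times> C \<times> E. norm_sq B (branch_B j)) = 1"
proof -
  have "(\<Sum>j\<in>R \<times> A \<times> C \<times> E. norm_sq B (branch_B j))
      = (\<Sum>(r, a, c, e)\<in>R \<times> A \<times> C \<times> E. \<Sum>b\<in>B. (cmod (\<Phi> e (r, a, b, c)))\<^sup>2)"
    by (simp add: norm_sq_def branch_B_def split_def)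
  also have "\<dots> = (\<Sum>(e, r, a, b, c)\<in>E \<times> R \<times> A \<times> B \<times> C. (cmod (\<Phi> e (r, a, b, c)))\<^sup>2)"
    unfolding sum.Sigma[OF _ ballI, of "R \<times> A \<times> C \<times> E" "\<lambda>_. B", simplified]
    by (simp add: split_def sum.cartesian_product)
      (rule sum.reindex_bij_witness[of _ "\<lambda>(e, r, a, b, c). ((r, a, c, e), b)" "\<lambda>((r, a, c, e), b). (e, r, a, b, c)"], auto)
  also have "\<dots> = 1" using Phi_1 by (simp add: norm_sq_def sum.cartesian_product split_def)
  finally show ?thesis .
qed

lemma branch_RB_1: "(\<Sum>j\<in>A \<times> C \<times> E. norm_sq (R \<times> B) (branch_RB j)) = 1"
proof -
  have "(\<Sum>j\<in>A \<times> C \<times> E. norm_sq (R \<times> B) (branch_RB j)) = (\<Sum>j\<in>R \<times> A \<times> C \<times> E. norm_sq B (branch_B j))"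
    unfolding norm_sq_Times' sum.cartesian_product
    by (rule sum.reindex_bij_witness[of _ "\<lambda>(r, a, c, e). ((a, c, e), r)" "\<lambda>((a, c, e), r). (r, a, c, e)"])
      (auto simp: branch_RB_def branch_B_def)
  then show ?thesis using branch_B_1 by simp
qed

lemma norm_sq_dec_op: "norm_sq Out (op_app In dec_op v) = norm_sq In v"
proof -
  let ?v = "\<lambda>r (x, b, eB). v ((r, b), (x, eB))"
  have app: "op_app In dec_op v ((r, c, b), tB) = op_app (Q \<times> B \<times> EB) (dec P) (?v r) (b, c, tB)"
    if "r \<in> R" for r c b tB
  proof -
    have "op_app In dec_op v ((r, c, b), tB)
        = (\<Sum>r'\<in>R. of_bool (r = r') * (\<Sum>b'\<in>B. \<Sum>x\<in>Q. \<Sum>eB\<in>EB. dec P (b, c, tB) (x, b', eB) * v ((r', b'), (x, eB))))"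
      by (simp add: op_app_def dec_op_def sum.cartesian_product' sum_distrib_left mult.assoc)
    also have "\<dots> = (\<Sum>b'\<in>B. \<Sum>x\<in>Q. \<Sum>eB\<in>EB. dec P (b, c, tB) (x, b', eB) * v ((r, b'), (x, eB)))"
      using that by (simp add: sum_of_bool)
    also have "\<dots> = (\<Sum>x\<in>Q. \<Sum>b'\<in>B. \<Sum>eB\<in>EB. dec P (b, c, tB) (x, b', eB) * v ((r, b'), (x, eB)))"
      by (rule sum.swap)
    finally show ?thesis by (simp add: op_app_def sum.cartesian_product')
  qed
  have "norm_sq Out (op_app In dec_op v)
      = (\<Sum>r\<in>R. \<Sum>c\<in>C. \<Sum>b\<in>B. \<Sum>tB\<in>TB. (cmod (op_app (Q \<times> B \<times> EB) (dec P) (?v r) (b, c, tB)))\<^sup>2)"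
    by (simp add: norm_sq_def sum.cartesian_product' app)
  also have "\<dots> = (\<Sum>r\<in>R. \<Sum>b\<in>B. \<Sum>c\<in>C. \<Sum>tB\<in>TB. (cmod (op_app (Q \<times> B \<times> EB) (dec P) (?v r) (b, c, tB)))\<^sup>2)"
    by (rule sum.cong[OF refl], rule sum.swap)
  also have "\<dots> = (\<Sum>r\<in>R. norm_sq (Q \<times> B \<times> EB) (?v r))"
    by (simp add: isometry_norm_sq[OF _ dec_iso, symmetric]) (simp add: norm_sq_def sum.cartesian_product')
  also have "\<dots> = (\<Sum>r\<in>R. \<Sum>x\<in>Q. \<Sum>b\<in>B. \<Sum>eB\<in>EB. (cmod (v ((r, b), (x, eB))))\<^sup>2)"
    by (simp add: norm_sq_def sum.cartesian_product')
  also have "\<dots> = (\<Sum>r\<in>R. \<Sum>b\<in>B. \<Sum>x\<in>Q. \<Sum>eB\<in>EB. (cmod (v ((r, b), (x, eB))))\<^sup>2)"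
    by (rule sum.cong[OF refl], rule sum.swap)
  finally show ?thesis by (simp add: norm_sq_def sum.cartesian_product')
qed

text \<open>The encoding does not touch \<open>RB\<close>, hence \<open>RB\<close> remains in its original state.\<close>

lemma gram_encoded_RB:
  "gram (R \<times> B) ((A \<times> TA \<times> E) \<times> (Q \<times> EB)) (\<lambda>(w, z) x. encoded w (x, z)) \<sigma>
     \<longleftrightarrow> gram (R \<times> B) (A \<times> C \<times> E) branch_RB \<sigma>"
proof -
  let ?y = "\<lambda>e eB (r, b). \<lambda>(a, c, eA). \<Phi> e (r, a, b, c) * theta P (eA, eB)"
  have "(\<Sum>(w, z)\<in>(A \<times> TA \<times> E) \<times> (Q \<times> EB). encoded w (x, z) * cnj (encoded w (x', z)))
      = (\<Sum>j\<in>A \<times> C \<times> E. branch_RB j x * cnj (branch_RB j x'))" for x x'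
  proof -
    let ?V = "\<lambda>e eB x. op_app (A \<times> C \<times> EA) (enc P) (?y e eB x)"
    have "(\<Sum>(w, z)\<in>(A \<times> TA \<times> E) \<times> (Q \<times> EB). encoded w (x, z) * cnj (encoded w (x', z)))
      = (\<Sum>((a, tA, e), (k, eB))\<in>(A \<times> TA \<times> E) \<times> (Q \<times> EB). ?V e eB x (a, k, tA) * cnj (?V e eB x' (a, k, tA)))"
      by (intro sum.cong refl) (auto simp: encoded_def split: prod.splits)
    also have "\<dots> = (\<Sum>((e, eB), (a, k, tA))\<in>(E \<times> EB) \<times> (A \<times> Q \<times> TA). ?V e eB x (a, k, tA) * cnj (?V e eB x' (a, k, tA)))"
      by (rule sum.reindex_bij_witness[of _ "\<lambda>((e, eB), (a, k, tA)). ((a, tA, e), (k, eB))"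
          "\<lambda>((a, tA, e), (k, eB)). ((e, eB), (a, k, tA))"]) auto
    also have "\<dots> = (\<Sum>(e, eB)\<in>E \<times> EB. ip (A \<times> Q \<times> TA) (?V e eB x') (?V e eB x))"
      unfolding ip_def by (simp add: sum.cartesian_product' mult.commute)
    also have "\<dots> = (\<Sum>(e, eB)\<in>E \<times> EB. ip (A \<times> C \<times> EA) (?y e eB x') (?y e eB x))"
      by (simp add: isometry_ip[OF _ enc_iso])
    also have "\<dots> = (\<Sum>e\<in>E. \<Sum>eB\<in>EB. \<Sum>a\<in>A. \<Sum>c\<in>C. \<Sum>eA\<in>EA.
        branch_RB (a, c, e) x * cnj (branch_RB (a, c, e) x') * of_real ((cmod (theta P (eA, eB)))\<^sup>2))"
      unfolding ip_def sum.cartesian_product' complex_norm_square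
      by (cases x; cases x') (simp add: branch_RB_def mult_ac)
    also have "\<dots> = (\<Sum>((e, a, c), (eA, eB))\<in>(E \<times> A \<times> C) \<times> (EA \<times> EB).
        branch_RB (a, c, e) x * cnj (branch_RB (a, c, e) x') * of_real ((cmod (theta P (eA, eB)))\<^sup>2))"
      unfolding sum.cartesian_product split_def
      by (rule sum.reindex_bij_witness[of _ "\<lambda>((e, a, c), (eA, eB)). (e, eB, a, c, eA)"
          "\<lambda>(e, eB, a, c, eA). ((e, a, c), (eA, eB))"]) auto
    also have "\<dots> = (\<Sum>(e, a, c)\<in>E \<times> A \<times> C. branch_RB (a, c, e) x * cnj (branch_RB (a, c, e) x')
        * of_real (\<Sum>z\<in>EA \<times> EB. (cmod (theta P z))\<^sup>2))"
      by (simp add: sum.cartesian_product' sum_distrib_left del: of_real_power)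
    also have "\<dots> = (\<Sum>j\<in>A \<times> C \<times> E. branch_RB j x * cnj (branch_RB j x'))"
      unfolding theta_1
      by (rule sum.reindex_bij_witness[of _ "\<lambda>(a, c, e). (e, a, c)" "\<lambda>(e, a, c). (a, c, e)"]) auto
    finally show ?thesis .
  qed
  then show ?thesis unfolding gram_def by (simp add: split_def)
qed

text \<open>This transfers bounds for \<open>\<Psi>\<^sub>R\<^sub>B\<close> to the encoded state;
  with the identity for \<open>M\<close> it also yields the normalisation of the latter.\<close>

lemma sum_encoded_RB:
  "(\<Sum>w\<in>A \<times> TA \<times> E. \<Sum>z\<in>Q \<times> EB. norm_sq Y (op_app (R \<times> B) M (\<lambda>x. encoded w (x, z))))
    = (\<Sum>j\<in>A \<times> C \<times> E. norm_sq Y (op_app (R \<times> B) M (branch_RB j)))"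
proof -
  let ?\<sigma> = "\<lambda>x x'. \<Sum>j\<in>A \<times> C \<times> E. branch_RB j x * cnj (branch_RB j x')"
  have g: "gram (R \<times> B) (A \<times> C \<times> E) branch_RB ?\<sigma>" by (simp add: gram_def)
  have "(\<Sum>(w, z)\<in>(A \<times> TA \<times> E) \<times> (Q \<times> EB). norm_sq Y (op_app (R \<times> B) M (\<lambda>x. encoded w (x, z))))
    = (\<Sum>j\<in>A \<times> C \<times> E. norm_sq Y (op_app (R \<times> B) M (branch_RB j)))"
    using gram_norm_sq_unique[OF gram_encoded_RB[THEN iffD2, OF g] g, of Y M] by (simp add: split_def)
  then show ?thesis by (simp only: sum.cartesian_product)
qed

lemma encoded_1: "(\<Sum>w\<in>A \<times> TA \<times> E. norm_sq In (encoded w)) = 1"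
proof -
  let ?one = "\<lambda>x y. of_bool (x = y) :: complex"
  have one: "norm_sq (R \<times> B) (op_app (R \<times> B) ?one v) = norm_sq (R \<times> B) v" for v
    by (rule norm_sq_cong) (simp add: op_app_def sum_of_bool)
  show ?thesis
    using sum_encoded_RB[of "R \<times> B" ?one] branch_RB_1 unfolding one norm_sq_Times[of "R \<times> B"] by simp
qed

text \<open>Tracing out \<open>T\<^sub>A\<close> and \<open>T\<^sub>B\<close> turns them into
  indices, so the output state acquires an ensemble made of the vectors that Bob's decoding
  produces. This is the form that \<open>fidelity_test\<close> needs.\<close>

lemma gram_protocol_output:
  "gram (R \<times> A \<times> B \<times> C) (TA \<times> TB \<times> E)
    (\<lambda>(tA, tB, e) (r, a, b, c). op_app In dec_op (encoded (a, tA, e)) ((r, c, b), tB)) (protocol_output R A B C \<Psi> P)"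
  unfolding gram_def
proof (intro ballI)
  let ?S = "R \<times> A \<times> B \<times> C \<times> EA \<times> EB" and ?S2 = "R \<times> A \<times> Q \<times> TA \<times> B \<times> EB"
  let ?f = "\<lambda>e (r, a, b, c, eA, eB). \<Phi> e (r, a, b, c) * theta P (eA, eB)"
  let ?g = "\<lambda>e. op_app ?S (enc_full P) (?f e)"
  let ?\<rho>1 = "conj_by ?S (enc_full P) (with_theta P \<Psi>)"
  have "gram ?S E ?f (with_theta P \<Psi>)"
    using gram_Psi unfolding gram_def with_theta_def by (auto simp: sum_distrib_left sum_distrib_right mult_ac)
  note c = conj_by_gram[OF this]
  have g1: "gram ?S2 E ?g ?\<rho>1"
    unfolding gram_def by (intro ballI, rule c)
  have g: "?g e (r, a, k, tA, b, eB) = encoded (a, tA, e) ((r, b), (k, eB))"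
    if "r \<in> R" "b \<in> B" "eB \<in> EB" for e r a k tA b eB
  proof -
    let ?t = "\<lambda>r' a' b' c' eA eB'. enc P (a, k, tA) (a', c', eA) * (\<Phi> e (r', a', b', c') * theta P (eA, eB'))"
    have "?g e (r, a, k, tA, b, eB) = (\<Sum>r'\<in>R. \<Sum>a'\<in>A. \<Sum>b'\<in>B. \<Sum>c'\<in>C. \<Sum>eA\<in>EA. \<Sum>eB'\<in>EB.
        of_bool (r = r') * (of_bool (b = b') * (of_bool (eB = eB') * ?t r' a' b' c' eA eB')))"
      by (simp add: op_app_def enc_full_def sum.cartesian_product' of_bool_conj mult.assoc)
    also have "\<dots> = (\<Sum>a'\<in>A. \<Sum>c'\<in>C. \<Sum>eA\<in>EA. ?t r a' b c' eA eB)"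
      using that by (simp add: sum_distrib_left[symmetric] sum_of_bool)
    finally show ?thesis by (simp add: encoded_def op_app_def sum.cartesian_product')
  qed
  have h: "op_app ?S2 (dec_full P) (?g e) (r, a, b, c, tA, tB) = op_app In dec_op (encoded (a, tA, e)) ((r, c, b), tB)"
    if "r \<in> R" "a \<in> A" "tA \<in> TA" for e r a b c tA tB
  proof -
    let ?t = "\<lambda>r' a' k tA' b' eB. dec P (b, c, tB) (k, b', eB) * ?g e (r', a', k, tA', b', eB)"
    have "op_app ?S2 (dec_full P) (?g e) (r, a, b, c, tA, tB) = (\<Sum>r'\<in>R. \<Sum>a'\<in>A. \<Sum>k\<in>Q. \<Sum>tA'\<in>TA. \<Sum>b'\<in>B. \<Sum>eB\<in>EB.
        of_bool (r = r') * (of_bool (a = a') * (of_bool (tA = tA') * ?t r' a' k tA' b' eB)))"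
      by (simp add: op_app_def[of ?S2] dec_full_def sum.cartesian_product' of_bool_conj mult.assoc)
    also have "\<dots> = (\<Sum>k\<in>Q. \<Sum>b'\<in>B. \<Sum>eB\<in>EB. ?t r a k tA b' eB)"
      using that by (simp add: sum_distrib_left[symmetric] sum_of_bool)
    also have "\<dots> = (\<Sum>k\<in>Q. \<Sum>b'\<in>B. \<Sum>eB\<in>EB. dec P (b, c, tB) (k, b', eB) * encoded (a, tA, e) ((r, b'), (k, eB)))"
      using that by (simp add: g)
    also have "\<dots> = (\<Sum>b'\<in>B. \<Sum>k\<in>Q. \<Sum>eB\<in>EB. dec P (b, c, tB) (k, b', eB) * encoded (a, tA, e) ((r, b'), (k, eB)))"
      by (rule sum.swap)
    also have "\<dots> = (\<Sum>r'\<in>R. of_bool (r = r') * (\<Sum>b'\<in>B. \<Sum>k\<in>Q. \<Sum>eB\<in>EB. dec P (b, c, tB) (k, b', eB) * encoded (a, tA, e) ((r', b'), (k, eB))))"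
      using that by (simp add: sum_of_bool)
    finally show ?thesis
      by (simp add: op_app_def dec_op_def sum.cartesian_product' sum_distrib_left mult.assoc)
  qed
  fix x x' assume "x \<in> R \<times> A \<times> B \<times> C" "x' \<in> R \<times> A \<times> B \<times> C"
  then obtain r a b c r' a' b' c' where x: "x = (r, a, b, c)" "x' = (r', a', b', c')"
    and mem: "r \<in> R" "a \<in> A" "r' \<in> R" "a' \<in> A" by auto
  have "protocol_output R A B C \<Psi> P x x'
    = (\<Sum>tA\<in>TA. \<Sum>tB\<in>TB. conj_by ?S2 (dec_full P) ?\<rho>1 (r, a, b, c, tA, tB) (r', a', b', c', tA, tB))"
    by (simp add: protocol_output_def x Let_def)
  also have "\<dots> = (\<Sum>tA\<in>TA. \<Sum>tB\<in>TB. \<Sum>e\<in>E. op_app In dec_op (encoded (a, tA, e)) ((r, c, b), tB)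
      * cnj (op_app In dec_op (encoded (a', tA, e)) ((r', c', b'), tB)))"
    unfolding conj_by_gram[OF g1] using mem by (intro sum.cong refl) (simp add: h)
  finally show "protocol_output R A B C \<Psi> P x x' = (\<Sum>j\<in>TA \<times> TB \<times> E.
      (case j of (tA, tB, e) \<Rightarrow> \<lambda>(r, a, b, c). op_app In dec_op (encoded (a, tA, e)) ((r, c, b), tB)) x
      * cnj ((case j of (tA, tB, e) \<Rightarrow> \<lambda>(r, a, b, c). op_app In dec_op (encoded (a, tA, e)) ((r, c, b), tB)) x'))"
    by (simp add: x sum.cartesian_product')
qed

end

text \<open>Bob tests whether his systems \<open>RBQE\<^sub>B\<close> hold the register \<open>Q\<close> sent to him: he applies \<open>N\<close> to \<open>RB\<close>,
  decodes, and applies \<open>L\<close> to \<open>RCB\<close>.  The hypotheses on \<open>N\<close> say that it hardly changes the state of \<open>RB\<close> and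
  that \<open>N \<Psi>\<^sub>R\<^sub>B N\<^sup>\<dagger> \<le> \<kappa>1 (1\<^sub>R \<otimes> \<Psi>\<^sub>B)\<close>; those on \<open>L\<close>, that \<open>L\<^sup>\<dagger> L\<close> hardly changes the state of \<open>RCB\<close> and that
  \<open>Tr\<^sub>R L\<^sup>\<dagger> L \<le> \<kappa>2\<close>.\<close>

locale tested_redistribution = redistribution R A B C E \<Phi> \<Psi> P q \<epsilon>
  for R :: "'r set" and A :: "'a set" and B :: "'b set" and C :: "'c set" and E :: "'e set"
    and \<Phi> \<Psi> P q \<epsilon> +
  fixes N :: "('r \<times> 'b, 'r \<times> 'b) operator" and L :: "('r \<times> 'c \<times> 'b, 'r \<times> 'c \<times> 'b) operator"
    and \<kappa>1 \<kappa>2 \<eta>1 \<eta>2 :: real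
  assumes N_contr: "norm_sq (R \<times> B) (op_app (R \<times> B) N v) \<le> norm_sq (R \<times> B) v"
    and L_contr: "norm_sq (R \<times> C \<times> B) (op_app (R \<times> C \<times> B) L w) \<le> norm_sq (R \<times> C \<times> B) w"
    and kappa1: "0 \<le> \<kappa>1"
    and N_bound: "(\<Sum>j\<in>A \<times> C \<times> E. (cmod (\<Sum>x\<in>R \<times> B. d x * op_app (R \<times> B) N (branch_RB j) x))\<^sup>2)
      \<le> \<kappa>1 * (\<Sum>r\<in>R. \<Sum>j\<in>R \<times> A \<times> C \<times> E. (cmod (\<Sum>b\<in>B. d (r, b) * branch_B j b))\<^sup>2)"
    and N_close: "sqrt (\<Sum>j\<in>A \<times> C \<times> E. norm_sq (R \<times> B) (\<lambda>x. branch_RB j x - op_app (R \<times> B) N (branch_RB j) x)) \<le> \<eta>1"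
    and L_bound: "(\<Sum>r\<in>R. norm_sq (R \<times> C \<times> B) (op_app (R \<times> C \<times> B) L (\<lambda>(r', x). of_bool (r = r') * k x)))
      \<le> \<kappa>2 * norm_sq (C \<times> B) k"
    and L_close: "sqrt (\<Sum>j\<in>A \<times> E. norm_sq (R \<times> C \<times> B)
      (\<lambda>x. branch_RCB j x - op_app (R \<times> C \<times> B) (adj L) (op_app (R \<times> C \<times> B) L (branch_RCB j)) x)) \<le> \<eta>2"
begin

definition test_op :: "(('r \<times> 'c \<times> 'b) \<times> nat, ('r \<times> 'b) \<times> (nat \<times> nat)) operator" where
  "test_op = op_mult Out (op_lift L) (op_mult In dec_op (op_lift N))"

lemma op_app_test_op:
  "op_app In test_op v = op_app Out (op_lift L) (op_app In dec_op (op_app In (op_lift N) v))"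
  by (simp add: test_op_def op_app_mult)

lemma L_dec_contraction: "norm_sq Out (op_app Out (op_lift L) (op_app In dec_op v)) \<le> norm_sq In v"
  using lift_contraction[of TB "R \<times> C \<times> B" "R \<times> C \<times> B" L "op_app In dec_op v"] L_contr norm_sq_dec_op by simp

lemma test_op_contraction: "norm_sq Out (op_app In test_op v) \<le> norm_sq In v"
  unfolding op_app_test_op
  by (rule order_trans[OF L_dec_contraction lift_contraction]) (simp_all add: N_contr)

text \<open>\<open>g\<close> is an arbitrary vector of \<open>Q E\<^sub>B\<close>, uncorrelated with
  \<open>R B\<close>. \<open>N_bound\<close> is used once per output label, with the corresponding
  row of \<open>L\<close> after the decoding as \<open>d\<close>, and trades the state of
  \<open>R B\<close> for the identity on \<open>R\<close> and the state of \<open>B\<close>. The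
  decoding leaves the basis vector \<open>r\<close> of \<open>R\<close> alone and preserves norms on
  the rest, so \<open>L_bound\<close> applies with the decoded vector as \<open>k\<close>.\<close>

lemma wrong_test:
  "(\<Sum>j\<in>A \<times> C \<times> E. norm_sq Out (op_app In test_op (\<lambda>(x, z). branch_RB j x * g z)))
    \<le> \<kappa>1 * \<kappa>2 * norm_sq (Q \<times> EB) g"
proof -
  let ?M = "op_mult Out (op_lift L) dec_op"
  let ?J = "A \<times> C \<times> E" and ?J' = "R \<times> A \<times> C \<times> E"
  let ?e = "\<lambda>r j ((r', b), z). of_bool (r = r') * branch_B j b * g z"
  \<comment> \<open>Row \<open>o'\<close> of \<open>L\<close> after the decoding, with its
    \<open>Q E\<^sub>B\<close> part already contracted with \<open>g\<close>.\<close>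
  define d where "d = (\<lambda>o' x. \<Sum>z\<in>Q \<times> EB. ?M o' (x, z) * g z)"
  have M: "op_app In ?M (\<lambda>(x, z). h x * g z) o' = (\<Sum>x\<in>R \<times> B. d o' x * h x)" for h o'
    unfolding op_app_def d_def sum.cartesian_product'[of _ "R \<times> B"]
    by (intro sum.cong refl) (simp add: sum_distrib_left sum_distrib_right mult_ac)
  have lift: "op_app In test_op (\<lambda>(x, z). branch_RB j x * g z)
      = op_app In ?M (\<lambda>(x, z). op_app (R \<times> B) N (branch_RB j) x * g z)" for j
  proof -
    have "op_app In (op_lift N) (\<lambda>(x, z). branch_RB j x * g z) (x, z) = op_app (R \<times> B) N (branch_RB j) x * g z"
      if "z \<in> Q \<times> EB" for x z
      using that by (subst op_app_lift) (simp_all add: op_app_def sum_distrib_right mult.assoc)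
    then have "op_app In dec_op (op_app In (op_lift N) (\<lambda>(x, z). branch_RB j x * g z))
      = op_app In dec_op (\<lambda>(x, z). op_app (R \<times> B) N (branch_RB j) x * g z)"
      by (intro op_app_cong) auto
    then show ?thesis by (simp only: op_app_test_op op_app_mult)
  qed
  have "(\<Sum>j\<in>?J. norm_sq Out (op_app In test_op (\<lambda>(x, z). branch_RB j x * g z)))
    = (\<Sum>o'\<in>Out. \<Sum>j\<in>?J. (cmod (\<Sum>x\<in>R \<times> B. d o' x * op_app (R \<times> B) N (branch_RB j) x))\<^sup>2)"
    unfolding lift norm_sq_def M by (rule sum.swap)
  also have "\<dots> \<le> (\<Sum>o'\<in>Out. \<kappa>1 * (\<Sum>r\<in>R. \<Sum>j\<in>?J'. (cmod (\<Sum>b\<in>B. d o' (r, b) * branch_B j b))\<^sup>2))"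
    by (intro sum_mono N_bound)
  also have "\<dots> = \<kappa>1 * (\<Sum>o'\<in>Out. \<Sum>(r, j)\<in>R \<times> ?J'. (cmod (\<Sum>b\<in>B. d o' (r, b) * branch_B j b))\<^sup>2)"
    by (simp only: sum_distrib_left[symmetric] sum.cartesian_product)
  also have "\<dots> = \<kappa>1 * (\<Sum>(r, j)\<in>R \<times> ?J'. \<Sum>o'\<in>Out. (cmod (\<Sum>b\<in>B. d o' (r, b) * branch_B j b))\<^sup>2)"
    by (subst sum.swap) (simp add: split_def)
  also have "\<dots> = \<kappa>1 * (\<Sum>(r, j)\<in>R \<times> ?J'. norm_sq Out (op_app In ?M (?e r j)))"
  proof -
    have "op_app In ?M (?e r j) o' = (\<Sum>b\<in>B. d o' (r, b) * branch_B j b)"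
      if "r \<in> R" for r j o'
    proof -
      have "op_app In ?M (?e r j) o'
        = op_app In ?M (\<lambda>(x, z). (case x of (r', b) \<Rightarrow> of_bool (r = r') * branch_B j b) * g z) o'"
        by (simp add: split_def)
      also have "\<dots> = (\<Sum>r'\<in>R. of_bool (r = r') * (\<Sum>b\<in>B. d o' (r', b) * branch_B j b))"
        unfolding M by (simp add: sum.cartesian_product' sum_distrib_left mult_ac)
      finally show ?thesis using that by (simp add: sum_of_bool)
    qed
    then show ?thesis by (auto simp: norm_sq_def intro!: sum.cong arg_cong[where f = "\<lambda>x. \<kappa>1 * x"])
  qed
  also have "\<dots> \<le> \<kappa>1 * (\<kappa>2 * norm_sq (Q \<times> EB) g)"
  proof (rule mult_left_mono[OF _ kappa1])
    \<comment> \<open>The decoding of \<open>branch_B j\<close> together with \<open>g\<close>;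
      since \<open>dec P\<close> is an isometry, its squared norm is the product of theirs.\<close>
    define om where "om = (\<lambda>j ((c, b), tB). op_app (Q \<times> B \<times> EB) (dec P) (\<lambda>(x, b', eB). branch_B j b' * g (x, eB)) (b, c, tB))"
    have om_norm: "norm_sq ((C \<times> B) \<times> TB) (om j) = norm_sq B (branch_B j) * norm_sq (Q \<times> EB) g" for j
    proof -
      have "norm_sq ((C \<times> B) \<times> TB) (om j) = norm_sq (B \<times> C \<times> TB) (op_app (Q \<times> B \<times> EB) (dec P) (\<lambda>(x, b', eB). branch_B j b' * g (x, eB)))"
        by (simp add: om_def norm_sq_def sum.cartesian_product') (rule sum.swap)
      also have "\<dots> = norm_sq (Q \<times> B \<times> EB) (\<lambda>(x, b', eB). branch_B j b' * g (x, eB))"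
        by (rule isometry_norm_sq[OF _ dec_iso]) simp
      also have "\<dots> = (\<Sum>b\<in>B. \<Sum>x\<in>Q. \<Sum>eB\<in>EB. (cmod (branch_B j b))\<^sup>2 * (cmod (g (x, eB)))\<^sup>2)"
        by (simp add: norm_sq_def sum.cartesian_product' norm_mult power_mult_distrib) (rule sum.swap)
      also have "\<dots> = norm_sq B (branch_B j) * norm_sq (Q \<times> EB) g"
        unfolding norm_sq_def sum_distrib_right unfolding sum.cartesian_product' sum_distrib_left ..
      finally show ?thesis .
    qed
    have dec: "op_app In dec_op (?e r j) ((r1, c, b), tB) = of_bool (r = r1) * om j ((c, b), tB)"
      if "r1 \<in> R" for r j r1 c b tB
    proof -
      have "op_app In dec_op (?e r j) ((r1, c, b), tB)
        = (\<Sum>r'\<in>R. of_bool (r1 = r') * (of_bool (r = r') * (\<Sum>b'\<in>B. \<Sum>x\<in>Q. \<Sum>eB\<in>EB. dec P (b, c, tB) (x, b', eB) * (branch_B j b' * g (x, eB)))))"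
        by (simp add: op_app_def dec_op_def sum.cartesian_product' sum_distrib_left mult_ac)
      also have "\<dots> = of_bool (r = r1) * (\<Sum>b'\<in>B. \<Sum>x\<in>Q. \<Sum>eB\<in>EB. dec P (b, c, tB) (x, b', eB) * (branch_B j b' * g (x, eB)))"
        using that by (subst sum_of_bool) simp_all
      also have "(\<Sum>b'\<in>B. \<Sum>x\<in>Q. \<Sum>eB\<in>EB. dec P (b, c, tB) (x, b', eB) * (branch_B j b' * g (x, eB))) = om j ((c, b), tB)"
        by (simp add: om_def op_app_def sum.cartesian_product') (rule sum.swap)
      finally show ?thesis .
    qed
    have "(\<Sum>r\<in>R. norm_sq Out (op_app In ?M (?e r j)))
      \<le> \<kappa>2 * (norm_sq B (branch_B j) * norm_sq (Q \<times> EB) g)" for j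
    proof -
      have "op_app In ?M (?e r j)
        = op_app Out (op_lift L) (\<lambda>((r1, x), tB). of_bool (r = r1) * om j (x, tB))" for r
        unfolding op_app_mult by (rule op_app_cong) (auto simp: dec)
      then have "(\<Sum>r\<in>R. norm_sq Out (op_app In ?M (?e r j)))
        = (\<Sum>r\<in>R. \<Sum>tB\<in>TB. norm_sq (R \<times> C \<times> B) (op_app (R \<times> C \<times> B) L (\<lambda>(r1, x). of_bool (r = r1) * om j (x, tB))))"
        by (simp add: norm_sq_lift split_def)
      also have "\<dots> = (\<Sum>tB\<in>TB. \<Sum>r\<in>R. norm_sq (R \<times> C \<times> B) (op_app (R \<times> C \<times> B) L (\<lambda>(r1, x). of_bool (r = r1) * om j (x, tB))))"
        by (rule sum.swap)
      also have "\<dots> \<le> (\<Sum>tB\<in>TB. \<kappa>2 * norm_sq (C \<times> B) (\<lambda>x. om j (x, tB)))"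
        by (intro sum_mono L_bound)
      also have "\<dots> = \<kappa>2 * norm_sq ((C \<times> B) \<times> TB) (om j)"
        by (simp add: norm_sq_Times[of "C \<times> B"] sum_distrib_left)
      finally show ?thesis by (simp only: om_norm)
    qed
    then have "(\<Sum>j\<in>?J'. \<Sum>r\<in>R. norm_sq Out (op_app In ?M (?e r j)))
      \<le> (\<Sum>j\<in>?J'. \<kappa>2 * (norm_sq B (branch_B j) * norm_sq (Q \<times> EB) g))"
      by (intro sum_mono)
    also have "\<dots> = \<kappa>2 * norm_sq (Q \<times> EB) g"
      using branch_B_1 by (simp add: sum_distrib_left[symmetric] sum_distrib_right[symmetric])
    finally show "(\<Sum>(r, j)\<in>R \<times> ?J'. norm_sq Out (op_app In ?M (?e r j)))
      \<le> \<kappa>2 * norm_sq (Q \<times> EB) g"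
      by (subst sum.cartesian_product[symmetric], subst sum.swap)
  qed
  finally show ?thesis by (simp add: mult.assoc)
qed

text \<open>Dropping \<open>N\<close> costs \<open>\<eta>1\<close>, because the decoding and
  \<open>L\<close> are contractions and the encoded state agrees with \<open>\<Psi>\<close> on
  \<open>R B\<close>. The remaining \<open>L\<close>, extended by the identity on \<open>A\<close>,
  is a test of the protocol output, which \<open>fidelity_test\<close> compares with
  \<open>\<Psi>\<close> at the cost \<open>\<eta>2\<close>.\<close>

lemma correct_test:
  "sqrt (1 - \<epsilon>\<^sup>2) - \<eta>1 - \<eta>2 \<le> sqrt (\<Sum>w\<in>A \<times> TA \<times> E. norm_sq Out (op_app In test_op (encoded w)))"
proof -
  let ?W = "A \<times> TA \<times> E" and ?X = "R \<times> A \<times> B \<times> C" and ?Y = "(R \<times> C \<times> B) \<times> A" and ?Z = "R \<times> C \<times> B"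
  let ?LD = "\<lambda>v. op_app Out (op_lift L) (op_app In dec_op v)"
  let ?N = "op_app In (op_lift N)"
  have "sqrt (\<Sum>w\<in>?W. norm_sq Out (?LD (encoded w))) \<le> sqrt (\<Sum>w\<in>?W. norm_sq Out (?LD (?N (encoded w))))
      + sqrt (\<Sum>w\<in>?W. norm_sq Out (\<lambda>x. ?LD (encoded w) x - ?LD (?N (encoded w)) x))"
    by (rule norm_sq_family_triangle_diff)
  also have "\<dots> = sqrt (\<Sum>w\<in>?W. norm_sq Out (op_app In test_op (encoded w)))
      + sqrt (\<Sum>w\<in>?W. norm_sq Out (?LD (\<lambda>x. encoded w x - ?N (encoded w) x)))"
    by (simp add: op_app_test_op op_app_diff)
  also have "sqrt (\<Sum>w\<in>?W. norm_sq Out (?LD (\<lambda>x. encoded w x - ?N (encoded w) x))) \<le> \<eta>1"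
  proof -
    let ?one = "\<lambda>x y. of_bool (x = y) - N x y :: complex"
    have one: "op_app (R \<times> B) ?one v x = v x - op_app (R \<times> B) N v x" if "x \<in> R \<times> B" for v x
      using that by (simp add: op_app_def left_diff_distrib sum_subtractf sum_of_bool)
    have one': "norm_sq (R \<times> B) (op_app (R \<times> B) ?one v) = norm_sq (R \<times> B) (\<lambda>x. v x - op_app (R \<times> B) N v x)" for v
      using one by (rule norm_sq_cong)
    have "(\<Sum>w\<in>?W. norm_sq Out (?LD (\<lambda>x. encoded w x - ?N (encoded w) x)))
      \<le> (\<Sum>w\<in>?W. norm_sq In (\<lambda>x. encoded w x - ?N (encoded w) x))"
      by (intro sum_mono L_dec_contraction)
    also have "\<dots> = (\<Sum>w\<in>?W. \<Sum>z\<in>Q \<times> EB. norm_sq (R \<times> B) (op_app (R \<times> B) ?one (\<lambda>x. encoded w (x, z))))"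
      unfolding one' norm_sq_Times[of "R \<times> B"] by (intro sum.cong refl norm_sq_cong) (simp add: op_app_lift)
    also have "\<dots> = (\<Sum>j\<in>A \<times> C \<times> E. norm_sq (R \<times> B) (\<lambda>x. branch_RB j x - op_app (R \<times> B) N (branch_RB j) x))"
      unfolding sum_encoded_RB unfolding one' ..
    finally have "sqrt (\<Sum>w\<in>?W. norm_sq Out (?LD (\<lambda>x. encoded w x - ?N (encoded w) x)))
      \<le> sqrt (\<Sum>j\<in>A \<times> C \<times> E. norm_sq (R \<times> B) (\<lambda>x. branch_RB j x - op_app (R \<times> B) N (branch_RB j) x))"
      by simp
    then show ?thesis using N_close by linarith
  qed
  finally have 1: "sqrt (\<Sum>w\<in>?W. norm_sq Out (?LD (encoded w))) - \<eta>1
    \<le> sqrt (\<Sum>w\<in>?W. norm_sq Out (op_app In test_op (encoded w)))" by simp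
  \<comment> \<open>\<open>L\<close> with the identity on \<open>A\<close>; the labels of
    \<open>R A B C\<close> are reordered so that \<open>R C B\<close> comes first.\<close>
  define M :: "(('r \<times> 'c \<times> 'b) \<times> 'a, 'r \<times> 'a \<times> 'b \<times> 'c) operator"
    where "M = (\<lambda>(x, a) (r, a', b, c). of_bool (a = a') * L x (r, c, b))"
  have M: "op_app ?X M v (x, a) = op_app ?Z L (\<lambda>(r, c, b). v (r, a, b, c)) x" if "a \<in> A" for v x a
  proof -
    have "op_app ?X M v (x, a) = (\<Sum>r\<in>R. \<Sum>a'\<in>A. of_bool (a = a') * (\<Sum>b\<in>B. \<Sum>c\<in>C. L x (r, c, b) * v (r, a', b, c)))"
      by (simp add: M_def op_app_def sum.cartesian_product' sum_distrib_left mult.assoc)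
    also have "\<dots> = (\<Sum>r\<in>R. \<Sum>b\<in>B. \<Sum>c\<in>C. L x (r, c, b) * v (r, a, b, c))"
      using that by (simp add: sum_of_bool)
    also have "\<dots> = (\<Sum>r\<in>R. \<Sum>c\<in>C. \<Sum>b\<in>B. L x (r, c, b) * v (r, a, b, c))"
      by (rule sum.cong[OF refl], rule sum.swap)
    finally show ?thesis by (simp add: op_app_def sum.cartesian_product')
  qed
  have adjM: "op_app ?Y (adj M) u (r, a, b, c) = op_app ?Z (adj L) (\<lambda>x. u (x, a)) (r, c, b)" if "a \<in> A" for u r a b c
  proof -
    have "op_app ?Y (adj M) u (r, a, b, c) = (\<Sum>x\<in>?Z. \<Sum>a'\<in>A. of_bool (a' = a) * (cnj (L x (r, c, b)) * u (x, a')))"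
      unfolding op_app_def sum.cartesian_product'[of _ ?Z]
      by (rule sum.cong[OF refl], rule sum.cong[OF refl]) (simp add: M_def adj_def of_bool_def)
    also have "\<dots> = (\<Sum>x\<in>?Z. cnj (L x (r, c, b)) * u (x, a))" using that by (simp add: sum_of_bool)
    finally show ?thesis by (simp add: op_app_def adj_def)
  qed
  have slice: "norm_sq ?X v = (\<Sum>a\<in>A. norm_sq ?Z (\<lambda>(r, c, b). v (r, a, b, c)))" for v
  proof -
    have "norm_sq ?X v = (\<Sum>a\<in>A. \<Sum>r\<in>R. \<Sum>b\<in>B. \<Sum>c\<in>C. (cmod (v (r, a, b, c)))\<^sup>2)"
      by (simp add: norm_sq_def sum.cartesian_product') (rule sum.swap)
    also have "\<dots> = (\<Sum>a\<in>A. \<Sum>r\<in>R. \<Sum>c\<in>C. \<Sum>b\<in>B. (cmod (v (r, a, b, c)))\<^sup>2)"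
      by (rule sum.cong[OF refl], rule sum.cong[OF refl], rule sum.swap)
    finally show ?thesis by (simp add: norm_sq_def sum.cartesian_product')
  qed
  have normM: "norm_sq ?Y (op_app ?X M v) = (\<Sum>a\<in>A. norm_sq ?Z (op_app ?Z L (\<lambda>(r, c, b). v (r, a, b, c))))" for v
    unfolding norm_sq_Times[of ?Z A] by (intro sum.cong refl norm_sq_cong) (simp add: M)
  have M_contr: "norm_sq ?Y (op_app ?X M v) \<le> norm_sq ?X v" for v
    unfolding normM slice by (intro sum_mono L_contr)
  let ?g = "\<lambda>(tA, tB, e) (r, a, b, c). op_app In dec_op (encoded (a, tA, e)) ((r, c, b), tB)"
  \<comment> \<open>Between output vectors and decoded vectors, \<open>A\<close> passes from the
    argument to the index and \<open>T\<^sub>B\<close> the other way.\<close>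
  have reorder: "(\<Sum>(tA, tB, e)\<in>TA \<times> TB \<times> E. \<Sum>a\<in>A. h a tA tB e) = (\<Sum>(a, tA, e)\<in>?W. \<Sum>tB\<in>TB. h a tA tB e)"
    for h :: "'a \<Rightarrow> nat \<Rightarrow> nat \<Rightarrow> 'e \<Rightarrow> real"
    unfolding split_def sum.cartesian_product
    by (rule sum.reindex_bij_witness[of _ "\<lambda>((a, tA, e), tB). ((tA, tB, e), a)" "\<lambda>((tA, tB, e), a). ((a, tA, e), tB)"]) auto
  have g1: "(\<Sum>j\<in>TA \<times> TB \<times> E. norm_sq ?X (?g j)) = 1"
  proof -
    have "(\<Sum>j\<in>TA \<times> TB \<times> E. norm_sq ?X (?g j))
      = (\<Sum>(tA, tB, e)\<in>TA \<times> TB \<times> E. \<Sum>a\<in>A. norm_sq ?Z (\<lambda>x. op_app In dec_op (encoded (a, tA, e)) (x, tB)))"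
      unfolding slice by (intro sum.cong refl) (auto intro!: sum.cong norm_sq_cong)
    also have "\<dots> = (\<Sum>w\<in>?W. norm_sq Out (op_app In dec_op (encoded w)))"
      unfolding reorder norm_sq_Times[of ?Z] by (simp add: split_def)
    finally show ?thesis by (simp add: norm_sq_dec_op encoded_1)
  qed
  have gM: "(\<Sum>j\<in>TA \<times> TB \<times> E. norm_sq ?Y (op_app ?X M (?g j))) = (\<Sum>w\<in>?W. norm_sq Out (?LD (encoded w)))"
  proof -
    have "(\<Sum>j\<in>TA \<times> TB \<times> E. norm_sq ?Y (op_app ?X M (?g j)))
      = (\<Sum>(tA, tB, e)\<in>TA \<times> TB \<times> E. \<Sum>a\<in>A. norm_sq ?Z (op_app ?Z L (\<lambda>x. op_app In dec_op (encoded (a, tA, e)) (x, tB))))"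
      unfolding normM
      by (intro sum.cong refl) (auto intro!: sum.cong arg_cong[where f = "norm_sq ?Z"] op_app_cong)
    also have "\<dots> = (\<Sum>w\<in>?W. norm_sq Out (?LD (encoded w)))"
      unfolding reorder by (simp add: norm_sq_lift split_def)
    finally show ?thesis .
  qed
  have close: "(\<Sum>e\<in>E. norm_sq ?X (\<lambda>x. \<Phi> e x - op_app ?Y (adj M) (op_app ?X M (\<Phi> e)) x))
    = (\<Sum>j\<in>A \<times> E. norm_sq ?Z (\<lambda>x. branch_RCB j x - op_app ?Z (adj L) (op_app ?Z L (branch_RCB j)) x))"
  proof -
    have *: "op_app ?Y (adj M) (op_app ?X M (\<Phi> e)) (r, a, b, c)
      = op_app ?Z (adj L) (op_app ?Z L (branch_RCB (a, e))) (r, c, b)" if "a \<in> A" for e r a b c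
    proof -
      have "branch_RCB (a, e) = (\<lambda>(r, c, b). \<Phi> e (r, a, b, c))" by (simp add: branch_RCB_def)
      then show ?thesis using that by (simp only: adjM M)
    qed
    have "(\<Sum>e\<in>E. norm_sq ?X (\<lambda>x. \<Phi> e x - op_app ?Y (adj M) (op_app ?X M (\<Phi> e)) x))
      = (\<Sum>e\<in>E. \<Sum>a\<in>A. norm_sq ?Z (\<lambda>x. branch_RCB (a, e) x - op_app ?Z (adj L) (op_app ?Z L (branch_RCB (a, e))) x))"
      unfolding slice by (intro sum.cong refl norm_sq_cong) (auto simp: * branch_RCB_def)
    also have "\<dots> = (\<Sum>a\<in>A. \<Sum>e\<in>E. norm_sq ?Z (\<lambda>x. branch_RCB (a, e) x - op_app ?Z (adj L) (op_app ?Z L (branch_RCB (a, e))) x))"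
      by (rule sum.swap)
    finally show ?thesis by (simp add: sum.cartesian_product')
  qed
  have "sqrt (1 - \<epsilon>\<^sup>2) \<le> sqrt (\<Sum>j\<in>TA \<times> TB \<times> E. norm_sq ?Y (op_app ?X M (?g j)))
    + sqrt (\<Sum>e\<in>E. norm_sq ?X (\<lambda>x. \<Phi> e x - op_app ?Y (adj M) (op_app ?X M (\<Phi> e)) x))"
    by (rule fidelity_test[OF _ gram_protocol_output gram_Psi g1 Phi_1 M_contr dist eps]) simp
  then show ?thesis using 1 L_close unfolding gM close by linarith
qed

end

section \<open>Sums over lists of labels\<close>

lemma finite_nlists: "finite A \<Longrightarrow> finite (nlists n A)"
proof -
  have "nlists n A = {xs. set xs \<subseteq> A \<and> length xs = n}" unfolding nlists_def by blast
  then show "finite A \<Longrightarrow> finite (nlists n A)" by (simp only: finite_lists_length_eq)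
qed

lemma sum_nlists_Suc:
  assumes "finite A"
  shows "(\<Sum>xs\<in>nlists (Suc n) A. f xs) = (\<Sum>x\<in>A. \<Sum>xs\<in>nlists n A. f (x # xs))"
proof -
  have "(\<Sum>xs\<in>nlists (Suc n) A. f xs) = (\<Sum>(x, xs)\<in>A \<times> nlists n A. f (x # xs))"
    by (rule sum.reindex_bij_witness[of _ "\<lambda>(x, xs). x # xs" "\<lambda>xs. (hd xs, tl xs)"])
      (auto simp: in_nlists_Suc_iff)
  then show ?thesis by (simp add: sum.cartesian_product)
qed

text \<open>The distributive law for products over list positions. Statements about tensor powers
  and about independent pairs factorise through it and its variants.\<close>

lemma sum_prod_nlists:
  fixes f :: "nat \<Rightarrow> 'x \<Rightarrow> 'a::comm_semiring_1"
  assumes "finite A"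
  shows "(\<Sum>xs\<in>nlists n A. \<Prod>i<n. f i (xs ! i)) = (\<Prod>i<n. \<Sum>x\<in>A. f i x)"
proof (induction n arbitrary: f)
  case (Suc n)
  have "(\<Sum>xs\<in>nlists (Suc n) A. \<Prod>i<Suc n. f i (xs ! i))
      = (\<Sum>x\<in>A. f 0 x * (\<Sum>xs\<in>nlists n A. \<Prod>i<n. f (Suc i) (xs ! i)))"
    by (simp add: sum_nlists_Suc[OF assms] prod.lessThan_Suc_shift sum_distrib_left del: prod.lessThan_Suc)
  also have "\<dots> = (\<Sum>x\<in>A. f 0 x * (\<Prod>i<n. \<Sum>x\<in>A. f (Suc i) x))"
    by (subst Suc.IH[of "\<lambda>i. f (Suc i)"]) (rule refl)
  finally show ?case
    by (simp add: prod.lessThan_Suc_shift sum_distrib_right del: prod.lessThan_Suc)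
qed simp

lemma sum_prod_nlists2:
  fixes g :: "nat \<Rightarrow> 'x \<Rightarrow> 'y \<Rightarrow> 'a::comm_semiring_1"
  assumes "finite A" "finite B"
  shows "(\<Sum>xs\<in>nlists n A. \<Sum>ys\<in>nlists n B. \<Prod>i<n. g i (xs ! i) (ys ! i)) = (\<Prod>i<n. \<Sum>x\<in>A. \<Sum>y\<in>B. g i x y)"
proof -
  have "(\<Sum>ys\<in>nlists n B. \<Prod>i<n. g i (xs ! i) (ys ! i)) = (\<Prod>i<n. \<Sum>y\<in>B. g i (xs ! i) y)" for xs
    by (rule sum_prod_nlists[OF assms(2)])
  then show ?thesis
    using sum_prod_nlists[OF assms(1), of "\<lambda>i x. \<Sum>y\<in>B. g i x y"] by simp
qed

lemma sum_of_bool_nested: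
  fixes F :: "'e \<Rightarrow> 'r \<Rightarrow> 'b \<Rightarrow> 'e \<Rightarrow> 'a::semiring_1"
  assumes "finite E"
  shows "(\<Sum>e\<in>E. \<Sum>r\<in>R. \<Sum>b\<in>B. \<Sum>e'\<in>E. of_bool (e = e') * F e r b e') = (\<Sum>e\<in>E. \<Sum>r\<in>R. \<Sum>b\<in>B. F e r b e)"
  by (rule sum.cong[OF refl], rule sum.cong[OF refl], rule sum.cong[OF refl], subst sum_of_bool(1)[OF assms]) simp

lemma prod_if_eq:
  fixes a :: "'a::comm_monoid_mult" and j n :: nat
  assumes "j < n"
  shows "(\<Prod>i<n. if i = j then a else 1) = a"
  using assms by (subst prod.delta) auto

lemma prod_if_eq2:
  fixes a b :: "'a::comm_monoid_mult" and j k n :: nat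
  assumes "j < n" "k < n" "j \<noteq> k"
  shows "(\<Prod>i<n. if i = j then a else if i = k then b else 1) = a * b"
proof -
  have "(\<Prod>i<n. if i = j then a else if i = k then b else 1)
      = (\<Prod>i<n. (if i = j then a else 1) * (if i = k then b else 1))"
    using assms by (intro prod.cong) auto
  then show ?thesis using assms by (simp add: prod.distrib prod_if_eq)
qed

section \<open>The simulation\<close>

text \<open>Up to the relabelling \<open>\<beta>\<close>, \<open>T\<close> is the identity on
  \<open>G\<close> tensored with \<open>M\<^sup>\<dagger> M\<close>, so its quadratic form at
  \<open>v\<close> is the sum over \<open>g\<close> of the squared norms of \<open>M\<close> applied
  to the slices of \<open>v\<close>.\<close>

lemma effect_of_contraction:
  assumes fin: "finite X" "finite G" "finite U" and \<beta>: "bij_betw \<beta> X (G \<times> U)"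
    and T: "\<And>x x'. x \<in> X \<Longrightarrow> x' \<in> X \<Longrightarrow>
      T x x' = of_bool (fst (\<beta> x) = fst (\<beta> x')) * op_mult Z (adj M) M (snd (\<beta> x)) (snd (\<beta> x'))"
    and M: "\<And>v. norm_sq Z (op_app U M v) \<le> norm_sq U v"
  shows "effect X T"
proof -
  have key: "ip X v (op_app X T v) = of_real (\<Sum>g\<in>G. norm_sq Z (op_app U M (\<lambda>u. v (inv_into X \<beta> (g, u)))))"
    and norm: "norm_sq X v = (\<Sum>g\<in>G. norm_sq U (\<lambda>u. v (inv_into X \<beta> (g, u))))" for v
  proof -
    let ?v = "\<lambda>p. v (inv_into X \<beta> p)"
    let ?A = "op_mult Z (adj M) M"
    have v: "?v (\<beta> x) = v x" if "x \<in> X" for x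
      using bij_betw_inv_into_left[OF \<beta> that] by simp
    have "ip X v (op_app X T v) = (\<Sum>x\<in>X. \<Sum>x'\<in>X.
        cnj (?v (\<beta> x)) * (of_bool (fst (\<beta> x) = fst (\<beta> x')) * ?A (snd (\<beta> x)) (snd (\<beta> x')) * ?v (\<beta> x')))"
      unfolding ip_def op_app_def sum_distrib_left by (intro sum.cong refl) (simp only: v T)
    also have "\<dots> = (\<Sum>x\<in>X. \<Sum>p'\<in>G \<times> U.
        cnj (?v (\<beta> x)) * (of_bool (fst (\<beta> x) = fst p') * ?A (snd (\<beta> x)) (snd p') * ?v p'))"
      by (rule sum.cong[OF refl], rule sum.reindex_bij_betw[OF \<beta>])
    also have "\<dots> = (\<Sum>p\<in>G \<times> U. \<Sum>p'\<in>G \<times> U.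
        cnj (?v p) * (of_bool (fst p = fst p') * ?A (snd p) (snd p') * ?v p'))"
      by (rule sum.reindex_bij_betw[OF \<beta>])
    also have "\<dots> = (\<Sum>g\<in>G. \<Sum>u\<in>U. \<Sum>g'\<in>G. of_bool (g = g') * (\<Sum>u'\<in>U.
        cnj (?v (g, u)) * (?A u u' * ?v (g', u'))))"
      unfolding sum.cartesian_product' sum_distrib_left by (intro sum.cong refl) (simp add: mult_ac)
    also have "\<dots> = (\<Sum>g\<in>G. \<Sum>u\<in>U. \<Sum>u'\<in>U. cnj (?v (g, u)) * (?A u u' * ?v (g, u')))"
      by (rule sum.cong[OF refl], rule sum.cong[OF refl], subst sum_of_bool(1)[OF fin(2)]) simp
    also have "\<dots> = (\<Sum>g\<in>G. ip U (\<lambda>u. ?v (g, u)) (op_app U ?A (\<lambda>u. ?v (g, u))))"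
      by (simp add: ip_def op_app_def sum_distrib_left)
    finally show "ip X v (op_app X T v) = of_real (\<Sum>g\<in>G. norm_sq Z (op_app U M (\<lambda>u. ?v (g, u))))"
      by (simp add: ip_adj_mult)
    have "norm_sq X v = (\<Sum>x\<in>X. (cmod (?v (\<beta> x)))\<^sup>2)" by (simp add: norm_sq_def v)
    also have "\<dots> = (\<Sum>p\<in>G \<times> U. (cmod (?v p))\<^sup>2)" by (rule sum.reindex_bij_betw[OF \<beta>])
    finally show "norm_sq X v = (\<Sum>g\<in>G. norm_sq U (\<lambda>u. ?v (g, u)))"
      by (simp add: norm_sq_def sum.cartesian_product')
  qed
  show ?thesis
    unfolding effect_def positive_op_iff key norm by (auto intro!: sum_nonneg sum_mono M)
qed

section \<open>Bob's state and his test on a single pair\<close>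

context tested_redistribution
begin

abbreviation "Y \<equiv> R \<times> B \<times> E"
abbreviation "Z \<equiv> Q \<times> EB"

definition pair_amp :: "'a \<times> 'c \<Rightarrow> 'r \<times> 'b \<times> 'e \<Rightarrow> complex" where
  "pair_amp = (\<lambda>(a, c) (r, b, e). \<Phi> e (r, a, b, c))"

text \<open>Bob's reduced state of \<open>R B E\<close> for a pair that Alice does not use; her
  \<open>A C\<close> are traced out.\<close>

definition idle :: "'r \<times> 'b \<times> 'e \<Rightarrow> 'r \<times> 'b \<times> 'e \<Rightarrow> complex" where
  "idle y y' = (\<Sum>z\<in>A \<times> C. pair_amp z y * cnj (pair_amp z y'))"

definition sent_amp :: "'a \<times> nat \<Rightarrow> ('r \<times> 'b \<times> 'e) \<times> (nat \<times> nat) \<Rightarrow> complex" where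
  "sent_amp = (\<lambda>(a, tA) ((r, b, e), z). encoded (a, tA, e) ((r, b), z))"

text \<open>Bob's joint state of \<open>Q E\<^sub>B\<close> and of his half of the pair that Alice
  has used.\<close>

definition sent :: "('r \<times> 'b \<times> 'e) \<times> (nat \<times> nat) \<Rightarrow> ('r \<times> 'b \<times> 'e) \<times> (nat \<times> nat) \<Rightarrow> complex" where
  "sent u u' = (\<Sum>w\<in>A \<times> TA. sent_amp w u * cnj (sent_amp w u'))"

definition slot_test :: "('r \<times> 'b \<times> 'e) \<times> (nat \<times> nat) \<Rightarrow> ('r \<times> 'b \<times> 'e) \<times> (nat \<times> nat) \<Rightarrow> complex" where
  "slot_test = (\<lambda>((r, b, e), z) ((r', b', e'), z').
     of_bool (e = e') * op_mult Out (adj test_op) test_op ((r, b), z) ((r', b'), z'))"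

lemma sum_idle: "(\<Sum>y\<in>Y. idle y y) = 1"
proof -
  have "(\<Sum>y\<in>Y. idle y y) = (\<Sum>(r, b, e)\<in>Y. \<Sum>(a, c)\<in>A \<times> C. of_real ((cmod (\<Phi> e (r, a, b, c)))\<^sup>2))"
    by (simp add: idle_def pair_amp_def split_def complex_norm_square del: of_real_power)
  also have "\<dots> = (\<Sum>(e, r, a, b, c)\<in>E \<times> R \<times> A \<times> B \<times> C. of_real ((cmod (\<Phi> e (r, a, b, c)))\<^sup>2))"
    unfolding split_def sum.cartesian_product
    by (rule sum.reindex_bij_witness[of _ "\<lambda>(e, r, a, b, c). ((r, b, e), (a, c))" "\<lambda>((r, b, e), (a, c)). (e, r, a, b, c)"]) auto
  also have "\<dots> = of_real (\<Sum>e\<in>E. norm_sq (R \<times> A \<times> B \<times> C) (\<Phi> e))"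
    by (simp add: norm_sq_def sum.cartesian_product split_def)
  finally show ?thesis by (simp add: Phi_1)
qed

lemma sum_sent: "(\<Sum>z\<in>Z. \<Sum>y\<in>Y. sent (y, z) (y, z)) = 1"
proof -
  have "(\<Sum>z\<in>Z. \<Sum>y\<in>Y. sent (y, z) (y, z))
      = (\<Sum>z\<in>Z. \<Sum>(r, b, e)\<in>Y. \<Sum>(a, tA)\<in>A \<times> TA. of_real ((cmod (encoded (a, tA, e) ((r, b), z)))\<^sup>2))"
    by (simp add: sent_def sent_amp_def split_def complex_norm_square del: of_real_power)
  also have "\<dots> = (\<Sum>((a, tA, e), ((r, b), z))\<in>(A \<times> TA \<times> E) \<times> In. of_real ((cmod (encoded (a, tA, e) ((r, b), z)))\<^sup>2))"
    unfolding split_def sum.cartesian_product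
    by (rule sum.reindex_bij_witness[of _ "\<lambda>((a, tA, e), ((r, b), z)). (z, (r, b, e), (a, tA))"
        "\<lambda>(z, (r, b, e), (a, tA)). ((a, tA, e), ((r, b), z))"]) auto
  also have "\<dots> = of_real (\<Sum>w\<in>A \<times> TA \<times> E. norm_sq In (encoded w))"
    by (simp add: norm_sq_def sum.cartesian_product split_def)
  finally show ?thesis by (simp add: encoded_1)
qed

lemma slot_test_sent:
  "(\<Sum>z\<in>Z. \<Sum>z'\<in>Z. \<Sum>y\<in>Y. \<Sum>y'\<in>Y. slot_test (y, z) (y', z') * sent (y', z') (y, z))
    = of_real (\<Sum>w\<in>A \<times> TA \<times> E. norm_sq Out (op_app In test_op (encoded w)))"
proof -
  let ?T = "op_mult Out (adj test_op) test_op"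
  let ?t = "\<lambda>r b z r' b' z' e a tA. cnj (encoded (a, tA, e) ((r, b), z)) * (?T ((r, b), z) ((r', b'), z') * encoded (a, tA, e) ((r', b'), z'))"
  have "(\<Sum>z\<in>Z. \<Sum>z'\<in>Z. \<Sum>y\<in>Y. \<Sum>y'\<in>Y. slot_test (y, z) (y', z') * sent (y', z') (y, z))
    = (\<Sum>z\<in>Z. \<Sum>z'\<in>Z. \<Sum>r\<in>R. \<Sum>b\<in>B. \<Sum>e\<in>E. \<Sum>r'\<in>R. \<Sum>b'\<in>B. \<Sum>e'\<in>E. of_bool (e = e') *
        (?T ((r, b), z) ((r', b'), z') * sent ((r', b', e'), z') ((r, b, e), z)))"
    by (simp add: slot_test_def sum.cartesian_product'[of _ R] sum.cartesian_product'[of _ B] mult.assoc)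
  also have "\<dots> = (\<Sum>z\<in>Z. \<Sum>z'\<in>Z. \<Sum>r\<in>R. \<Sum>b\<in>B. \<Sum>e\<in>E. \<Sum>r'\<in>R. \<Sum>b'\<in>B. \<Sum>(a, tA)\<in>A \<times> TA. ?t r b z r' b' z' e a tA)"
    unfolding sum_of_bool_nested[OF fin(5)] by (simp add: sent_def sent_amp_def sum_distrib_left split_def mult_ac)
  also have "\<dots> = (\<Sum>((a, tA, e), (((r, b), z), ((r', b'), z')))\<in>(A \<times> TA \<times> E) \<times> (In \<times> In). ?t r b z r' b' z' e a tA)"
    unfolding split_def sum.cartesian_product
    by (rule sum.reindex_bij_witness[of _ "\<lambda>((a, tA, e), (((r, b), z), ((r', b'), z'))). (z, z', r, b, e, r', b', (a, tA))"
        "\<lambda>(z, z', r, b, e, r', b', (a, tA)). ((a, tA, e), (((r, b), z), ((r', b'), z')))"]) auto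
  also have "\<dots> = (\<Sum>w\<in>A \<times> TA \<times> E. \<Sum>u\<in>In. \<Sum>u'\<in>In. cnj (encoded w u) * (?T u u' * encoded w u'))"
    by (simp add: sum.cartesian_product split_def)
  also have "\<dots> = (\<Sum>w\<in>A \<times> TA \<times> E. ip In (encoded w) (op_app In ?T (encoded w)))"
    by (simp add: ip_def op_app_def sum_distrib_left)
  also have "\<dots> = (\<Sum>w\<in>A \<times> TA \<times> E. of_real (norm_sq Out (op_app In test_op (encoded w))))"
    by (simp only: ip_adj_mult)
  finally show ?thesis by simp
qed

text \<open>For a wrong pair the test sees the product of \<open>\<Psi>\<^sub>R\<^sub>B\<close> and
  the state of \<open>Q E\<^sub>B\<close>. The latter is the mixture of the vectors
  \<open>?g w\<close>, which arise from \<open>encoded\<close> by moving \<open>R B\<close> into the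
  index; \<open>wrong_test\<close> applies to each of them, and their weights sum to 1.\<close>

lemma slot_test_idle:
  "Re (\<Sum>z\<in>Z. \<Sum>z'\<in>Z. (\<Sum>y\<in>Y. \<Sum>y'\<in>Y. slot_test (y, z) (y', z') * idle y' y) * (\<Sum>y\<in>Y. sent (y, z') (y, z)))
    \<le> \<kappa>1 * \<kappa>2"
proof -
  let ?T = "op_mult Out (adj test_op) test_op"
  let ?W = "(A \<times> TA \<times> E) \<times> (R \<times> B)" and ?J = "A \<times> C \<times> E"
  let ?g = "\<lambda>(w, x) z. encoded w (x, z)"
  have idle: "(\<Sum>y\<in>Y. \<Sum>y'\<in>Y. slot_test (y, z) (y', z') * idle y' y)
    = (\<Sum>j\<in>?J. \<Sum>x\<in>R \<times> B. \<Sum>x'\<in>R \<times> B. cnj (branch_RB j x) * ?T (x, z) (x', z') * branch_RB j x')" for z z'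
  proof -
    have "(\<Sum>y\<in>Y. \<Sum>y'\<in>Y. slot_test (y, z) (y', z') * idle y' y)
      = (\<Sum>r\<in>R. \<Sum>b\<in>B. \<Sum>e\<in>E. \<Sum>r'\<in>R. \<Sum>b'\<in>B. \<Sum>e'\<in>E. of_bool (e = e') *
        (?T ((r, b), z) ((r', b'), z') * idle (r', b', e') (r, b, e)))"
      by (simp add: slot_test_def sum.cartesian_product'[of _ R] sum.cartesian_product'[of _ B] mult.assoc)
    also have "\<dots> = (\<Sum>r\<in>R. \<Sum>b\<in>B. \<Sum>e\<in>E. \<Sum>r'\<in>R. \<Sum>b'\<in>B. \<Sum>(a, c)\<in>A \<times> C.
        cnj (branch_RB (a, c, e) (r, b)) * ?T ((r, b), z) ((r', b'), z') * branch_RB (a, c, e) (r', b'))"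
      unfolding sum_of_bool_nested[OF fin(5)]
      by (simp add: idle_def pair_amp_def branch_RB_def sum_distrib_left sum_distrib_right split_def mult_ac)
    also have "\<dots> = (\<Sum>(j, x, x')\<in>?J \<times> (R \<times> B) \<times> (R \<times> B). cnj (branch_RB j x) * ?T (x, z) (x', z') * branch_RB j x')"
      unfolding split_def sum.cartesian_product
      by (rule sum.reindex_bij_witness[of _ "\<lambda>((a, c, e), (r, b), (r', b')). (r, b, e, r', b', (a, c))"
          "\<lambda>(r, b, e, r', b', (a, c)). ((a, c, e), (r, b), (r', b'))"]) auto
    finally show ?thesis by (simp add: sum.cartesian_product split_def)
  qed
  have sent: "(\<Sum>y\<in>Y. sent (y, z') (y, z)) = (\<Sum>w\<in>?W. ?g w z' * cnj (?g w z))" for z z'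
  proof -
    have "(\<Sum>y\<in>Y. sent (y, z') (y, z)) = (\<Sum>(r, b, e)\<in>Y. \<Sum>(a, tA)\<in>A \<times> TA. encoded (a, tA, e) ((r, b), z') * cnj (encoded (a, tA, e) ((r, b), z)))"
      by (simp add: sent_def sent_amp_def split_def)
    also have "\<dots> = (\<Sum>w\<in>?W. ?g w z' * cnj (?g w z))"
      unfolding split_def sum.cartesian_product
      by (rule sum.reindex_bij_witness[of _ "\<lambda>((a, tA, e), (r, b)). ((r, b, e), (a, tA))"
          "\<lambda>((r, b, e), (a, tA)). ((a, tA, e), (r, b))"]) auto
    finally show ?thesis .
  qed
  have "(\<Sum>z\<in>Z. \<Sum>z'\<in>Z. (\<Sum>y\<in>Y. \<Sum>y'\<in>Y. slot_test (y, z) (y', z') * idle y' y) * (\<Sum>y\<in>Y. sent (y, z') (y, z)))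
    = (\<Sum>z\<in>Z. \<Sum>z'\<in>Z. \<Sum>(j, x, x')\<in>?J \<times> (R \<times> B) \<times> (R \<times> B). \<Sum>w\<in>?W.
        cnj (branch_RB j x * ?g w z) * (?T (x, z) (x', z') * (branch_RB j x' * ?g w z')))"
    unfolding idle sent sum.cartesian_product'[of _ ?J "(R \<times> B) \<times> (R \<times> B)"] sum.cartesian_product'[of _ "R \<times> B" "R \<times> B"]
    unfolding sum_distrib_right unfolding sum_distrib_left by (simp add: mult_ac)
  also have "\<dots> = (\<Sum>(w, j, ((x, z), (x', z')))\<in>?W \<times> ?J \<times> (In \<times> In).
        cnj (branch_RB j x * ?g w z) * (?T (x, z) (x', z') * (branch_RB j x' * ?g w z')))"
    unfolding split_def sum.cartesian_product
    by (rule sum.reindex_bij_witness[of _ "\<lambda>(w, j, ((x, z), (x', z'))). (z, z', (j, x, x'), w)"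
        "\<lambda>(z, z', (j, x, x'), w). (w, j, ((x, z), (x', z')))"]) auto
  also have "\<dots> = (\<Sum>w\<in>?W. \<Sum>j\<in>?J. \<Sum>u\<in>In. \<Sum>u'\<in>In.
        cnj ((\<lambda>(x, z). branch_RB j x * ?g w z) u) * (?T u u' * (\<lambda>(x, z). branch_RB j x * ?g w z) u'))"
    by (simp add: sum.cartesian_product split_def)
  also have "\<dots> = (\<Sum>w\<in>?W. \<Sum>j\<in>?J. ip In (\<lambda>(x, z). branch_RB j x * ?g w z) (op_app In ?T (\<lambda>(x, z). branch_RB j x * ?g w z)))"
    by (simp add: ip_def op_app_def sum_distrib_left)
  also have "\<dots> = of_real (\<Sum>w\<in>?W. \<Sum>j\<in>?J. norm_sq Out (op_app In test_op (\<lambda>(x, z). branch_RB j x * ?g w z)))"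
    by (simp only: ip_adj_mult of_real_sum)
  finally have "Re (\<Sum>z\<in>Z. \<Sum>z'\<in>Z. (\<Sum>y\<in>Y. \<Sum>y'\<in>Y. slot_test (y, z) (y', z') * idle y' y) * (\<Sum>y\<in>Y. sent (y, z') (y, z)))
    = (\<Sum>w\<in>?W. \<Sum>j\<in>?J. norm_sq Out (op_app In test_op (\<lambda>(x, z). branch_RB j x * ?g w z)))"
    by (simp only: Re_complex_of_real)
  also have "\<dots> \<le> (\<Sum>w\<in>?W. \<kappa>1 * \<kappa>2 * norm_sq Z (?g w))"
    by (intro sum_mono wrong_test)
  also have "\<dots> = \<kappa>1 * \<kappa>2 * (\<Sum>w\<in>A \<times> TA \<times> E. norm_sq In (encoded w))"
    by (simp add: sum_distrib_left[symmetric] norm_sq_Times'[of "R \<times> B"] sum.cartesian_product split_def)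
  finally show ?thesis by (simp add: encoded_1)
qed

end

lemma prod_split_slot:
  fixes a :: "'a::comm_monoid_mult" and j n :: nat
  assumes "j < n"
  shows "(\<Prod>i<n. if i = j then a else c i) = a * (\<Prod>i\<in>{..<n} - {j}. c i)"
proof -
  have "(\<Prod>i<n. if i = j then a else c i) = a * (\<Prod>i\<in>{..<n} - {j}. if i = j then a else c i)"
    using assms by (subst prod.remove[of _ j]) auto
  also have "(\<Prod>i\<in>{..<n} - {j}. if i = j then a else c i) = (\<Prod>i\<in>{..<n} - {j}. c i)"
    by (rule prod.cong) auto
  finally show ?thesis .
qed

lemma prod_of_bool_all: "finite I \<Longrightarrow> (\<Prod>i\<in>I. of_bool (Q i)) = (of_bool (\<forall>i\<in>I. Q i) :: 'a::comm_semiring_1)"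
  by (induction I rule: finite_induct) auto

lemma conj_by_ancilla:
  assumes "finite S" "s \<in> S" "s' \<in> S"
  shows "conj_by (U \<times> S) (\<lambda>(y, s) (u, t). of_bool (s = t) * V y u) \<rho> (y, s) (y', s')
    = (\<Sum>u'\<in>U. \<Sum>u\<in>U. V y u * \<rho> (u, s) (u', s') * cnj (V y' u'))"
proof -
  have b: "cnj (of_bool b * c) = of_bool b * cnj c" for b c by (cases b) auto
  have "conj_by (U \<times> S) (\<lambda>(y, s) (u, t). of_bool (s = t) * V y u) \<rho> (y, s) (y', s')
    = (\<Sum>u'\<in>U. \<Sum>t'\<in>S. of_bool (s' = t') * (\<Sum>u\<in>U. (\<Sum>t\<in>S. of_bool (s = t) * (V y u * \<rho> (u, t) (u', t'))) * cnj (V y' u')))"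
    unfolding conj_by_def op_mult_def adj_def sum.cartesian_product' split_conv b sum_distrib_right
    by (simp add: sum_distrib_left mult_ac)
  also have "\<dots> = (\<Sum>u'\<in>U. \<Sum>u\<in>U. (\<Sum>t\<in>S. of_bool (s = t) * (V y u * \<rho> (u, t) (u', s'))) * cnj (V y' u'))"
    by (rule sum.cong[OF refl], subst sum_of_bool(1)[OF assms(1)]) (simp add: assms)
  also have "\<dots> = (\<Sum>u'\<in>U. \<Sum>u\<in>U. V y u * \<rho> (u, s) (u', s') * cnj (V y' u'))"
    by (rule sum.cong[OF refl], rule sum.cong[OF refl], subst sum_of_bool(1)[OF assms(1)]) (simp add: assms)
  finally show ?thesis .
qed

text \<open>For each of the \<open>K\<close> messages Bob holds registers \<open>RBE\<close> that purify a pair \<open>AC\<close> of Alice.  Since the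
  registers of a simulation are labelled by numbers, \<open>h\<close> numbers the basis of all his registers.\<close>

locale coding = tested_redistribution R A B C E \<Phi> \<Psi> P q \<epsilon> N L \<kappa>1 \<kappa>2 \<eta>1 \<eta>2
  for R :: "'r set" and A :: "'a set" and B :: "'b set" and C :: "'c set" and E :: "'e set"
    and \<Phi> \<Psi> P q \<epsilon> N L \<kappa>1 \<kappa>2 \<eta>1 \<eta>2 +
  fixes K D :: nat and h :: "nat \<Rightarrow> ('r \<times> 'b \<times> 'e) list"
  assumes K: "1 \<le> K" and h: "bij_betw h {..<D} (nlists K (R \<times> B \<times> E))"
begin

abbreviation "X \<equiv> (EB \<times> {..<D}) \<times> Q"
abbreviation "YS \<equiv> nlists K Y"
abbreviation "ZS \<equiv> nlists K (A \<times> C)"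

definition lab :: "(nat \<times> nat) \<times> nat \<Rightarrow> ('r \<times> 'b \<times> 'e) list \<times> (nat \<times> nat)" where
  "lab = (\<lambda>((eB, s), x). (h s, (x, eB)))"

text \<open>Only the factor at position \<open>j\<close> depends on the labels \<open>z\<close> and
  \<open>z'\<close> of \<open>Q E\<^sub>B\<close>, of which Bob holds a single copy.\<close>

definition test_at :: "nat \<Rightarrow> ('r \<times> 'b \<times> 'e) list \<times> (nat \<times> nat) \<Rightarrow> ('r \<times> 'b \<times> 'e) list \<times> (nat \<times> nat) \<Rightarrow> complex" where
  "test_at j = (\<lambda>(ys, z) (ys', z'). \<Prod>i<K. if i = j then slot_test (ys ! i, z) (ys' ! i, z') else of_bool (ys ! i = ys' ! i))"

definition state_at :: "nat \<Rightarrow> ('r \<times> 'b \<times> 'e) list \<times> (nat \<times> nat) \<Rightarrow> ('r \<times> 'b \<times> 'e) list \<times> (nat \<times> nat) \<Rightarrow> complex" where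
  "state_at j = (\<lambda>(ys, z) (ys', z'). \<Prod>i<K. if i = j then sent (ys ! i, z) (ys' ! i, z') else idle (ys ! i) (ys' ! i))"

text \<open>\<open>omega\<close> is the product of \<open>theta P\<close> and \<open>K\<close>
  purified copies of \<open>\<Psi>\<close>. Alice holds nothing beyond \<open>E\<^sub>A\<close> and
  her pairs, whence \<open>dim_GA = 1\<close>. Messages are counted from 1 but list positions from
  0, whence \<open>m - 1\<close>.\<close>

definition sim :: "(((nat \<times> nat) \<times> nat, (nat \<times> nat) \<times> nat) operator \<Rightarrow> (nat, nat) operator) \<Rightarrow> ('a, 'c) simulation" where
  "sim D0 = \<lparr>num_pairs = K, dim_GA = 1, dim_GB = D,
     omega = (\<lambda>((zs, eA, g), (eB, s)). theta P (eA, eB) * (\<Prod>i<K. pair_amp (zs ! i) (h s ! i))),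
     slot = (\<lambda>m. m - 1), decoder = D0\<rparr>"

lemma fin_lists [simp]: "finite YS" "finite ZS" "finite Y" "finite Z" "finite X"
  by (simp_all add: finite_nlists)

lemma lab_bij: "bij_betw lab X (YS \<times> Z)"
proof (rule bij_betw_byWitness[where f' = "\<lambda>(ys, (x, eB)). ((eB, inv_into {..<D} h ys), x)"])
  show "\<forall>a\<in>X. (\<lambda>(ys, (x, eB)). ((eB, inv_into {..<D} h ys), x)) (lab a) = a"
    using bij_betw_inv_into_left[OF h] by (auto simp: lab_def)
  show "\<forall>a'\<in>YS \<times> Z. lab ((\<lambda>(ys, (x, eB)). ((eB, inv_into {..<D} h ys), x)) a') = a'"
    using bij_betw_inv_into_right[OF h] by (auto simp: lab_def)
  show "lab ` X \<subseteq> YS \<times> Z" using bij_betwE[OF h] by (auto simp: lab_def)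
  show "(\<lambda>(ys, (x, eB)). ((eB, inv_into {..<D} h ys), x)) ` (YS \<times> Z) \<subseteq> X"
    using bij_betwE[OF bij_betw_inv_into[OF h]] by auto
qed

lemma sum_X: "(\<Sum>x\<in>X. F (lab x)) = (\<Sum>z\<in>Z. \<Sum>ys\<in>YS. F (ys, z))"
proof -
  have "(\<Sum>x\<in>X. F (lab x)) = (\<Sum>p\<in>YS \<times> Z. F p)" by (rule sum.reindex_bij_betw[OF lab_bij])
  also have "\<dots> = (\<Sum>ys\<in>YS. \<Sum>z\<in>Z. F (ys, z))" by (simp only: sum.cartesian_product')
  finally show ?thesis by (simp only: sum.swap[of _ Z])
qed

lemma sum_h: "(\<Sum>s<D. F (h s)) = (\<Sum>ys\<in>YS. F ys)"
  by (rule sum.reindex_bij_betw[OF h])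

lemma Y_nonempty: "Y \<noteq> {}"
  using sum_idle by auto

lemma AC_nonempty: "A \<times> C \<noteq> {}"
proof
  assume "A \<times> C = {}"
  then have "idle y y' = 0" for y y' unfolding idle_def by (simp only: sum.empty)
  then show False using sum_idle by simp
qed

text \<open>The sums over Bob's lists factorise over the pairs, but those over \<open>z\<close> and
  \<open>z'\<close> stay outside: \<open>Q E\<^sub>B\<close> is shared by the factor of the tested
  pair and that of the used pair.\<close>

lemma born_expand:
  assumes "\<And>x x'. x \<in> X \<Longrightarrow> x' \<in> X \<Longrightarrow> \<rho> x x' = state_at j (lab x) (lab x')"
  shows "born X (\<lambda>x x'. test_at k (lab x) (lab x')) \<rho> = (\<Sum>z\<in>Z. \<Sum>z'\<in>Z. \<Prod>i<K. \<Sum>y\<in>Y. \<Sum>y'\<in>Y.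
     (if i = k then slot_test (y, z) (y', z') else of_bool (y = y')) * (if i = j then sent (y', z') (y, z) else idle y' y))"
proof -
  have "born X (\<lambda>x x'. test_at k (lab x) (lab x')) \<rho>
    = (\<Sum>x\<in>X. \<Sum>x'\<in>X. test_at k (lab x) (lab x') * state_at j (lab x') (lab x))"
    unfolding born_def by (intro sum.cong refl) (simp add: assms)
  also have "\<dots> = (\<Sum>z\<in>Z. \<Sum>ys\<in>YS. \<Sum>z'\<in>Z. \<Sum>ys'\<in>YS. test_at k (ys, z) (ys', z') * state_at j (ys', z') (ys, z))"
    by (subst sum_X, rule sum_X)
  also have "\<dots> = (\<Sum>z\<in>Z. \<Sum>z'\<in>Z. \<Sum>ys\<in>YS. \<Sum>ys'\<in>YS. test_at k (ys, z) (ys', z') * state_at j (ys', z') (ys, z))"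
    by (rule sum.cong[OF refl], rule sum.swap)
  also have "\<dots> = (\<Sum>z\<in>Z. \<Sum>z'\<in>Z. \<Sum>ys\<in>YS. \<Sum>ys'\<in>YS. \<Prod>i<K.
     (if i = k then slot_test (ys ! i, z) (ys' ! i, z') else of_bool (ys ! i = ys' ! i)) *
     (if i = j then sent (ys' ! i, z') (ys ! i, z) else idle (ys' ! i) (ys ! i)))"
    by (simp only: test_at_def state_at_def split_conv prod.distrib)
  also have "\<dots> = (\<Sum>z\<in>Z. \<Sum>z'\<in>Z. \<Prod>i<K. \<Sum>y\<in>Y. \<Sum>y'\<in>Y.
     (if i = k then slot_test (y, z) (y', z') else of_bool (y = y')) * (if i = j then sent (y', z') (y, z) else idle y' y))"
    by (rule sum.cong[OF refl], rule sum.cong[OF refl], rule sum_prod_nlists2) simp_all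
  finally show ?thesis .
qed

lemma born_same:
  assumes "\<And>x x'. x \<in> X \<Longrightarrow> x' \<in> X \<Longrightarrow> \<rho> x x' = state_at j (lab x) (lab x')" "j < K"
  shows "born X (\<lambda>x x'. test_at j (lab x) (lab x')) \<rho>
    = of_real (\<Sum>w\<in>A \<times> TA \<times> E. norm_sq Out (op_app In test_op (encoded w)))"
proof -
  let ?f = "\<lambda>z z' i y y'. (if i = j then slot_test (y, z) (y', z') else of_bool (y = y')) * (if i = j then sent (y', z') (y, z) else idle y' y)"
  have "(\<Prod>i<K. \<Sum>y\<in>Y. \<Sum>y'\<in>Y.
     ?f z z' i y y')
    = (\<Sum>y\<in>Y. \<Sum>y'\<in>Y. slot_test (y, z) (y', z') * sent (y', z') (y, z))" for z z'
  proof -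
    have "(\<Prod>i<K. \<Sum>y\<in>Y. \<Sum>y'\<in>Y.
       ?f z z' i y y')
      = (\<Prod>i<K. if i = j then \<Sum>y\<in>Y. \<Sum>y'\<in>Y. slot_test (y, z) (y', z') * sent (y', z') (y, z) else 1)"
    proof (rule prod.cong[OF refl])
      fix i
      have "(\<Sum>y\<in>Y. \<Sum>y'\<in>Y. of_bool (y = y') * idle y' y) = (\<Sum>y\<in>Y. idle y y)"
        by (rule sum.cong[OF refl], subst sum_of_bool(1)) simp_all
      then show "(\<Sum>y\<in>Y. \<Sum>y'\<in>Y. ?f z z' i y y')
        = (if i = j then \<Sum>y\<in>Y. \<Sum>y'\<in>Y. slot_test (y, z) (y', z') * sent (y', z') (y, z) else 1)"
        using sum_idle by (cases "i = j") simp_all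
    qed
    then show ?thesis using assms(2) by (simp only: prod_if_eq)
  qed
  then show ?thesis by (subst born_expand[OF assms(1)]) (simp_all only: slot_test_sent)
qed

text \<open>Pairs other than \<open>j\<close> and \<open>k\<close> contribute the trace 1 of
  \<open>idle\<close>. The test at \<open>k\<close> meets only \<open>idle\<close>, and the used
  pair \<open>j\<close> is traced out, which leaves the state of \<open>Q E\<^sub>B\<close>.\<close>

lemma born_other:
  assumes "\<And>x x'. x \<in> X \<Longrightarrow> x' \<in> X \<Longrightarrow> \<rho> x x' = state_at j (lab x) (lab x')" "j < K" "k < K" "k \<noteq> j"
  shows "Re (born X (\<lambda>x x'. test_at k (lab x) (lab x')) \<rho>) \<le> \<kappa>1 * \<kappa>2"
proof -
  let ?f = "\<lambda>z z' i y y'. (if i = k then slot_test (y, z) (y', z') else of_bool (y = y')) * (if i = j then sent (y', z') (y, z) else idle y' y)"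
  have "(\<Prod>i<K. \<Sum>y\<in>Y. \<Sum>y'\<in>Y.
     ?f z z' i y y')
    = (\<Sum>y\<in>Y. \<Sum>y'\<in>Y. slot_test (y, z) (y', z') * idle y' y) * (\<Sum>y\<in>Y. sent (y, z') (y, z))" for z z'
  proof -
    have "(\<Prod>i<K. \<Sum>y\<in>Y. \<Sum>y'\<in>Y.
       ?f z z' i y y')
      = (\<Prod>i<K. if i = k then \<Sum>y\<in>Y. \<Sum>y'\<in>Y. slot_test (y, z) (y', z') * idle y' y
          else if i = j then \<Sum>y\<in>Y. sent (y, z') (y, z) else 1)"
    proof (rule prod.cong[OF refl])
      fix i
      have "(\<Sum>y\<in>Y. \<Sum>y'\<in>Y. of_bool (y = y') * F y' y) = (\<Sum>y\<in>Y. F y y)" for F :: "_ \<Rightarrow> _ \<Rightarrow> complex"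
        by (rule sum.cong[OF refl], subst sum_of_bool(1)) simp_all
      from this[of idle] this[of "\<lambda>y' y. sent (y', z') (y, z)"]
      show "(\<Sum>y\<in>Y. \<Sum>y'\<in>Y. ?f z z' i y y')
        = (if i = k then \<Sum>y\<in>Y. \<Sum>y'\<in>Y. slot_test (y, z) (y', z') * idle y' y
          else if i = j then \<Sum>y\<in>Y. sent (y, z') (y, z) else 1)"
        using sum_idle assms(4) by (cases "i = j"; cases "i = k") simp_all
    qed
    then show ?thesis by (simp only: prod_if_eq2[OF assms(3,2,4)])
  qed
  then show ?thesis using slot_test_idle by (subst born_expand[OF assms(1)]) (simp_all only:)
qed

lemma effect_test_at:
  assumes "j < K"
  shows "effect X (\<lambda>x x'. test_at j (lab x) (lab x'))"
proof -
  obtain y0 where y0: "y0 \<in> Y" using Y_nonempty by blast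
  \<comment> \<open>Writing a fixed label \<open>y0\<close> at position \<open>j\<close> gives a
    label of the other pairs alone; together with \<open>E\<close> these are the spectators on which
    the test acts as the identity.\<close>
  let ?G = "{ys \<in> YS. ys ! j = y0} \<times> E"
  let ?g = "\<lambda>(ys, z). case ys ! j of (r, b, e) \<Rightarrow> ((ys[j := y0], e), ((r, b), z))"
  let ?g' = "\<lambda>((ys, e), ((r, b), z)). (ys[j := (r, b, e)], z)"
  have len: "length ys = K" if "ys \<in> YS" for ys using that by simp
  have upd: "ys[j := y] \<in> YS" if "ys \<in> YS" "y \<in> Y" for ys y
    by (intro nlistsI set_update_subsetI nlistsE_set[OF that(1)] that(2)) (simp add: len[OF that(1)])
  have nth: "ys ! j \<in> Y" if "ys \<in> YS" for ys using nlistsE_nth_in[OF that assms] .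
  have g: "bij_betw ?g (YS \<times> Z) (?G \<times> In)"
  proof (rule bij_betw_byWitness[where f' = ?g'])
    show "\<forall>a\<in>YS \<times> Z. ?g' (?g a) = a"
    proof
      fix a assume a: "a \<in> YS \<times> Z"
      obtain ys z where "a = (ys, z)" by (cases a)
      moreover obtain r b e where "ys ! j = (r, b, e)" by (cases "ys ! j")
      ultimately show "?g' (?g a) = a" using list_update_id[of ys j] by simp
    qed
    show "\<forall>a'\<in>?G \<times> In. ?g (?g' a') = a'"
      using assms len by (auto simp: list_update_overwrite)
    show "?g ` (YS \<times> Z) \<subseteq> ?G \<times> In"
    proof
      fix p assume "p \<in> ?g ` (YS \<times> Z)"
      then obtain ys z where a: "ys \<in> YS" "z \<in> Z" "p = ?g (ys, z)" by auto
      obtain r b e where "ys ! j = (r, b, e)" by (cases "ys ! j")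
      then show "p \<in> ?G \<times> In" using a nth[OF a(1)] upd[OF a(1) y0] len[OF a(1)] assms by simp
    qed
    show "?g' ` (?G \<times> In) \<subseteq> YS \<times> Z" using upd by auto
  qed
  show ?thesis
  proof (rule effect_of_contraction[where G = ?G and U = In and Z = Out and M = test_op and \<beta> = "?g \<circ> lab"])
    show "bij_betw (?g \<circ> lab) X (?G \<times> In)" by (rule bij_betw_trans[OF lab_bij g])
    show "norm_sq Out (op_app In test_op v) \<le> norm_sq In v" for v by (rule test_op_contraction)
    fix x x' assume "x \<in> X" "x' \<in> X"
    then have "lab x \<in> YS \<times> Z" "lab x' \<in> YS \<times> Z" using bij_betwE[OF lab_bij] by blast+
    then obtain ys z ys' z' where l: "lab x = (ys, z)" "lab x' = (ys', z')" "ys \<in> YS" "ys' \<in> YS" by auto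
    obtain r b e where y: "ys ! j = (r, b, e)" by (cases "ys ! j")
    obtain r' b' e' where y': "ys' ! j = (r', b', e')" by (cases "ys' ! j")
    have eq: "(\<forall>i\<in>{..<K} - {j}. ys ! i = ys' ! i) \<longleftrightarrow> ys[j := y0] = ys'[j := y0]"
    proof
      assume *: "\<forall>i\<in>{..<K} - {j}. ys ! i = ys' ! i"
      show "ys[j := y0] = ys'[j := y0]"
      proof (rule nth_equalityI)
        fix i assume "i < length (ys[j := y0])"
        then have "i < length ys" "i < length ys'" "i < K" using len[OF l(3)] len[OF l(4)] by simp_all
        then show "ys[j := y0] ! i = ys'[j := y0] ! i"
          using * by (cases "i = j") simp_all
      qed (simp add: len l)
    next
      assume *: "ys[j := y0] = ys'[j := y0]"
      show "\<forall>i\<in>{..<K} - {j}. ys ! i = ys' ! i"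
      proof
        fix i assume "i \<in> {..<K} - {j}"
        then show "ys ! i = ys' ! i" using arg_cong[OF *, of "\<lambda>l. l ! i"] by simp
      qed
    qed
    have "test_at j (lab x) (lab x') = slot_test (ys ! j, z) (ys' ! j, z') * of_bool (ys[j := y0] = ys'[j := y0])"
    proof -
      have "test_at j (lab x) (lab x') = (\<Prod>i<K. if i = j then slot_test (ys ! j, z) (ys' ! j, z') else of_bool (ys ! i = ys' ! i))"
        unfolding test_at_def l by (simp cong: if_cong)
      also have "\<dots> = slot_test (ys ! j, z) (ys' ! j, z') * of_bool (ys[j := y0] = ys'[j := y0])"
        unfolding prod_split_slot[OF assms] by (simp only: prod_of_bool_all[OF finite_Diff[OF finite_lessThan]] eq)
      finally show ?thesis .
    qed
    then show "test_at j (lab x) (lab x') = of_bool (fst ((?g \<circ> lab) x) = fst ((?g \<circ> lab) x'))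
        * op_mult Out (adj test_op) test_op (snd ((?g \<circ> lab) x)) (snd ((?g \<circ> lab) x'))"
      by (simp add: l y y' slot_test_def; blast)
  qed (simp_all add: finite_nlists)
qed

lemma state_at_gram:
  assumes "j < K"
  shows "\<exists>f. gram X ((A \<times> TA) \<times> ZS) f (\<lambda>x x'. state_at j (lab x) (lab x'))"
proof -
  obtain z0 where z0: "z0 \<in> A \<times> C" using AC_nonempty by blast
  \<comment> \<open>Position \<open>j\<close> of Alice's list is pinned to \<open>z0\<close>: her
    pair \<open>j\<close> has been turned into \<open>w\<close>, and a free entry there would count
    each \<open>w\<close> once per element of \<open>A \<times> C\<close>.\<close>
  let ?F = "\<lambda>(w, zs) (ys, z). \<Prod>i<K. if i = j then of_bool (zs ! i = z0) * sent_amp w (ys ! i, z) else pair_amp (zs ! i) (ys ! i)"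
  have "(\<Sum>p\<in>(A \<times> TA) \<times> ZS. ?F p (ys, z) * cnj (?F p (ys', z'))) = state_at j (ys, z) (ys', z')" for ys z ys' z'
  proof -
    let ?R = "\<Prod>i\<in>{..<K} - {j}. idle (ys ! i) (ys' ! i)"
    have "(\<Sum>p\<in>(A \<times> TA) \<times> ZS. ?F p (ys, z) * cnj (?F p (ys', z')))
      = (\<Sum>w\<in>A \<times> TA. \<Sum>zs\<in>ZS. \<Prod>i<K. if i = j then of_bool (zs ! i = z0) * (sent_amp w (ys ! i, z) * cnj (sent_amp w (ys' ! i, z')))
          else pair_amp (zs ! i) (ys ! i) * cnj (pair_amp (zs ! i) (ys' ! i)))"
      unfolding sum.cartesian_product'[of _ "A \<times> TA"] split_conv cnj_prod prod.distrib[symmetric]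
      by (intro sum.cong refl prod.cong) (auto simp: of_bool_def)
    also have "\<dots> = (\<Sum>w\<in>A \<times> TA. \<Prod>i<K. \<Sum>z1\<in>A \<times> C. if i = j then of_bool (z1 = z0) * (sent_amp w (ys ! i, z) * cnj (sent_amp w (ys' ! i, z')))
          else pair_amp z1 (ys ! i) * cnj (pair_amp z1 (ys' ! i)))"
      by (rule sum.cong[OF refl], rule sum_prod_nlists) simp
    also have "\<dots> = (\<Sum>w\<in>A \<times> TA. \<Prod>i<K. if i = j then sent_amp w (ys ! j, z) * cnj (sent_amp w (ys' ! j, z')) else idle (ys ! i) (ys' ! i))"
    proof (rule sum.cong[OF refl], rule prod.cong[OF refl])
      fix w i
      show "(\<Sum>z1\<in>A \<times> C. if i = j then of_bool (z1 = z0) * (sent_amp w (ys ! i, z) * cnj (sent_amp w (ys' ! i, z')))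
          else pair_amp z1 (ys ! i) * cnj (pair_amp z1 (ys' ! i)))
        = (if i = j then sent_amp w (ys ! j, z) * cnj (sent_amp w (ys' ! j, z')) else idle (ys ! i) (ys' ! i))"
      proof (cases "i = j")
        case True
        show ?thesis using z0 by (simp only: True simp_thms if_True, subst sum_of_bool(2)) simp_all
      qed (simp add: idle_def)
    qed
    also have "\<dots> = sent (ys ! j, z) (ys' ! j, z') * ?R"
      unfolding prod_split_slot[OF assms] sent_def sum_distrib_right ..
    also have "\<dots> = state_at j (ys, z) (ys', z')"
      unfolding state_at_def split_conv prod_split_slot[OF assms, symmetric] by (intro prod.cong) auto
    finally show ?thesis .
  qed
  then have "state_at j p p' = (\<Sum>i\<in>(A \<times> TA) \<times> ZS. ?F i p * cnj (?F i p'))" for p p'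
    by (cases p; cases p') (simp only:)
  then have "gram X ((A \<times> TA) \<times> ZS) (\<lambda>i x. ?F i (lab x)) (\<lambda>x x'. state_at j (lab x) (lab x'))"
    unfolding gram_def by blast
  then show ?thesis by blast
qed

lemma state_at_trace:
  assumes "j < K"
  shows "op_trace X (\<lambda>x x'. state_at j (lab x) (lab x')) = 1"
proof -
  have "op_trace X (\<lambda>x x'. state_at j (lab x) (lab x')) = (\<Sum>z\<in>Z. \<Sum>ys\<in>YS. state_at j (ys, z) (ys, z))"
    unfolding op_trace_def by (rule sum_X[of "\<lambda>p. state_at j p p"])
  also have "\<dots> = (\<Sum>z\<in>Z. \<Prod>i<K. \<Sum>y\<in>Y. if i = j then sent (y, z) (y, z) else idle y y)"
    unfolding state_at_def split_conv by (rule sum.cong[OF refl], rule sum_prod_nlists) simp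
  also have "\<dots> = (\<Sum>z\<in>Z. \<Prod>i<K. if i = j then \<Sum>y\<in>Y. sent (y, z) (y, z) else 1)"
    by (intro sum.cong prod.cong refl) (simp add: sum_idle)
  also have "\<dots> = (\<Sum>z\<in>Z. \<Sum>y\<in>Y. sent (y, z) (y, z))"
    by (simp only: prod_if_eq[OF assms])
  finally show ?thesis by (simp only: sum_sent)
qed

text \<open>The constraint on position \<open>m - 1\<close> becomes an indicator inside the factor
  of that position; then the sum over Alice's lists factorises, and the other positions yield
  \<open>idle\<close>.\<close>

lemma selected_state_sim:
  assumes "m \<in> {1..K}" "(a, c) \<in> A \<times> C"
  shows "selected_state A C (sim D0) m ((a, c, eA), (eB, s)) ((a', c', eA'), (eB', s'))
    = theta P (eA, eB) * cnj (theta P (eA', eB')) * (\<Prod>i<K. if i = m - 1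
        then pair_amp (a, c) (h s ! i) * cnj (pair_amp (a', c') (h s' ! i)) else idle (h s ! i) (h s' ! i))"
proof -
  let ?j = "m - 1"
  let ?t = "theta P (eA, eB) * cnj (theta P (eA', eB'))"
  let ?p = "\<lambda>i. pair_amp (a, c) (h s ! i) * cnj (pair_amp (a', c') (h s' ! i))"
  let ?r = "\<lambda>z i. pair_amp z (h s ! i) * cnj (pair_amp z (h s' ! i))"
  let ?q = "\<lambda>zs i. pair_amp (zs ! i) (h s ! i) * cnj (pair_amp (zs[?j := (a', c')] ! i) (h s' ! i))"
  let ?g = "\<lambda>i z. if i = ?j then of_bool (z = (a, c)) * ?p i else ?r z i"
  have j: "?j < K" using assms by auto
  have "selected_state A C (sim D0) m ((a, c, eA), (eB, s)) ((a', c', eA'), (eB', s'))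
    = (\<Sum>zs\<in>{zs \<in> ZS. zs ! ?j = (a, c)}. ?t * (\<Prod>i<K. ?q zs i))"
    by (simp add: selected_state_def sim_def prod.distrib cnj_prod mult_ac)
  also have "\<dots> = (\<Sum>zs\<in>ZS. if zs ! ?j = (a, c) then ?t * (\<Prod>i<K. ?q zs i) else 0)"
    by (rule sum.inter_filter) simp
  also have "\<dots> = (\<Sum>zs\<in>ZS. ?t * (\<Prod>i<K. ?g i (zs ! i)))"
  proof (rule sum.cong[OF refl])
    fix zs assume zs: "zs \<in> ZS"
    show "(if zs ! ?j = (a, c) then ?t * (\<Prod>i<K. ?q zs i) else 0)
      = ?t * (\<Prod>i<K. ?g i (zs ! i))"
    proof (cases "zs ! ?j = (a, c)")
      case True
      then have "(\<Prod>i<K. ?q zs i)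
        = (\<Prod>i<K. ?g i (zs ! i))"
        using zs j by (intro prod.cong) (auto simp: nth_list_update)
      then show ?thesis using True by (simp only: simp_thms if_True)
    next
      case False
      then have "(\<Prod>i<K. ?g i (zs ! i)) = 0"
        using j by (intro prod_zero) auto
      then show ?thesis using False by (simp only: simp_thms if_False mult_zero_right)
    qed
  qed
  also have "\<dots> = ?t * (\<Prod>i<K. \<Sum>z\<in>A \<times> C. ?g i z)"
    unfolding sum_distrib_left[symmetric]
    by (subst sum_prod_nlists[of "A \<times> C" "?g"]) simp_all
  also have "(\<Prod>i<K. \<Sum>z\<in>A \<times> C. ?g i z)
    = (\<Prod>i<K. if i = ?j then ?p i else idle (h s ! i) (h s' ! i))"
  proof (rule prod.cong[OF refl])
    fix i
    show "(\<Sum>z\<in>A \<times> C. ?g i z)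
      = (if i = ?j then ?p i else idle (h s ! i) (h s' ! i))"
    proof (cases "i = ?j")
      case True
      show ?thesis using assms(2) by (simp only: True simp_thms if_True, subst sum_of_bool(2)) simp_all
    qed (simp add: idle_def)
  qed
  finally show ?thesis .
qed

end

section \<open>Verification of the simulation\<close>

context coding
begin

lemma sent_amp_eq:
  "sent_amp (a, tA) (y, (k, eB))
    = (\<Sum>u\<in>A \<times> C \<times> EA. enc P (a, k, tA) u * (pair_amp (fst u, fst (snd u)) y * theta P (snd (snd u), eB)))"
proof -
  obtain r b e where y: "y = (r, b, e)" by (cases y)
  show ?thesis unfolding y by (simp add: sent_amp_def encoded_def op_app_def pair_amp_def split_def)
qed

text \<open>The encoding meets only \<open>theta P\<close> and the factor at position
  \<open>m - 1\<close>, from which it produces \<open>sent_amp\<close>; the product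
  \<open>?R\<close> over the other pairs passes through unchanged.\<close>

lemma received_state_sim:
  assumes m: "m \<in> {1..K}" and x: "x \<in> X" "x' \<in> X"
  shows "received_state A C P (sim D0) m x x' = state_at (m - 1) (lab x) (lab x')"
proof -
  let ?j = "m - 1" and ?U = "A \<times> C \<times> EA" and ?S = "EB \<times> {..<D}"
  have j: "?j < K" using m by auto
  obtain eB s k eB' s' k' where xs: "x = ((eB, s), k)" "x' = ((eB', s'), k')"
    and mem: "(eB, s) \<in> ?S" "(eB', s') \<in> ?S" using x by auto
  let ?R = "\<Prod>i\<in>{..<K} - {?j}. idle (h s ! i) (h s' ! i)"
  let ?f = "\<lambda>u. pair_amp (fst u, fst (snd u)) (h s ! ?j) * theta P (snd (snd u), eB)"
  let ?f' = "\<lambda>u. pair_amp (fst u, fst (snd u)) (h s' ! ?j) * theta P (snd (snd u), eB')"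
  let ?sel = "selected_state A C (sim D0) m"
  have sel: "?sel (u, (eB, s)) (u', (eB', s')) = ?f u * cnj (?f' u') * ?R" if "u \<in> ?U" "u' \<in> ?U" for u u'
  proof -
    obtain a c eA a' c' eA' where u: "u = (a, c, eA)" "u' = (a', c', eA')" by (cases u; cases u')
    then have ac: "(a, c) \<in> A \<times> C" using that by simp
    have "(\<Prod>i<K. if i = ?j then pair_amp (a, c) (h s ! i) * cnj (pair_amp (a', c') (h s' ! i)) else idle (h s ! i) (h s' ! i))
      = (\<Prod>i<K. if i = ?j then pair_amp (a, c) (h s ! ?j) * cnj (pair_amp (a', c') (h s' ! ?j)) else idle (h s ! i) (h s' ! i))"
      by (intro prod.cong) auto
    then show ?thesis unfolding u selected_state_sim[OF m ac] prod_split_slot[OF j] by simp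
  qed
  have V: "(\<lambda>((a, q, tA), sB) ((a', c', eA'), sB'). of_bool (sB = sB') * enc P (a, q, tA) (a', c', eA'))
    = (\<lambda>(y, s) (u, t). of_bool (s = t) * enc P y u)"
    by (auto simp: fun_eq_iff)
  have "received_state A C P (sim D0) m x x'
    = (\<Sum>a\<in>A. \<Sum>tA\<in>TA. conj_by (?U \<times> ?S) (\<lambda>(y, s) (u, t). of_bool (s = t) * enc P y u) ?sel ((a, k, tA), (eB, s)) ((a, k', tA), (eB', s')))"
    unfolding received_state_def V Let_def xs by (simp add: space_SB_def sim_def)
  also have "\<dots> = (\<Sum>a\<in>A. \<Sum>tA\<in>TA. \<Sum>u'\<in>?U. \<Sum>u\<in>?U. enc P (a, k, tA) u * ?sel (u, (eB, s)) (u', (eB', s')) * cnj (enc P (a, k', tA) u'))"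
    by (intro sum.cong refl conj_by_ancilla mem) simp
  also have "\<dots> = (\<Sum>a\<in>A. \<Sum>tA\<in>TA. sent_amp (a, tA) (h s ! ?j, (k, eB)) * cnj (sent_amp (a, tA) (h s' ! ?j, (k', eB'))) * ?R)"
  proof (rule sum.cong[OF refl], rule sum.cong[OF refl])
    fix a tA
    have "(\<Sum>u'\<in>?U. \<Sum>u\<in>?U. enc P (a, k, tA) u * ?sel (u, (eB, s)) (u', (eB', s')) * cnj (enc P (a, k', tA) u'))
      = (\<Sum>u'\<in>?U. \<Sum>u\<in>?U. (enc P (a, k, tA) u * ?f u) * cnj (enc P (a, k', tA) u' * ?f' u')) * ?R"
      unfolding sum_distrib_right by (rule sum.cong[OF refl], rule sum.cong[OF refl]) (simp only: sel, simp)
    also have "(\<Sum>u'\<in>?U. \<Sum>u\<in>?U. (enc P (a, k, tA) u * ?f u) * cnj (enc P (a, k', tA) u' * ?f' u'))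
      = (\<Sum>u\<in>?U. \<Sum>u'\<in>?U. (enc P (a, k, tA) u * ?f u) * cnj (enc P (a, k', tA) u' * ?f' u'))"
      by (rule sum.swap)
    also have "\<dots> = sent_amp (a, tA) (h s ! ?j, (k, eB)) * cnj (sent_amp (a, tA) (h s' ! ?j, (k', eB')))"
      unfolding sent_amp_eq cnj_sum sum_product ..
    finally show "(\<Sum>u'\<in>?U. \<Sum>u\<in>?U. enc P (a, k, tA) u * ?sel (u, (eB, s)) (u', (eB', s')) * cnj (enc P (a, k', tA) u'))
      = sent_amp (a, tA) (h s ! ?j, (k, eB)) * cnj (sent_amp (a, tA) (h s' ! ?j, (k', eB'))) * ?R" .
  qed
  also have "\<dots> = sent (h s ! ?j, (k, eB)) (h s' ! ?j, (k', eB')) * ?R"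
    by (simp only: sent_def sum_distrib_right sum.cartesian_product')
  also have "\<dots> = (\<Prod>i<K. if i = ?j then sent (h s ! ?j, (k, eB)) (h s' ! ?j, (k', eB')) else idle (h s ! i) (h s' ! i))"
    by (rule prod_split_slot[OF j, symmetric])
  also have "\<dots> = state_at ?j (lab x) (lab x')"
    unfolding state_at_def lab_def xs split_conv by (intro prod.cong) auto
  finally show ?thesis .
qed

lemma sum_pair_amp: "(\<Sum>z\<in>A \<times> C. \<Sum>y\<in>Y. (cmod (pair_amp z y))\<^sup>2) = 1"
proof -
  have "complex_of_real (\<Sum>z\<in>A \<times> C. \<Sum>y\<in>Y. (cmod (pair_amp z y))\<^sup>2) = (\<Sum>z\<in>A \<times> C. \<Sum>y\<in>Y. pair_amp z y * cnj (pair_amp z y))"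
    by (simp only: of_real_sum complex_norm_square)
  also have "\<dots> = (\<Sum>y\<in>Y. idle y y)" unfolding idle_def by (rule sum.swap)
  finally show ?thesis unfolding sum_idle by (simp only: of_real_eq_1_iff)
qed

lemma omega_unit: "unit_vec_on (space_SA A C P (sim D0) \<times> space_SB P (sim D0)) (omega (sim D0))"
proof -
  let ?t = "\<lambda>eA eB. (cmod (theta P (eA, eB)))\<^sup>2"
  let ?p = "\<lambda>zs ys. \<Prod>i<K. (cmod (pair_amp (zs ! i) (ys ! i)))\<^sup>2"
  have "(\<Sum>x\<in>space_SA A C P (sim D0) \<times> space_SB P (sim D0). (cmod (omega (sim D0) x))\<^sup>2)
    = (\<Sum>zs\<in>ZS. \<Sum>eA\<in>EA. \<Sum>eB\<in>EB. \<Sum>s<D. ?t eA eB * ?p zs (h s))"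
    unfolding space_SA_def space_SB_def sum.cartesian_product' sim_def
    by (simp add: norm_mult power_mult_distrib prod_norm[symmetric] prod_power_distrib)
  also have "\<dots> = (\<Sum>zs\<in>ZS. \<Sum>eA\<in>EA. \<Sum>eB\<in>EB. \<Sum>ys\<in>YS. ?t eA eB * ?p zs ys)"
    by (rule sum.cong[OF refl], rule sum.cong[OF refl], rule sum.cong[OF refl], rule sum_h)
  also have "\<dots> = (\<Sum>zs\<in>ZS. (\<Sum>eA\<in>EA. \<Sum>eB\<in>EB. ?t eA eB) * (\<Sum>ys\<in>YS. ?p zs ys))"
    unfolding sum_distrib_right unfolding sum_distrib_left ..
  also have "(\<Sum>eA\<in>EA. \<Sum>eB\<in>EB. ?t eA eB) = 1" using theta_1 by (simp only: sum.cartesian_product')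
  also have "(\<Sum>zs\<in>ZS. 1 * (\<Sum>ys\<in>YS. ?p zs ys)) = (\<Prod>i<K. \<Sum>z\<in>A \<times> C. \<Sum>y\<in>Y. (cmod (pair_amp z y))\<^sup>2)"
    unfolding mult_1 by (rule sum_prod_nlists2) simp_all
  also have "\<dots> = 1" unfolding sum_pair_amp by simp
  finally show ?thesis by (simp only: unit_vec_on_def)
qed

text \<open>Summing over Bob's lists replaces the idle factors by their trace 1 and the used one by
  the marginal of \<open>\<Psi>\<close>; \<open>E\<^sub>B\<close> is kept, so \<open>theta P\<close>
  stays intact.\<close>

lemma selected_marginal:
  assumes m: "m \<in> {1..K}" and ac: "a \<in> A" "c \<in> C" "a' \<in> A" "c' \<in> C"
  shows "(\<Sum>s<D. selected_state A C (sim D0) m ((a, c, eA), (eB, s)) ((a', c', eA'), (eB', s)))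
    = marg_AC R B \<Psi> (a, c) (a', c') * (theta P (eA, eB) * cnj (theta P (eA', eB')))"
proof -
  let ?j = "m - 1" and ?t = "theta P (eA, eB) * cnj (theta P (eA', eB'))"
  have j: "?j < K" using m by auto
  let ?F = "\<lambda>ys. \<Prod>i<K. if i = ?j then pair_amp (a, c) (ys ! i) * cnj (pair_amp (a', c') (ys ! i)) else idle (ys ! i) (ys ! i)"
  have AC: "(a, c) \<in> A \<times> C" using ac by simp
  have "(\<Sum>s<D. selected_state A C (sim D0) m ((a, c, eA), (eB, s)) ((a', c', eA'), (eB', s)))
    = ?t * (\<Sum>s<D. ?F (h s))"
    unfolding selected_state_sim[OF m AC] sum_distrib_left ..
  also have "(\<Sum>s<D. ?F (h s)) = (\<Sum>ys\<in>YS. ?F ys)" by (rule sum_h)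
  also have "\<dots> = (\<Prod>i<K. \<Sum>y\<in>Y. if i = ?j then pair_amp (a, c) y * cnj (pair_amp (a', c') y) else idle y y)"
    by (rule sum_prod_nlists) simp
  also have "\<dots> = (\<Prod>i<K. if i = ?j then \<Sum>y\<in>Y. pair_amp (a, c) y * cnj (pair_amp (a', c') y) else 1)"
  proof (rule prod.cong[OF refl])
    fix i
    show "(\<Sum>y\<in>Y. if i = ?j then pair_amp (a, c) y * cnj (pair_amp (a', c') y) else idle y y)
      = (if i = ?j then \<Sum>y\<in>Y. pair_amp (a, c) y * cnj (pair_amp (a', c') y) else 1)"
      by (cases "i = ?j") (simp_all only: sum_idle simp_thms if_True if_False)
  qed
  also have "\<dots> = (\<Sum>y\<in>Y. pair_amp (a, c) y * cnj (pair_amp (a', c') y))" by (rule prod_if_eq[OF j])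
  also have "\<dots> = marg_AC R B \<Psi> (a, c) (a', c')"
  proof -
    have "\<Psi> (r, a, b, c) (r, a', b, c') = (\<Sum>e\<in>E. \<Phi> e (r, a, b, c) * cnj (\<Phi> e (r, a', b, c')))"
      if "r \<in> R" "b \<in> B" for r b
      using gram_Psi that ac by (simp add: gram_def)
    then show ?thesis by (simp add: marg_AC_def pair_amp_def sum.cartesian_product')
  qed
  finally show ?thesis by (simp only: mult.commute)
qed

text \<open>\<open>s\<close> bounds from below the root of the acceptance probability of the right
  test. A message has at most \<open>K - 1\<close> predecessors, each accepted with probability at
  most \<open>\<kappa>1 * \<kappa>2\<close>. These are the inputs of
  \<open>sequential_decoding\<close>.\<close>

lemma simulation_exists:
  assumes msgs: "messages M = {1..K}"
    and kappa2: "0 \<le> \<kappa>2" and E0: "real (K - 1) * (\<kappa>1 * \<kappa>2) \<le> E0"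
    and s: "0 \<le> s" "s \<le> sqrt (1 - \<epsilon>\<^sup>2) - \<eta>1 - \<eta>2"
    and bound: "2 * sqrt E0 + (sqrt (1 - s\<^sup>2) + sqrt (2 * sqrt E0))\<^sup>2 \<le> \<epsilon>'"
  shows "\<exists>S. qsr_simulation A C (marg_AC R B \<Psi>) P M \<epsilon>' S"
proof -
  let ?T = "\<lambda>k x x'. test_at (k - 1) (lab x) (lab x')"
  have eff: "effect X (?T k)" if "k \<in> {1..K}" for k
    using that by (intro effect_test_at) auto
  note dec = sequential_decoding[where T = ?T, OF fin_lists(5) K eff]
  let ?D = "\<lambda>\<rho> m m'. of_bool (m = m') * born X (sequential_povm X ?T K m) \<rho>"
  let ?S = "sim ?D"
  have kk: "0 \<le> \<kappa>1 * \<kappa>2" using kappa1 kappa2 by simp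
  have "0 \<le> real (K - 1) * (\<kappa>1 * \<kappa>2)" using kk by simp
  then have E00: "0 \<le> E0" using E0 by linarith
  have err: "(\<Sum>m'\<in>{1..K} - {m}. Re (?D (received_state A C P ?S m) m' m')) \<le> \<epsilon>'" if m: "m \<in> {1..K}" for m
  proof -
    let ?\<rho> = "received_state A C P ?S m"
    have j: "m - 1 < K" using m by auto
    have \<rho>: "?\<rho> x x' = state_at (m - 1) (lab x) (lab x')" if "x \<in> X" "x' \<in> X" for x x'
      by (rule received_state_sim[OF m that])
    obtain f where f: "gram X ((A \<times> TA) \<times> ZS) f (\<lambda>x x'. state_at (m - 1) (lab x) (lab x'))"
      using state_at_gram[OF j] by blast
    have "gram X ((A \<times> TA) \<times> ZS) f ?\<rho>"
      unfolding gram_def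
    proof (intro ballI)
      fix x y assume xy: "x \<in> X" "y \<in> X"
      then have "state_at (m - 1) (lab x) (lab y) = (\<Sum>j\<in>(A \<times> TA) \<times> ZS. f j x * cnj (f j y))"
        using f unfolding gram_def by blast
      then show "?\<rho> x y = (\<Sum>j\<in>(A \<times> TA) \<times> ZS. f j x * cnj (f j y))" using \<rho>[OF xy] by (simp only:)
    qed
    then have pos: "positive_op X ?\<rho>" by (rule gram_positive)
    have tr: "op_trace X ?\<rho> = 1"
    proof -
      have "op_trace X ?\<rho> = op_trace X (\<lambda>x x'. state_at (m - 1) (lab x) (lab x'))"
        unfolding op_trace_def by (intro sum.cong refl \<rho>)
      then show ?thesis by (simp only: state_at_trace[OF j])
    qed
    let ?b = "\<Sum>w\<in>A \<times> TA \<times> E. norm_sq Out (op_app In test_op (encoded w))"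
    have same: "Re (born X (?T m) ?\<rho>) = ?b" by (subst born_same[OF \<rho> j]) simp_all
    have "?b \<le> (\<Sum>w\<in>A \<times> TA \<times> E. norm_sq In (encoded w))" by (intro sum_mono test_op_contraction)
    then have b1: "?b \<le> 1" unfolding encoded_1 .
    have "s \<le> sqrt ?b" using correct_test s(2) by linarith
    then have "s\<^sup>2 \<le> (sqrt ?b)\<^sup>2" using s(1) by (intro power_mono)
    then have b: "s\<^sup>2 \<le> ?b" by (simp add: sum_nonneg)
    have "(\<Sum>k\<in>{1..<m}. Re (born X (?T k) ?\<rho>)) \<le> (\<Sum>k\<in>{1..<m}. \<kappa>1 * \<kappa>2)"
    proof (rule sum_mono)
      fix k assume "k \<in> {1..<m}"
      then have "k - 1 < K" "k - 1 \<noteq> m - 1" using m by auto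
      then show "Re (born X (?T k) ?\<rho>) \<le> \<kappa>1 * \<kappa>2" using j by (intro born_other[OF \<rho>]) simp_all
    qed
    also have "\<dots> = real (m - 1) * (\<kappa>1 * \<kappa>2)" by simp
    also have "\<dots> \<le> real (K - 1) * (\<kappa>1 * \<kappa>2)" using m kk by (intro mult_right_mono) auto
    also have "\<dots> \<le> E0" by (rule E0)
    finally have "(\<Sum>k\<in>{1..<m}. Re (born X (?T k) ?\<rho>)) \<le> E0" .
    from dec(2)[OF _ pos tr m this]
    have "(\<Sum>m'\<in>{1..K} - {m}. Re (?D ?\<rho> m' m')) \<le> 2 * sqrt E0 + (sqrt (1 - ?b) + sqrt (2 * sqrt E0))\<^sup>2"
      unfolding same by blast
    also have "\<dots> \<le> 2 * sqrt E0 + (sqrt (1 - s\<^sup>2) + sqrt (2 * sqrt E0))\<^sup>2"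
      using b b1 E00 by (intro add_left_mono power_mono add_mono real_sqrt_le_mono) auto
    finally show ?thesis using bound by linarith
  qed
  have ch: "channel X {1..K} ?D" by (rule dec(1))
  have "qsr_simulation A C (marg_AC R B \<Psi>) P M \<epsilon>' ?S"
    unfolding qsr_simulation_def msgs
  proof (intro conjI ballI allI impI)
    show "unit_vec_on (space_SA A C P ?S \<times> space_SB P ?S) (omega ?S)" by (rule omega_unit)
    show "channel (space_SB P ?S \<times> {..<dim_Q P}) {1..K} (decoder ?S)"
      using ch by (simp add: space_SB_def sim_def)
    fix m assume m: "m \<in> {1..K}"
    show "slot ?S m < num_pairs ?S" using m by (auto simp: sim_def)
    show "(\<Sum>s<dim_GB ?S. selected_state A C ?S m ((a, c, eA), eB, s) ((a', c', eA'), eB', s))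
       = marg_AC R B \<Psi> (a, c) (a', c') * (theta P (eA, eB) * cnj (theta P (eA', eB')))"
      if "a \<in> A" "c \<in> C" "a' \<in> A" "c' \<in> C" for a c eA eB a' c' eA' eB'
      using selected_marginal[OF m that, of ?D eA eB eA' eB'] by (simp add: sim_def)
    have "decoder ?S = ?D" by (simp add: sim_def)
    then show "(\<Sum>m'\<in>{1..K} - {m}. Re (decoder ?S (received_state A C P ?S m) m' m')) \<le> \<epsilon>'"
      using err[OF m] by (simp only:)
  qed
  then show ?thesis by blast
qed

end

context tested_redistribution
begin

lemma simulation:
  assumes kappa2: "0 \<le> \<kappa>2" and E0: "real (Max (messages M) - 1) * (\<kappa>1 * \<kappa>2) \<le> E0"
    and s: "0 \<le> s" "s \<le> sqrt (1 - \<epsilon>\<^sup>2) - \<eta>1 - \<eta>2"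
    and bound: "2 * sqrt E0 + (sqrt (1 - s\<^sup>2) + sqrt (2 * sqrt E0))\<^sup>2 \<le> \<epsilon>'"
  shows "\<exists>S. qsr_simulation A C (marg_AC R B \<Psi>) P M \<epsilon>' S"
proof -
  define K where "K = max 1 (nat \<lfloor>2 powr M\<rfloor>)"
  have msgs: "messages M = {1..K}" by (simp add: messages_def K_def)
  have K: "1 \<le> K" by (simp add: K_def)
  have "finite (nlists K (R \<times> B \<times> E))" by (simp add: finite_nlists)
  then obtain h where h: "bij_betw h {..<card (nlists K (R \<times> B \<times> E))} (nlists K (R \<times> B \<times> E))"
    using ex_bij_betw_nat_finite by (metis atLeast0LessThan)
  interpret coding R A B C E \<Phi> \<Psi> P q \<epsilon> N L \<kappa>1 \<kappa>2 \<eta>1 \<eta>2 K "card (nlists K (R \<times> B \<times> E))" h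
    by unfold_locales (fact K, fact h)
  have "Max (messages M) = K" unfolding msgs using K by (intro Max_eqI) auto
  then show ?thesis using simulation_exists[OF msgs kappa2 _ s bound] E0 by simp
qed

end

section \<open>Spectral projections\<close>

definition spectral_projection :: "'i set \<Rightarrow> ('i \<Rightarrow> 'x \<Rightarrow> complex) \<Rightarrow> ('x, 'x) operator" where
  "spectral_projection T u = (\<lambda>x y. \<Sum>i\<in>T. u i x * cnj (u i y))"

lemma adj_spectral_projection [simp]: "adj (spectral_projection T u) = spectral_projection T u"
  by (simp add: adj_def spectral_projection_def mult.commute)

lemma norm_ip_commute: "cmod (ip X u v) = cmod (ip X v u)"
  by (subst ip_cnj[symmetric]) simp

lemma op_app_spectral_projection:
  "op_app X (spectral_projection T u) v x = (\<Sum>i\<in>T. ip X (u i) v * u i x)"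
proof -
  have "op_app X (spectral_projection T u) v x = (\<Sum>y\<in>X. \<Sum>i\<in>T. cnj (u i y) * v y * u i x)"
    by (simp add: op_app_def spectral_projection_def sum_distrib_left sum_distrib_right mult_ac)
  also have "\<dots> = (\<Sum>i\<in>T. \<Sum>y\<in>X. cnj (u i y) * v y * u i x)" by (rule sum.swap)
  finally show ?thesis by (simp add: ip_def sum_distrib_right)
qed

context
  fixes X :: "'x set" and I :: "'i set" and u :: "'i \<Rightarrow> 'x \<Rightarrow> complex" and p :: "'i \<Rightarrow> real"
    and \<rho> :: "('x, 'x) operator" and T :: "'i set"
  assumes X: "finite X" and I: "finite I" and es: "eigensystem X I u p \<rho>"
    and p0: "\<And>i. i \<in> I \<Longrightarrow> 0 \<le> p i" and T: "T \<subseteq> I"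
begin

lemma parseval: "norm_sq X v = (\<Sum>i\<in>I. (cmod (ip X (u i) v))\<^sup>2)"
proof -
  have g: "gram X I u (\<lambda>x y. of_bool (x = y))" using es by (simp add: gram_def eigensystem_def)
  have "of_real (norm_sq X v) = ip X v (op_app X (\<lambda>x y. of_bool (x = y)) v)"
    unfolding ip_self[symmetric] using X by (intro ip_cong) (simp_all add: op_app_def sum_of_bool)
  also have "\<dots> = of_real (\<Sum>i\<in>I. (cmod (ip X v (u i)))\<^sup>2)" by (rule gram_ip[OF g])
  finally show ?thesis by (simp only: of_real_eq_iff norm_ip_commute[of X v])
qed

lemma eigensystem_expectation:
  assumes "gram X J f \<rho>"
  shows "(\<Sum>j\<in>J. (cmod (ip X v (f j)))\<^sup>2) = (\<Sum>i\<in>I. p i * (cmod (ip X (u i) v))\<^sup>2)"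
proof -
  have "complex_of_real (\<Sum>j\<in>J. (cmod (ip X v (f j)))\<^sup>2) = ip X v (op_app X \<rho> v)"
    by (rule gram_ip[OF assms, symmetric])
  also have "\<dots> = of_real (\<Sum>i\<in>I. (cmod (ip X v (\<lambda>x. of_real (sqrt (p i)) * u i x)))\<^sup>2)"
    by (rule gram_ip[OF eigensystem_gram[OF es p0]])
  also have "(\<Sum>i\<in>I. (cmod (ip X v (\<lambda>x. of_real (sqrt (p i)) * u i x)))\<^sup>2) = (\<Sum>i\<in>I. p i * (cmod (ip X (u i) v))\<^sup>2)"
    using p0 unfolding ip_scale_right
    by (intro sum.cong refl) (simp add: norm_mult power_mult_distrib norm_ip_commute[of X v])
  finally show ?thesis by (simp only: of_real_eq_iff)
qed

lemma ip_spectral_projection: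
  assumes "j \<in> I"
  shows "ip X (u j) (op_app X (spectral_projection T u) v) = of_bool (j \<in> T) * ip X (u j) v"
proof -
  have fT: "finite T" using T I finite_subset by blast
  have "ip X (u j) (op_app X (spectral_projection T u) v) = (\<Sum>i\<in>T. ip X (u i) v * ip X (u j) (u i))"
    unfolding op_app_spectral_projection[abs_def] by (simp only: ip_sum_right ip_scale_right)
  also have "\<dots> = (\<Sum>i\<in>T. ip X (u i) v * of_bool (j = i))"
    using es T assms by (intro sum.cong) (auto simp: eigensystem_def)
  also have "\<dots> = (if j \<in> T then ip X (u j) v else 0)" by (rule sum_of_bool(3)[OF fT])
  finally show ?thesis by simp
qed

lemma norm_sq_spectral_projection:
  "norm_sq X (op_app X (spectral_projection T u) v) = (\<Sum>i\<in>T. (cmod (ip X (u i) v))\<^sup>2)"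
proof -
  have "norm_sq X (op_app X (spectral_projection T u) v) = (\<Sum>i\<in>I. if i \<in> T then (cmod (ip X (u i) v))\<^sup>2 else 0)"
    unfolding parseval by (intro sum.cong refl) (simp add: ip_spectral_projection)
  also have "\<dots> = (\<Sum>i\<in>I \<inter> T. (cmod (ip X (u i) v))\<^sup>2)"
    by (rule sum.inter_restrict[OF I, symmetric])
  also have "I \<inter> T = T" using T by auto
  finally show ?thesis .
qed

lemma spectral_projection_contraction: "norm_sq X (op_app X (spectral_projection T u) v) \<le> norm_sq X v"
  unfolding norm_sq_spectral_projection unfolding parseval using T I by (intro sum_mono2) auto

text \<open>Summed over the family, the squared overlaps with \<open>u i\<close> give the eigenvalue
  \<open>p i\<close>, so exactly the spectral weight outside \<open>T\<close> is lost.\<close>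

lemma spectral_projection_close:
  assumes "gram X J f \<rho>"
  shows "(\<Sum>j\<in>J. norm_sq X (\<lambda>x. f j x - op_app X (spectral_projection T u) (f j) x)) = (\<Sum>i\<in>I - T. p i)"
proof -
  have "norm_sq X (\<lambda>x. f j x - op_app X (spectral_projection T u) (f j) x) = (\<Sum>i\<in>I - T. (cmod (ip X (u i) (f j)))\<^sup>2)" for j
  proof -
    have "norm_sq X (\<lambda>x. f j x - op_app X (spectral_projection T u) (f j) x)
      = (\<Sum>i\<in>I. if i \<in> I - T then (cmod (ip X (u i) (f j)))\<^sup>2 else 0)"
      unfolding parseval ip_diff_right by (intro sum.cong refl) (simp add: ip_spectral_projection)
    also have "\<dots> = (\<Sum>i\<in>I \<inter> (I - T). (cmod (ip X (u i) (f j)))\<^sup>2)"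
      by (rule sum.inter_restrict[OF I, symmetric])
    also have "I \<inter> (I - T) = I - T" by auto
    finally show ?thesis .
  qed
  then have "(\<Sum>j\<in>J. norm_sq X (\<lambda>x. f j x - op_app X (spectral_projection T u) (f j) x))
    = (\<Sum>i\<in>I - T. \<Sum>j\<in>J. (cmod (ip X (u i) (f j)))\<^sup>2)"
    by (simp only: sum.swap[of _ J])
  also have "\<dots> = (\<Sum>i\<in>I - T. p i)"
  proof (rule sum.cong[OF refl])
    fix i assume i: "i \<in> I - T"
    have "(\<Sum>j\<in>J. (cmod (ip X (u i) (f j)))\<^sup>2) = (\<Sum>k\<in>I. p k * (cmod (ip X (u k) (u i)))\<^sup>2)"
      by (rule eigensystem_expectation[OF assms])
    also have "\<dots> = (\<Sum>k\<in>I. p k * of_bool (k = i))"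
      using es i by (intro sum.cong refl) (auto simp: eigensystem_def)
    also have "\<dots> = p i" using i I by (simp add: sum_of_bool)
    finally show "(\<Sum>j\<in>J. (cmod (ip X (u i) (f j)))\<^sup>2) = p i" .
  qed
  finally show ?thesis .
qed

lemma spectral_projection_lower:
  assumes "gram X J f \<rho>" "\<And>i. i \<in> T \<Longrightarrow> 1 \<le> \<mu> * p i" "0 \<le> \<mu>"
  shows "norm_sq X (op_app X (spectral_projection T u) v) \<le> \<mu> * (\<Sum>j\<in>J. (cmod (ip X v (f j)))\<^sup>2)"
proof -
  have "(\<Sum>i\<in>T. (cmod (ip X (u i) v))\<^sup>2) \<le> (\<Sum>i\<in>T. \<mu> * p i * (cmod (ip X (u i) v))\<^sup>2)"
    using assms(2) mult_right_mono[of 1] by (intro sum_mono) fastforce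
  also have "\<dots> \<le> (\<Sum>i\<in>I. \<mu> * p i * (cmod (ip X (u i) v))\<^sup>2)"
    using T I p0 assms(3) by (intro sum_mono2) auto
  finally show ?thesis
    unfolding norm_sq_spectral_projection eigensystem_expectation[OF assms(1)]
    by (simp add: sum_distrib_left mult.assoc)
qed

lemma spectral_projection_upper:
  assumes "gram X J f \<rho>" "\<And>i. i \<in> T \<Longrightarrow> p i \<le> \<nu>" "0 \<le> \<nu>"
  shows "(\<Sum>j\<in>J. (cmod (ip X (op_app X (spectral_projection T u) v) (f j)))\<^sup>2) \<le> \<nu> * norm_sq X v"
proof -
  have "(\<Sum>j\<in>J. (cmod (ip X (op_app X (spectral_projection T u) v) (f j)))\<^sup>2)
    = (\<Sum>i\<in>I. p i * (cmod (of_bool (i \<in> T) * ip X (u i) v))\<^sup>2)"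
    unfolding eigensystem_expectation[OF assms(1)] by (intro sum.cong refl) (simp only: ip_spectral_projection)
  also have "\<dots> \<le> (\<Sum>i\<in>I. \<nu> * (cmod (ip X (u i) v))\<^sup>2)"
    using assms(2,3) by (intro sum_mono) (auto intro: mult_right_mono)
  finally show ?thesis by (simp add: parseval sum_distrib_left)
qed

end

section \<open>Tensor powers\<close>

text \<open>\<open>co l\<close> lists the labels of the \<open>n\<close> factors of the label \<open>l\<close> of the tensor power.\<close>

definition power_labels :: "nat \<Rightarrow> 'l set \<Rightarrow> ('l \<Rightarrow> nat \<Rightarrow> 'x::finite) \<Rightarrow> bool" where
  "power_labels n M co \<longleftrightarrow> finite M \<and>
     (\<forall>g :: nat \<Rightarrow> 'x \<Rightarrow> complex. (\<Sum>l\<in>M. \<Prod>i<n. g i (co l i)) = (\<Prod>i<n. \<Sum>x\<in>UNIV. g i x)) \<and>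
     (\<forall>l\<in>M. \<forall>l'\<in>M. (\<forall>i<n. co l i = co l' i) \<longrightarrow> l = l')"

lemma power_labels_1: "power_labels n (nlists n UNIV) (\<lambda>xs i. xs ! i)"
  by (auto simp: power_labels_def finite_nlists sum_prod_nlists in_nlists_UNIV intro: nth_equalityI)

lemma power_labels_2: "power_labels n (nlists n UNIV \<times> nlists n UNIV) (\<lambda>(xs, ys) i. (xs ! i, ys ! i))"
proof -
  have "(\<Sum>l\<in>nlists n UNIV \<times> nlists n UNIV. \<Prod>i<n. g i ((\<lambda>(xs, ys) i. (xs ! i, ys ! i)) l i)) = (\<Prod>i<n. \<Sum>x\<in>UNIV. g i x)"
    for g :: "nat \<Rightarrow> 'a \<times> 'b \<Rightarrow> complex"
    unfolding sum.cartesian_product' split_conv UNIV_Times_UNIV[symmetric]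
    by (rule sum_prod_nlists2[of _ _ "\<lambda>i x y. g i (x, y)"]) simp_all
  then show ?thesis
    by (auto simp: power_labels_def finite_nlists in_nlists_UNIV intro: nth_equalityI)
qed

lemma power_labels_3:
  "power_labels n (nlists n UNIV \<times> nlists n UNIV \<times> nlists n UNIV) (\<lambda>(xs, ys, zs) i. (xs ! i, ys ! i, zs ! i))"
proof -
  have "(\<Sum>l\<in>nlists n UNIV \<times> nlists n UNIV \<times> nlists n UNIV. \<Prod>i<n. g i ((\<lambda>(xs, ys, zs) i. (xs ! i, ys ! i, zs ! i)) l i))
      = (\<Prod>i<n. \<Sum>x\<in>UNIV. g i x)"
    for g :: "nat \<Rightarrow> 'a \<times> 'b \<times> 'c \<Rightarrow> complex"
  proof -
    have "(\<Sum>ys\<in>nlists n UNIV. \<Sum>zs\<in>nlists n UNIV. \<Prod>i<n. g i (xs ! i, ys ! i, zs ! i))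
      = (\<Prod>i<n. \<Sum>y\<in>UNIV. \<Sum>z\<in>UNIV. g i (xs ! i, y, z))" for xs
      by (rule sum_prod_nlists2[of _ _ "\<lambda>i y z. g i (xs ! i, y, z)"]) simp_all
    then show ?thesis
      unfolding sum.cartesian_product' split_conv UNIV_Times_UNIV[symmetric]
      using sum_prod_nlists[of UNIV "\<lambda>i x. \<Sum>y\<in>UNIV. \<Sum>z\<in>UNIV. g i (x, y, z)" n] by simp
  qed
  then show ?thesis
    by (auto simp: power_labels_def finite_nlists in_nlists_UNIV intro: nth_equalityI)
qed

text \<open>The eigenvectors are products of eigenvectors of \<open>\<rho>\<close>, one for each
  list of indices. Orthonormality is a sum over labels and factorises by
  \<open>power_labels\<close>; completeness and the decomposition are sums over index lists and
  factorise by \<open>sum_prod_nlists\<close>.\<close>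

lemma eigensystem_power:
  fixes \<rho> :: "('x::finite, 'x) operator" and d :: nat
  assumes es: "eigensystem UNIV {..<d} u p \<rho>" and M: "power_labels n M co"
  shows "eigensystem M (nlists n {..<d}) (\<lambda>J l. \<Prod>i<n. u (J ! i) (co l i)) (\<lambda>J. \<Prod>i<n. p (J ! i))
    (\<lambda>l l'. \<Prod>i<n. \<rho> (co l i) (co l' i))"
  unfolding eigensystem_def
proof (intro conjI ballI)
  note H = M[unfolded power_labels_def]
  have eqJ: "(\<forall>i<n. J ! i = J' ! i) \<longleftrightarrow> J = J'" if "J \<in> nlists n {..<d}" "J' \<in> nlists n {..<d}" for J J' :: "nat list"
    using that by (auto intro: nth_equalityI)
  have all: "(\<Prod>i<n. of_bool (Q i)) = (of_bool (\<forall>i<n. Q i) :: complex)" for Q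
    using prod_of_bool_all[of "{..<n}" Q] by auto
  fix J J' assume J: "J \<in> nlists n {..<d}" "J' \<in> nlists n {..<d}"
  have "ip M (\<lambda>l. \<Prod>i<n. u (J ! i) (co l i)) (\<lambda>l. \<Prod>i<n. u (J' ! i) (co l i))
    = (\<Sum>l\<in>M. \<Prod>i<n. cnj (u (J ! i) (co l i)) * u (J' ! i) (co l i))"
    by (simp add: ip_def cnj_prod prod.distrib)
  also have "\<dots> = (\<Prod>i<n. \<Sum>x\<in>UNIV. cnj (u (J ! i) x) * u (J' ! i) x)"
    using H by (elim conjE) (drule spec[of _ "\<lambda>i x. cnj (u (J ! i) x) * u (J' ! i) x"], simp)
  also have "\<dots> = (\<Prod>i<n. of_bool (J ! i = J' ! i))"
  proof (rule prod.cong[OF refl])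
    fix i assume "i \<in> {..<n}"
    then have "J ! i \<in> {..<d}" "J' ! i \<in> {..<d}" using J nlistsE_nth_in by fastforce+
    then show "(\<Sum>x\<in>UNIV. cnj (u (J ! i) x) * u (J' ! i) x) = of_bool (J ! i = J' ! i)"
      using es by (simp add: eigensystem_def ip_def)
  qed
  finally show "ip M (\<lambda>l. \<Prod>i<n. u (J ! i) (co l i)) (\<lambda>l. \<Prod>i<n. u (J' ! i) (co l i)) = of_bool (J = J')"
    by (simp only: all eqJ[OF J])
next
  note H = M[unfolded power_labels_def]
  fix l l' assume l: "l \<in> M" "l' \<in> M"
  have all: "(\<Prod>i<n. of_bool (Q i)) = (of_bool (\<forall>i<n. Q i) :: complex)" for Q
    using prod_of_bool_all[of "{..<n}" Q] by auto
  have "(\<Sum>J\<in>nlists n {..<d}. (\<Prod>i<n. u (J ! i) (co l i)) * cnj (\<Prod>i<n. u (J ! i) (co l' i)))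
    = (\<Sum>J\<in>nlists n {..<d}. \<Prod>i<n. u (J ! i) (co l i) * cnj (u (J ! i) (co l' i)))"
    by (simp add: cnj_prod prod.distrib)
  also have "\<dots> = (\<Prod>i<n. \<Sum>k<d. u k (co l i) * cnj (u k (co l' i)))"
    by (rule sum_prod_nlists) simp
  also have "\<dots> = (\<Prod>i<n. of_bool (co l i = co l' i))"
    using es by (simp add: eigensystem_def)
  also have "\<dots> = of_bool (\<forall>i<n. co l i = co l' i)" by (rule all)
  also have "(\<forall>i<n. co l i = co l' i) \<longleftrightarrow> l = l'" using H l by blast
  finally show "(\<Sum>J\<in>nlists n {..<d}. (\<Prod>i<n. u (J ! i) (co l i)) * cnj (\<Prod>i<n. u (J ! i) (co l' i))) = of_bool (l = l')" .
next
  fix l l' assume l: "l \<in> M" "l' \<in> M"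
  have "(\<Sum>J\<in>nlists n {..<d}. of_real (\<Prod>i<n. p (J ! i)) * ((\<Prod>i<n. u (J ! i) (co l i)) * cnj (\<Prod>i<n. u (J ! i) (co l' i))))
    = (\<Sum>J\<in>nlists n {..<d}. \<Prod>i<n. of_real (p (J ! i)) * (u (J ! i) (co l i) * cnj (u (J ! i) (co l' i))))"
    by (simp add: cnj_prod prod.distrib)
  also have "\<dots> = (\<Prod>i<n. \<Sum>k<d. of_real (p k) * (u k (co l i) * cnj (u k (co l' i))))"
    by (rule sum_prod_nlists) simp
  also have "\<dots> = (\<Prod>i<n. \<rho> (co l i) (co l' i))"
    using es by (simp add: eigensystem_def)
  finally show "(\<Prod>i<n. \<rho> (co l i) (co l' i)) = (\<Sum>J\<in>nlists n {..<d}. of_real (\<Prod>i<n. p (J ! i)) * ((\<Prod>i<n. u (J ! i) (co l i)) * cnj (\<Prod>i<n. u (J ! i) (co l' i))))"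
    by simp
qed

section \<open>Typical sequences\<close>

text \<open>Moments of a sum of \<open>n\<close> independent centred variables. The claims are
  proved together because the normalisation and the vanishing mean remove the cross terms in the
  induction step of the second moment.\<close>

lemma second_moment:
  fixes p y :: "nat \<Rightarrow> real"
  assumes p1: "(\<Sum>k<d. p k) = 1" and y0: "(\<Sum>k<d. p k * y k) = 0"
  shows "(\<Sum>J\<in>nlists n {..<d}. (\<Prod>i<n. p (J ! i))) = 1"
    and "(\<Sum>J\<in>nlists n {..<d}. (\<Prod>i<n. p (J ! i)) * (\<Sum>i<n. y (J ! i))) = 0"
    and "(\<Sum>J\<in>nlists n {..<d}. (\<Prod>i<n. p (J ! i)) * (\<Sum>i<n. y (J ! i))\<^sup>2) = real n * (\<Sum>k<d. p k * (y k)\<^sup>2)"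
proof (induction n)
  case (Suc n)
  let ?p = "\<lambda>J. \<Prod>i<n. p (J ! i)" and ?y = "\<lambda>J. \<Sum>i<n. y (J ! i)" and ?N = "nlists n {..<d}"
  note S = sum_nlists_Suc[OF finite_lessThan, where n = n]
  have pc: "(\<Prod>i<Suc n. p ((k # J) ! i)) = p k * ?p J" and yc: "(\<Sum>i<Suc n. y ((k # J) ! i)) = y k + ?y J" for k J
    by (simp_all add: prod.lessThan_Suc_shift sum.lessThan_Suc_shift del: prod.lessThan_Suc sum.lessThan_Suc)
  show 1: "(\<Sum>J\<in>nlists (Suc n) {..<d}. (\<Prod>i<Suc n. p (J ! i))) = 1"
    unfolding S pc by (simp add: sum_distrib_left[symmetric] Suc p1)
  have "(\<Sum>J\<in>nlists (Suc n) {..<d}. (\<Prod>i<Suc n. p (J ! i)) * (\<Sum>i<Suc n. y (J ! i)))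
    = (\<Sum>k<d. p k * y k * (\<Sum>J\<in>?N. ?p J) + p k * (\<Sum>J\<in>?N. ?p J * ?y J))"
    unfolding S pc yc by (simp add: sum_distrib_left sum.distrib[symmetric] algebra_simps)
  then show "(\<Sum>J\<in>nlists (Suc n) {..<d}. (\<Prod>i<Suc n. p (J ! i)) * (\<Sum>i<Suc n. y (J ! i))) = 0"
    by (simp add: Suc y0)
  have "(\<Sum>J\<in>nlists (Suc n) {..<d}. (\<Prod>i<Suc n. p (J ! i)) * (\<Sum>i<Suc n. y (J ! i))\<^sup>2)
    = (\<Sum>k<d. p k * (y k)\<^sup>2 * (\<Sum>J\<in>?N. ?p J) + 2 * (p k * y k) * (\<Sum>J\<in>?N. ?p J * ?y J) + p k * (\<Sum>J\<in>?N. ?p J * (?y J)\<^sup>2))"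
  proof -
    have "a * b * (c + s)\<^sup>2 = a * c\<^sup>2 * b + 2 * (a * c) * (b * s) + a * (b * s\<^sup>2)" for a b c s :: real
      by (simp add: power2_sum algebra_simps)
    then show ?thesis unfolding S pc yc by (simp only: sum.distrib sum_distrib_left[symmetric])
  qed
  also have "\<dots> = (\<Sum>k<d. p k * (y k)\<^sup>2 + p k * (real n * (\<Sum>k<d. p k * (y k)\<^sup>2)))"
    by (simp only: Suc) simp
  also have "\<dots> = (\<Sum>k<d. p k * (y k)\<^sup>2) + (\<Sum>k<d. p k) * (real n * (\<Sum>k<d. p k * (y k)\<^sup>2))"
    by (simp only: sum.distrib sum_distrib_right)
  finally show "(\<Sum>J\<in>nlists (Suc n) {..<d}. (\<Prod>i<Suc n. p (J ! i)) * (\<Sum>i<Suc n. y (J ! i))\<^sup>2) = real (Suc n) * (\<Sum>k<d. p k * (y k)\<^sup>2)"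
    by (simp add: p1 algebra_simps)
qed simp_all

definition typical :: "nat \<Rightarrow> nat \<Rightarrow> (nat \<Rightarrow> real) \<Rightarrow> real \<Rightarrow> real \<Rightarrow> nat list set" where
  "typical n d p H \<delta> = {J \<in> nlists n {..<d}. 2 powr (- (n * (H + \<delta>))) \<le> (\<Prod>i<n. p (J ! i)) \<and>
     (\<Prod>i<n. p (J ! i)) \<le> 2 powr (- (n * (H - \<delta>)))}"

text \<open>Chebyshev's inequality for the sum of the centred surprisals
  \<open>- log 2 (p k) - H\<close>, since atypicality means a deviation beyond
  \<open>n * \<delta>\<close>. Sequences of probability 0 have no meaningful logarithm but carry no
  weight, hence the case distinction.\<close>

lemma atypical_weight:
  assumes p0: "\<And>k. k < d \<Longrightarrow> 0 \<le> p k" and p1: "(\<Sum>k<d. p k) = 1"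
    and H: "H = (\<Sum>k<d. - (p k * log 2 (p k)))" and n: "0 < n" and \<delta>: "0 < \<delta>"
  shows "(\<Sum>J\<in>nlists n {..<d} - typical n d p H \<delta>. \<Prod>i<n. p (J ! i))
    \<le> (\<Sum>k<d. p k * (- log 2 (p k) - H)\<^sup>2) / (real n * \<delta>\<^sup>2)"
proof -
  define y where "y = (\<lambda>k. - log 2 (p k) - H)"
  let ?p = "\<lambda>J. \<Prod>i<n. p (J ! i)" and ?y = "\<lambda>J. \<Sum>i<n. y (J ! i)" and ?N = "nlists n {..<d}"
  have y0: "(\<Sum>k<d. p k * y k) = 0"
  proof -
    have "(\<Sum>k<d. p k * y k) = (\<Sum>k<d. - (p k * log 2 (p k))) - (\<Sum>k<d. p k) * H"
      by (simp add: y_def sum_distrib_right sum_subtractf right_diff_distrib)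
    then show ?thesis by (simp add: p1 H)
  qed
  have pJ: "0 \<le> ?p J" if "J \<in> ?N" for J
    using that nlistsE_nth_in[OF that] by (intro prod_nonneg) (auto intro: p0)
  have bad: "?p J * (real n * \<delta>)\<^sup>2 \<le> ?p J * (?y J)\<^sup>2" if J: "J \<in> ?N - typical n d p H \<delta>" for J
  proof (cases "?p J = 0")
    case False
    then have pos: "p (J ! i) > 0" if "i < n" for i
    proof -
      have "J ! i \<in> {..<d}" using J that nlistsE_nth_in[of J n "{..<d}" i] by blast
      then have "0 \<le> p (J ! i)" using p0 by simp
      moreover have "p (J ! i) \<noteq> 0" using False that by auto
      ultimately show ?thesis by simp
    qed
    have "log 2 (?p J) = (\<Sum>i<n. log 2 (p (J ! i)))"
      unfolding log_def by (subst ln_prod) (auto simp: sum_divide_distrib dest: pos order_less_imp_not_eq2)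
    then have y: "?y J = - log 2 (?p J) - n * H"
      by (simp add: y_def sum_subtractf sum_negf)
    have p: "?p J > 0" using pos by (intro prod_pos) auto
    have pl: "?p J = 2 powr log 2 (?p J)" using p by simp
    have "\<not> (2 powr (- (n * (H + \<delta>))) \<le> ?p J) \<or> \<not> (?p J \<le> 2 powr (- (n * (H - \<delta>))))"
      using J by (auto simp: typical_def)
    then have "log 2 (?p J) < - (n * (H + \<delta>)) \<or> - (n * (H - \<delta>)) < log 2 (?p J)"
      by (subst (asm) (1 2) pl) (auto simp: not_le powr_less_cancel_iff simp del: powr_log_cancel)
    then have "real n * \<delta> < \<bar>?y J\<bar>" unfolding y by (auto simp: algebra_simps)
    then have "(real n * \<delta>)\<^sup>2 \<le> (?y J)\<^sup>2" using \<delta> abs_le_square_iff[of "real n * \<delta>" "?y J"] by simp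
    then show ?thesis using p by (intro mult_left_mono) auto
  next
    case True
    then show ?thesis by (simp only: mult_zero_left)
  qed
  have "(\<Sum>J\<in>?N - typical n d p H \<delta>. ?p J) * (real n * \<delta>)\<^sup>2 \<le> (\<Sum>J\<in>?N - typical n d p H \<delta>. ?p J * (?y J)\<^sup>2)"
    unfolding sum_distrib_right by (intro sum_mono bad)
  also have "\<dots> \<le> (\<Sum>J\<in>?N. ?p J * (?y J)\<^sup>2)"
    using pJ by (intro sum_mono2) (auto simp: finite_nlists)
  also have "\<dots> = real n * (\<Sum>k<d. p k * (y k)\<^sup>2)" by (rule second_moment(3)[OF p1 y0])
  finally have "(\<Sum>J\<in>?N - typical n d p H \<delta>. ?p J) \<le> real n * (\<Sum>k<d. p k * (y k)\<^sup>2) / (real n * \<delta>)\<^sup>2"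
    using n \<delta> by (simp add: pos_le_divide_eq)
  also have "\<dots> = (\<Sum>k<d. p k * (y k)\<^sup>2) / (real n * \<delta>\<^sup>2)"
    using n by (simp add: power2_eq_square)
  finally show ?thesis by (simp add: y_def)
qed

lemma atypical_weight_small:
  assumes p0: "\<And>k. k < d \<Longrightarrow> 0 \<le> p k" and p1: "(\<Sum>k<d. p k) = 1"
    and H: "H = (\<Sum>k<d. - (p k * log 2 (p k)))" and \<delta>: "0 < \<delta>" and \<eta>: "0 < \<eta>"
  shows "\<exists>n0. \<forall>n\<ge>n0. (\<Sum>J\<in>nlists n {..<d} - typical n d p H \<delta>. \<Prod>i<n. p (J ! i)) \<le> \<eta>"
proof -
  let ?V = "\<Sum>k<d. p k * (- log 2 (p k) - H)\<^sup>2"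
  obtain n0 where n0: "?V / (\<eta> * \<delta>\<^sup>2) \<le> real n0" using real_arch_simple by blast
  show ?thesis
  proof (intro exI[of _ "Suc n0"] allI impI)
    fix n assume n: "Suc n0 \<le> n"
    have "?V / (\<eta> * \<delta>\<^sup>2) \<le> real n" using n0 n by linarith
    then have "?V \<le> real n * (\<eta> * \<delta>\<^sup>2)" using \<eta> \<delta> by (simp add: pos_divide_le_eq)
    then have "?V / (real n * \<delta>\<^sup>2) \<le> \<eta>" using n \<delta> by (simp add: pos_divide_le_eq mult_ac)
    then show "(\<Sum>J\<in>nlists n {..<d} - typical n d p H \<delta>. \<Prod>i<n. p (J ! i)) \<le> \<eta>"
      using atypical_weight[OF p0 p1 H _ \<delta>, where n = n] n by auto
  qed
qed

text \<open>The properties of the typical projection that are used below.  The state is given by vectors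
  \<open>f\<close> with \<open>\<rho> = \<Sum>\<^sub>j f\<^sub>j f\<^sub>j\<^sup>\<dagger>\<close>: first \<open>Tr (1 - Pj) \<rho> \<le> \<eta>\<close>, then \<open>Pj \<le> 2\<^bsup>n(H+\<delta>)\<^esup> \<rho>\<close>, then
  \<open>Pj \<rho> Pj \<le> 2\<^bsup>-n(H-\<delta>)\<^esup>\<close>.\<close>

definition typical_projection ::
  "'l set \<Rightarrow> 'j set \<Rightarrow> ('j \<Rightarrow> 'l \<Rightarrow> complex) \<Rightarrow> real \<Rightarrow> real \<Rightarrow> real \<Rightarrow> ('l, 'l) operator \<Rightarrow> bool" where
  "typical_projection M J f \<mu> \<nu> \<eta> Pj \<longleftrightarrow> adj Pj = Pj \<and>
     (\<forall>v. norm_sq M (op_app M Pj v) \<le> norm_sq M v) \<and>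
     (\<Sum>j\<in>J. norm_sq M (\<lambda>x. f j x - op_app M Pj (f j) x)) \<le> \<eta> \<and>
     (\<forall>v. norm_sq M (op_app M Pj v) \<le> \<mu> * (\<Sum>j\<in>J. (cmod (ip M v (f j)))\<^sup>2)) \<and>
     (\<forall>v. (\<Sum>j\<in>J. (cmod (ip M (op_app M Pj v) (f j)))\<^sup>2) \<le> \<nu> * norm_sq M v)"

text \<open>The projection onto the products of eigenvectors with typical index lists. The threshold
  comes from the spectrum of \<open>\<rho>\<close>, \<open>\<delta>\<close> and
  \<open>\<eta>\<close>; the labelling of the power and its family \<open>f\<close> are still
  free.\<close>

lemma typical_projection_exists:
  fixes \<rho> :: "('x::finite, 'x) operator"
  assumes pos: "positive_op UNIV \<rho>" and tr: "op_trace UNIV \<rho> = 1" and \<delta>: "0 < \<delta>" and \<eta>: "0 < \<eta>"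
  shows "\<exists>n0. \<forall>n\<ge>n0. \<forall>(M :: 'l set) co (J :: 'j set) f. power_labels n M co \<longrightarrow>
    gram M J f (\<lambda>l l'. \<Prod>i<n. \<rho> (co l i) (co l' i)) \<longrightarrow>
    (\<exists>Pj. typical_projection M J f (2 powr (n * (entropy UNIV \<rho> + \<delta>))) (2 powr (- (n * (entropy UNIV \<rho> - \<delta>)))) \<eta> Pj)"
proof -
  let ?d = "card (UNIV :: 'x set)" and ?H = "entropy UNIV \<rho>"
  obtain u p where up: "eigensystem UNIV {..<?d} u p \<rho>" "\<And>i. i < ?d \<Longrightarrow> 0 \<le> p i"
    using positive_op_eigensystem[OF finite_class.finite_UNIV pos] by blast
  have H: "?H = (\<Sum>i<?d. - (p i * log 2 (p i)))"
    by (rule entropy_eigensystem[OF finite_class.finite_UNIV up(1)])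
  have p1: "(\<Sum>i<?d. p i) = 1"
  proof -
    have "op_trace UNIV \<rho> = (\<Sum>x\<in>UNIV. \<Sum>i<?d. of_real (p i) * (cnj (u i x) * u i x))"
      using up(1) by (simp add: op_trace_def eigensystem_def mult_ac)
    also have "\<dots> = (\<Sum>i<?d. of_real (p i) * ip UNIV (u i) (u i))"
      by (subst sum.swap) (simp add: ip_def sum_distrib_left)
    also have "\<dots> = of_real (\<Sum>i<?d. p i)" using up(1) by (simp add: eigensystem_def)
    finally show ?thesis using tr by (metis of_real_eq_1_iff)
  qed
  obtain n0 where n0: "\<And>n. n0 \<le> n \<Longrightarrow> (\<Sum>J\<in>nlists n {..<?d} - typical n ?d p ?H \<delta>. \<Prod>i<n. p (J ! i)) \<le> \<eta>"
    using atypical_weight_small[OF up(2) p1 H \<delta> \<eta>] by blast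
  show ?thesis
  proof (intro exI[of _ n0] allI impI)
    fix n and M :: "'l set" and co and J :: "'j set" and f
    assume n: "n0 \<le> n" and M: "power_labels n M co"
      and f: "gram M J f (\<lambda>l l'. \<Prod>i<n. \<rho> (co l i) (co l' i))"
    let ?I = "nlists n {..<?d}" and ?T = "typical n ?d p ?H \<delta>"
    let ?u = "\<lambda>J l. \<Prod>i<n. u (J ! i) (co l i)" and ?p = "\<lambda>J. \<Prod>i<n. p (J ! i)"
    have es: "eigensystem M ?I ?u ?p (\<lambda>l l'. \<Prod>i<n. \<rho> (co l i) (co l' i))"
      by (rule eigensystem_power[OF up(1) M])
    have fM: "finite M" using M by (simp add: power_labels_def)
    have fI: "finite ?I" by (simp add: finite_nlists)
    have p0: "0 \<le> ?p J" if "J \<in> ?I" for J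
      using nlistsE_nth_in[OF that] by (intro prod_nonneg) (auto intro: up(2))
    have TI: "?T \<subseteq> ?I" by (auto simp: typical_def)
    let ?Pj = "spectral_projection ?T ?u"
    note ctx = fM fI es p0 TI
    have lower: "1 \<le> 2 powr (n * (?H + \<delta>)) * ?p i" if "i \<in> ?T" for i
    proof -
      have "2 powr (- (n * (?H + \<delta>))) \<le> ?p i" using that by (simp add: typical_def)
      then have "2 powr (n * (?H + \<delta>)) * 2 powr (- (n * (?H + \<delta>))) \<le> 2 powr (n * (?H + \<delta>)) * ?p i"
        by (intro mult_left_mono) auto
      then show ?thesis by (simp add: powr_add[symmetric])
    qed
    have upper: "?p i \<le> 2 powr (- (n * (?H - \<delta>)))" if "i \<in> ?T" for i
      using that by (simp add: typical_def)
    have "typical_projection M J f (2 powr (n * (?H + \<delta>))) (2 powr (- (n * (?H - \<delta>)))) \<eta> ?Pj"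
      unfolding typical_projection_def
    proof (intro conjI allI)
      show "(\<Sum>j\<in>J. norm_sq M (\<lambda>x. f j x - op_app M ?Pj (f j) x)) \<le> \<eta>"
        using spectral_projection_close[OF ctx f] n0[OF n] by (simp only:)
      show "norm_sq M (op_app M ?Pj v) \<le> 2 powr (n * (?H + \<delta>)) * (\<Sum>j\<in>J. (cmod (ip M v (f j)))\<^sup>2)" for v
        by (rule spectral_projection_lower[OF ctx f lower]) simp_all
      show "(\<Sum>j\<in>J. (cmod (ip M (op_app M ?Pj v) (f j)))\<^sup>2) \<le> 2 powr (- (n * (?H - \<delta>))) * norm_sq M v" for v
        by (rule spectral_projection_upper[OF ctx f upper]) simp_all
      show "norm_sq M (op_app M ?Pj v) \<le> norm_sq M v" for v
        by (rule spectral_projection_contraction[OF ctx])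
    qed simp
    then show "\<exists>Pj. typical_projection M J f (2 powr (n * (?H + \<delta>))) (2 powr (- (n * (?H - \<delta>)))) \<eta> Pj" by blast
  qed
qed

section \<open>Typical projections of a joint state and of its marginal, combined\<close>

definition op_rlift :: "('y, 'x) operator \<Rightarrow> ('r \<times> 'y, 'r \<times> 'x) operator" where
  "op_rlift M = (\<lambda>(r, y) (r', x). of_bool (r = r') * M y x)"

lemma op_app_rlift:
  assumes "finite R" "r \<in> R"
  shows "op_app (R \<times> X) (op_rlift M) v (r, y) = op_app X M (\<lambda>x. v (r, x)) y"
proof -
  have "op_app (R \<times> X) (op_rlift M) v (r, y) = (\<Sum>r'\<in>R. of_bool (r = r') * (\<Sum>x\<in>X. M y x * v (r', x)))"
    unfolding op_app_def op_rlift_def sum.cartesian_product' sum_distrib_left by (simp add: mult.assoc)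
  also have "\<dots> = (\<Sum>x\<in>X. M y x * v (r, x))"
    using assms by (subst sum_of_bool(1)) simp_all
  finally show ?thesis by (simp add: op_app_def)
qed

lemma adj_op_mult: "adj (op_mult X M N) = op_mult X (adj N) (adj M)"
  by (simp add: adj_def op_mult_def mult.commute)

text \<open>A contraction does not enlarge the distance between \<open>f\<close> and
  \<open>g\<close>, so the errors of successive nearly trivial operators simply add up.\<close>

lemma family_close_trans:
  assumes "\<And>v. norm_sq X (op_app X M v) \<le> norm_sq X v"
  shows "sqrt (\<Sum>j\<in>J. norm_sq X (\<lambda>x. f j x - op_app X M (g j) x))
    \<le> sqrt (\<Sum>j\<in>J. norm_sq X (\<lambda>x. f j x - op_app X M (f j) x)) + sqrt (\<Sum>j\<in>J. norm_sq X (\<lambda>x. f j x - g j x))"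
proof -
  have "sqrt (\<Sum>j\<in>J. norm_sq X (\<lambda>x. f j x - op_app X M (g j) x))
    \<le> sqrt (\<Sum>j\<in>J. norm_sq X (\<lambda>x. f j x - op_app X M (f j) x))
      + sqrt (\<Sum>j\<in>J. norm_sq X (\<lambda>x. (f j x - op_app X M (g j) x) - (f j x - op_app X M (f j) x)))"
    by (rule norm_sq_family_triangle_diff)
  also have "(\<Sum>j\<in>J. norm_sq X (\<lambda>x. (f j x - op_app X M (g j) x) - (f j x - op_app X M (f j) x)))
    = (\<Sum>j\<in>J. norm_sq X (op_app X M (\<lambda>x. f j x - g j x)))"
    by (simp add: op_app_diff)
  also have "sqrt \<dots> \<le> sqrt (\<Sum>j\<in>J. norm_sq X (\<lambda>x. f j x - g j x))"
    by (intro real_sqrt_le_mono sum_mono assms)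
  finally show ?thesis by simp
qed

context
  fixes R :: "'r set" and X :: "'x set" and J :: "'j set" and f :: "'j \<Rightarrow> 'r \<times> 'x \<Rightarrow> complex"
    and F :: "('r \<times> 'x, 'r \<times> 'x) operator" and G :: "('x, 'x) operator" and \<mu>1 \<nu>1 \<mu>2 \<nu>2 t :: real
  assumes R: "finite R" and t: "0 \<le> t"
    and F: "typical_projection (R \<times> X) J f \<mu>1 \<nu>1 (t\<^sup>2) F"
    and G: "typical_projection X (R \<times> J) (\<lambda>(r, j) x. f j (r, x)) \<mu>2 \<nu>2 (t\<^sup>2) G"
    and nonneg: "0 \<le> \<mu>1" "0 \<le> \<nu>1"
begin

abbreviation (input) "GR \<equiv> op_rlift G :: ('r \<times> 'x, 'r \<times> 'x) operator"

lemmas typical_F = F[unfolded typical_projection_def]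
lemmas typical_G = G[unfolded typical_projection_def]

lemma norm_sq_GR: "norm_sq (R \<times> X) (op_app (R \<times> X) GR v) = (\<Sum>r\<in>R. norm_sq X (op_app X G (\<lambda>x. v (r, x))))"
  unfolding norm_sq_Times' by (intro sum.cong refl norm_sq_cong) (simp add: op_app_rlift[OF R])

lemma GR_contraction: "norm_sq (R \<times> X) (op_app (R \<times> X) GR v) \<le> norm_sq (R \<times> X) v"
  unfolding norm_sq_GR norm_sq_Times'[of R X v] using typical_G by (intro sum_mono) blast

lemma F_contraction: "norm_sq (R \<times> X) (op_app (R \<times> X) F v) \<le> norm_sq (R \<times> X) v"
  using typical_F by blast

lemma adj_GR: "adj GR = GR"
proof -
  have "cnj (G y x) = G x y" for x y using typical_G by (metis adj_def)
  then show ?thesis by (auto simp: adj_def op_rlift_def fun_eq_iff of_bool_def)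
qed

lemma GR_close: "sqrt (\<Sum>j\<in>J. norm_sq (R \<times> X) (\<lambda>x. f j x - op_app (R \<times> X) GR (f j) x)) \<le> t"
proof -
  have "(\<Sum>j\<in>J. norm_sq (R \<times> X) (\<lambda>x. f j x - op_app (R \<times> X) GR (f j) x))
    = (\<Sum>j\<in>J. \<Sum>r\<in>R. norm_sq X (\<lambda>x. f j (r, x) - op_app X G (\<lambda>x. f j (r, x)) x))"
    unfolding norm_sq_Times' by (intro sum.cong refl norm_sq_cong) (simp add: op_app_rlift[OF R])
  also have "\<dots> = (\<Sum>r\<in>R. \<Sum>j\<in>J. norm_sq X (\<lambda>x. f j (r, x) - op_app X G (\<lambda>x. f j (r, x)) x))"
    by (rule sum.swap)
  also have "\<dots> \<le> t\<^sup>2" using typical_G by (simp add: sum.cartesian_product')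
  finally show ?thesis using t by (intro real_le_lsqrt) (auto intro!: sum_nonneg)
qed

lemma F_close: "sqrt (\<Sum>j\<in>J. norm_sq (R \<times> X) (\<lambda>x. f j x - op_app (R \<times> X) F (f j) x)) \<le> t"
  using typical_F t by (intro real_le_lsqrt) (auto intro!: sum_nonneg)

lemma GF_contraction: "norm_sq (R \<times> X) (op_app (R \<times> X) (op_mult (R \<times> X) GR F) v) \<le> norm_sq (R \<times> X) v"
  unfolding op_app_mult by (rule order_trans[OF GR_contraction F_contraction])

lemma FG_contraction: "norm_sq (R \<times> X) (op_app (R \<times> X) (op_mult (R \<times> X) F GR) v) \<le> norm_sq (R \<times> X) v"
  unfolding op_app_mult by (rule order_trans[OF F_contraction GR_contraction])

lemma GF_close: "sqrt (\<Sum>j\<in>J. norm_sq (R \<times> X) (\<lambda>x. f j x - op_app (R \<times> X) (op_mult (R \<times> X) GR F) (f j) x)) \<le> 2 * t"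
  using family_close_trans[where X = "R \<times> X" and M = GR and J = J and f = f and g = "\<lambda>j. op_app (R \<times> X) F (f j)", OF GR_contraction] GR_close F_close
  unfolding op_app_mult by linarith

text \<open>Four projections are applied in a row, each of which moves \<open>f\<close> by at most
  \<open>t\<close>.\<close>

lemma FG_close:
  "sqrt (\<Sum>j\<in>J. norm_sq (R \<times> X) (\<lambda>x. f j x - op_app (R \<times> X) (adj (op_mult (R \<times> X) F GR))
     (op_app (R \<times> X) (op_mult (R \<times> X) F GR) (f j)) x)) \<le> 4 * t"
proof -
  have "adj F = F" using typical_F by blast
  then show ?thesis
    using family_close_trans[where X = "R \<times> X" and M = GR and J = J and f = f and g = "\<lambda>j. op_app (R \<times> X) F (op_app (R \<times> X) F (op_app (R \<times> X) GR (f j)))", OF GR_contraction]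
      family_close_trans[where X = "R \<times> X" and M = F and J = J and f = f and g = "\<lambda>j. op_app (R \<times> X) F (op_app (R \<times> X) GR (f j))", OF F_contraction]
      family_close_trans[where X = "R \<times> X" and M = F and J = J and f = f and g = "\<lambda>j. op_app (R \<times> X) GR (f j)", OF F_contraction] GR_close F_close
    unfolding adj_op_mult adj_GR op_app_mult by simp
qed

text \<open>In operator form, \<open>F \<rho> F \<le> \<nu>1\<close> and
  \<open>G\<^sup>2 \<le> \<mu>2 \<rho>\<^sub>X\<close> give \<open>GR F \<rho> F GR \<le> \<nu>1
  \<mu>2 (1 \<otimes> \<rho>\<^sub>X)\<close>. The first bound requires \<open>F\<close> next to
  \<open>\<rho>\<close>, which fixes the order of the product. The row \<open>d\<close> is arbitrary
  since it will come from an unknown decoding.\<close>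

lemma GF_bound:
  "(\<Sum>j\<in>J. (cmod (\<Sum>x\<in>R \<times> X. d x * op_app (R \<times> X) (op_mult (R \<times> X) GR F) (f j) x))\<^sup>2)
    \<le> \<nu>1 * \<mu>2 * (\<Sum>r\<in>R. \<Sum>j\<in>R \<times> J. (cmod (\<Sum>x\<in>X. d (r, x) * (case j of (r, j) \<Rightarrow> \<lambda>x. f j (r, x)) x))\<^sup>2)"
proof -
  let ?s = "\<lambda>j. \<Sum>x\<in>R \<times> X. d x * op_app (R \<times> X) (op_mult (R \<times> X) GR F) (f j) x"
  let ?d = "\<lambda>x. cnj (d x)"
  have "?s j
    = ip (R \<times> X) (op_app (R \<times> X) F (op_app (R \<times> X) GR ?d)) (f j)" for j
  proof -
    have "adj F = F" using typical_F by blast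
    have "?s j
      = ip (R \<times> X) ?d (op_app (R \<times> X) GR (op_app (R \<times> X) F (f j)))"
      by (simp add: ip_def op_app_mult)
    also have "\<dots> = ip (R \<times> X) (op_app (R \<times> X) GR ?d) (op_app (R \<times> X) F (f j))"
      by (subst ip_op_app) (simp only: adj_GR)
    also have "\<dots> = ip (R \<times> X) (op_app (R \<times> X) F (op_app (R \<times> X) GR ?d)) (f j)"
      by (subst ip_op_app) (simp only: \<open>adj F = F\<close>)
    finally show ?thesis .
  qed
  then have "(\<Sum>j\<in>J. (cmod (?s j))\<^sup>2)
    \<le> \<nu>1 * norm_sq (R \<times> X) (op_app (R \<times> X) GR ?d)"
    using typical_F by simp
  also have "\<dots> \<le> \<nu>1 * (\<Sum>r\<in>R. \<mu>2 * (\<Sum>j\<in>R \<times> J. (cmod (ip X (\<lambda>x. ?d (r, x)) ((\<lambda>(r, j) x. f j (r, x)) j)))\<^sup>2))"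
    unfolding norm_sq_GR using typical_G nonneg by (intro mult_left_mono sum_mono) blast+
  also have "\<dots> = \<nu>1 * \<mu>2 * (\<Sum>r\<in>R. \<Sum>j\<in>R \<times> J. (cmod (\<Sum>x\<in>X. d (r, x) * (case j of (r, j) \<Rightarrow> \<lambda>x. f j (r, x)) x))\<^sup>2)"
    by (simp add: ip_def sum_distrib_left mult.assoc)
  finally show ?thesis .
qed

text \<open>Here \<open>F\<close> has to act last: by \<open>F\<^sup>2 \<le> \<mu>1 \<rho>\<close>,
  the sum over the basis of \<open>R\<close> produces \<open>\<rho>\<^sub>X\<close> between two
  copies of \<open>G\<close>, and \<open>G \<rho>\<^sub>X G \<le> \<nu>2\<close> finishes.\<close>

lemma FG_bound:
  "(\<Sum>r\<in>R. norm_sq (R \<times> X) (op_app (R \<times> X) (op_mult (R \<times> X) F GR) (\<lambda>(r', x). of_bool (r = r') * k x)))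
    \<le> \<mu>1 * \<nu>2 * norm_sq X k"
proof -
  let ?k = "op_app X G k"
  have GR: "op_app (R \<times> X) F (op_app (R \<times> X) GR (\<lambda>(r', x). of_bool (r = r') * k x)) = op_app (R \<times> X) F (\<lambda>(r', x). of_bool (r = r') * ?k x)" for r
    by (rule op_app_cong) (auto simp: op_app_rlift[OF R] op_app_scale)
  have ip: "ip (R \<times> X) (\<lambda>(r', x). of_bool (r = r') * ?k x) (f j) = ip X ?k (\<lambda>x. f j (r, x))" if "r \<in> R" for r j
  proof -
    have "ip (R \<times> X) (\<lambda>(r', x). of_bool (r = r') * ?k x) (f j) = (\<Sum>r'\<in>R. of_bool (r = r') * (\<Sum>x\<in>X. cnj (?k x) * f j (r', x)))"
      unfolding ip_def sum.cartesian_product' sum_distrib_left by (intro sum.cong refl) (simp add: of_bool_def)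
    also have "\<dots> = ip X ?k (\<lambda>x. f j (r, x))" using that R by (subst sum_of_bool(1)) (simp_all add: ip_def)
    finally show ?thesis .
  qed
  have "(\<Sum>r\<in>R. norm_sq (R \<times> X) (op_app (R \<times> X) (op_mult (R \<times> X) F GR) (\<lambda>(r', x). of_bool (r = r') * k x)))
    \<le> (\<Sum>r\<in>R. \<mu>1 * (\<Sum>j\<in>J. (cmod (ip (R \<times> X) (\<lambda>(r', x). of_bool (r = r') * ?k x) (f j)))\<^sup>2))"
    unfolding op_app_mult GR using typical_F by (intro sum_mono) blast
  also have "\<dots> = \<mu>1 * (\<Sum>r\<in>R. \<Sum>j\<in>J. (cmod (ip X ?k (\<lambda>x. f j (r, x))))\<^sup>2)"
    unfolding sum_distrib_left by (intro sum.cong refl) (simp only: ip)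
  also have "\<dots> = \<mu>1 * (\<Sum>j\<in>R \<times> J. (cmod (ip X ?k ((\<lambda>(r, j) x. f j (r, x)) j)))\<^sup>2)"
    by (simp add: sum.cartesian_product')
  also have "\<dots> \<le> \<mu>1 * (\<nu>2 * norm_sq X k)"
    using typical_G nonneg by (intro mult_left_mono) blast+
  finally show ?thesis by (simp add: mult.assoc)
qed

end

section \<open>Many copies\<close>

lemma sum_prod_nlists3:
  fixes g :: "nat \<Rightarrow> 'x \<Rightarrow> 'y \<Rightarrow> 'z \<Rightarrow> 'a::comm_semiring_1"
  assumes "finite A" "finite B" "finite C"
  shows "(\<Sum>xs\<in>nlists n A. \<Sum>ys\<in>nlists n B. \<Sum>zs\<in>nlists n C. \<Prod>i<n. g i (xs ! i) (ys ! i) (zs ! i))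
    = (\<Prod>i<n. \<Sum>x\<in>A. \<Sum>y\<in>B. \<Sum>z\<in>C. g i x y z)"
proof -
  have "(\<Sum>ys\<in>nlists n B. \<Sum>zs\<in>nlists n C. \<Prod>i<n. g i (xs ! i) (ys ! i) (zs ! i))
    = (\<Prod>i<n. \<Sum>y\<in>B. \<Sum>z\<in>C. g i (xs ! i) y z)" for xs
    by (rule sum_prod_nlists2[OF assms(2,3)])
  then show ?thesis using sum_prod_nlists[OF assms(1), of "\<lambda>i x. \<Sum>y\<in>B. \<Sum>z\<in>C. g i x y z"] by simp
qed

lemma sum_prod_nlists4:
  fixes g :: "nat \<Rightarrow> 'x \<Rightarrow> 'y \<Rightarrow> 'z \<Rightarrow> 'w \<Rightarrow> 'a::comm_semiring_1"
  assumes "finite A" "finite B" "finite C" "finite D"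
  shows "(\<Sum>xs\<in>nlists n A. \<Sum>ys\<in>nlists n B. \<Sum>zs\<in>nlists n C. \<Sum>ws\<in>nlists n D. \<Prod>i<n. g i (xs ! i) (ys ! i) (zs ! i) (ws ! i))
    = (\<Prod>i<n. \<Sum>x\<in>A. \<Sum>y\<in>B. \<Sum>z\<in>C. \<Sum>w\<in>D. g i x y z w)"
proof -
  have "(\<Sum>ys\<in>nlists n B. \<Sum>zs\<in>nlists n C. \<Sum>ws\<in>nlists n D. \<Prod>i<n. g i (xs ! i) (ys ! i) (zs ! i) (ws ! i))
    = (\<Prod>i<n. \<Sum>y\<in>B. \<Sum>z\<in>C. \<Sum>w\<in>D. g i (xs ! i) y z w)" for xs
    by (rule sum_prod_nlists3[OF assms(2-4)])
  then show ?thesis using sum_prod_nlists[OF assms(1), of "\<lambda>i x. \<Sum>y\<in>B. \<Sum>z\<in>C. \<Sum>w\<in>D. g i x y z w"] by simp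
qed

lemma info_R_C_given_B_eq:
  fixes \<Psi> :: "('r::finite, 'a::finite, 'b::finite, 'c::finite) rabc_op"
  defines "\<rho>RCB \<equiv> marg_RCB UNIV \<Psi>"
  defines "\<rho>RB \<equiv> \<lambda>(r, b) (r', b'). \<Sum>c\<in>UNIV. \<rho>RCB (r, c, b) (r', c, b')"
  shows "info_R_C_given_B \<Psi> = entropy UNIV (ptrace_fst UNIV \<rho>RCB) - entropy UNIV \<rho>RCB
    - entropy UNIV (ptrace_fst UNIV \<rho>RB) + entropy UNIV \<rho>RB"
proof -
  have "ptrace_snd (UNIV \<times> UNIV) \<rho>RCB = ptrace_snd UNIV \<rho>RB"
    unfolding ptrace_snd_def \<rho>RB_def sum.cartesian_product' by (intro ext) (simp, rule sum.swap)
  then show ?thesis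
    unfolding info_R_C_given_B_def cond_mutual_info_def mutual_info_def \<rho>RCB_def[symmetric] \<rho>RB_def[symmetric]
    by (simp add: ptrace_snd_def)
qed

definition power_branch ::
  "nat \<Rightarrow> (nat \<Rightarrow> 'r \<times> 'a \<times> 'b \<times> 'c \<Rightarrow> complex) \<Rightarrow> nat list \<Rightarrow> 'r list \<times> 'a list \<times> 'b list \<times> 'c list \<Rightarrow> complex" where
  "power_branch n \<phi> es = (\<lambda>(rs, as, bs, cs). \<Prod>i<n. \<phi> (es ! i) (rs ! i, as ! i, bs ! i, cs ! i))"

section \<open>Branches and marginals of the tensor power\<close>

context
  fixes \<Psi> :: "('r::finite, 'a::finite, 'b::finite, 'c::finite) rabc_op" and \<phi> and d :: nat
  assumes \<phi>: "gram UNIV {..<d} \<phi> \<Psi>" and tr: "op_trace UNIV \<Psi> = 1"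
begin

abbreviation (input) "\<rho>RCB \<equiv> marg_RCB UNIV \<Psi>"
abbreviation (input) "\<rho>RB \<equiv> (\<lambda>(r, b) (r', b'). \<Sum>c\<in>UNIV. \<rho>RCB (r, c, b) (r', c, b'))"

lemma Psi_eq: "\<Psi> x y = (\<Sum>k<d. \<phi> k x * cnj (\<phi> k y))"
  using \<phi> unfolding gram_def by blast

lemma RCB_eq: "\<rho>RCB (r, c, b) (r', c', b') = (\<Sum>a\<in>UNIV. \<Sum>k<d. \<phi> k (r, a, b, c) * cnj (\<phi> k (r', a, b', c')))"
  by (simp add: marg_RCB_def Psi_eq)

lemma RB_eq: "\<rho>RB (r, b) (r', b') = (\<Sum>a\<in>UNIV. \<Sum>c\<in>UNIV. \<Sum>k<d. \<phi> k (r, a, b, c) * cnj (\<phi> k (r', a, b', c)))"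
  by (simp add: RCB_eq) (rule sum.swap)

lemma CB_eq: "ptrace_fst UNIV \<rho>RCB (c, b) (c', b')
    = (\<Sum>r\<in>UNIV. \<Sum>a\<in>UNIV. \<Sum>k<d. \<phi> k (r, a, b, c) * cnj (\<phi> k (r, a, b', c')))"
  by (simp add: ptrace_fst_def RCB_eq)

lemma B_eq: "ptrace_fst UNIV \<rho>RB b b'
    = (\<Sum>r\<in>UNIV. \<Sum>a\<in>UNIV. \<Sum>c\<in>UNIV. \<Sum>k<d. \<phi> k (r, a, b, c) * cnj (\<phi> k (r, a, b', c)))"
  using RB_eq by (simp add: ptrace_fst_def)

lemma gram_tensor_pow:
  "gram (nlists n UNIV \<times> nlists n UNIV \<times> nlists n UNIV \<times> nlists n UNIV) (nlists n {..<d}) (power_branch n \<phi>) (tensor_pow n \<Psi>)"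
proof -
  have "tensor_pow n \<Psi> x y = (\<Sum>es\<in>nlists n {..<d}. power_branch n \<phi> es x * cnj (power_branch n \<phi> es y))" for x y
  proof -
    obtain rs as bs cs rs' as' bs' cs' where xy: "x = (rs, as, bs, cs)" "y = (rs', as', bs', cs')" by (cases x; cases y)
    have "(\<Sum>es\<in>nlists n {..<d}. power_branch n \<phi> es x * cnj (power_branch n \<phi> es y))
      = (\<Sum>es\<in>nlists n {..<d}. \<Prod>i<n. \<phi> (es ! i) (rs ! i, as ! i, bs ! i, cs ! i) * cnj (\<phi> (es ! i) (rs' ! i, as' ! i, bs' ! i, cs' ! i)))"
      by (simp add: power_branch_def xy cnj_prod prod.distrib)
    also have "\<dots> = (\<Prod>i<n. \<Sum>k<d. \<phi> k (rs ! i, as ! i, bs ! i, cs ! i) * cnj (\<phi> k (rs' ! i, as' ! i, bs' ! i, cs' ! i)))"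
      by (rule sum_prod_nlists) simp
    finally show ?thesis by (simp add: tensor_pow_def xy Psi_eq)
  qed
  then show ?thesis by (simp add: gram_def)
qed

lemma trace_sum: "(\<Sum>r\<in>UNIV. \<Sum>a\<in>UNIV. \<Sum>b\<in>UNIV. \<Sum>c\<in>UNIV. \<Psi> (r, a, b, c) (r, a, b, c)) = 1"
  using tr unfolding op_trace_def UNIV_Times_UNIV[symmetric] sum.cartesian_product' .

lemma power_branch_1:
  "(\<Sum>es\<in>nlists n {..<d}. norm_sq (nlists n UNIV \<times> nlists n UNIV \<times> nlists n UNIV \<times> nlists n UNIV) (power_branch n \<phi> es)) = 1"
proof -
  let ?U = "nlists n UNIV"
  have "op_trace (?U \<times> ?U \<times> ?U \<times> ?U) (tensor_pow n \<Psi>)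
    = (\<Sum>rs\<in>?U. \<Sum>as\<in>?U. \<Sum>bs\<in>?U. \<Sum>cs\<in>?U. \<Prod>i<n. \<Psi> (rs ! i, as ! i, bs ! i, cs ! i) (rs ! i, as ! i, bs ! i, cs ! i))"
    unfolding op_trace_def sum.cartesian_product' by (simp add: tensor_pow_def)
  also have "\<dots> = (\<Prod>i<n. \<Sum>r\<in>UNIV. \<Sum>a\<in>UNIV. \<Sum>b\<in>UNIV. \<Sum>c\<in>UNIV. \<Psi> (r, a, b, c) (r, a, b, c))"
    by (rule sum_prod_nlists4[where g = "\<lambda>i r a b c. \<Psi> (r, a, b, c) (r, a, b, c)"]) simp_all
  also have "\<dots> = 1" by (simp add: trace_sum)
  finally show ?thesis unfolding gram_trace[OF gram_tensor_pow] by (simp only: of_real_eq_1_iff)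
qed

lemma gram_branch_RCB:
  "gram (nlists n UNIV \<times> nlists n UNIV \<times> nlists n UNIV) (nlists n UNIV \<times> nlists n {..<d})
    (\<lambda>(as, es) (rs, cs, bs). power_branch n \<phi> es (rs, as, bs, cs))
    (\<lambda>l l'. \<Prod>i<n. \<rho>RCB ((\<lambda>(xs, ys, zs) i. (xs ! i, ys ! i, zs ! i)) l i) ((\<lambda>(xs, ys, zs) i. (xs ! i, ys ! i, zs ! i)) l' i))"
  unfolding gram_def
proof (intro ballI, clarify)
  fix rs cs bs rs' cs' bs'
  let ?t = "\<lambda>i a k. \<phi> k (rs ! i, a, bs ! i, cs ! i) * cnj (\<phi> k (rs' ! i, a, bs' ! i, cs' ! i))"
  have "(\<Prod>i<n. \<Sum>a\<in>UNIV. \<Sum>k<d. ?t i a k) = (\<Sum>as\<in>nlists n UNIV. \<Sum>es\<in>nlists n {..<d}. \<Prod>i<n. ?t i (as ! i) (es ! i))"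
    by (rule sum_prod_nlists2[symmetric]) simp_all
  then show "(\<Prod>i<n. \<rho>RCB (rs ! i, cs ! i, bs ! i) (rs' ! i, cs' ! i, bs' ! i))
    = (\<Sum>j\<in>nlists n UNIV \<times> nlists n {..<d}. (case j of (as, es) \<Rightarrow> \<lambda>(rs, cs, bs). power_branch n \<phi> es (rs, as, bs, cs)) (rs, cs, bs)
      * cnj ((case j of (as, es) \<Rightarrow> \<lambda>(rs, cs, bs). power_branch n \<phi> es (rs, as, bs, cs)) (rs', cs', bs')))"
    unfolding sum.cartesian_product' by (simp add: RCB_eq power_branch_def cnj_prod prod.distrib)
qed

lemma gram_branch_CB:
  "gram (nlists n UNIV \<times> nlists n UNIV) (nlists n UNIV \<times> nlists n UNIV \<times> nlists n {..<d})
    (\<lambda>(rs, as, es) (cs, bs). power_branch n \<phi> es (rs, as, bs, cs))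
    (\<lambda>l l'. \<Prod>i<n. ptrace_fst UNIV \<rho>RCB ((\<lambda>(xs, ys) i. (xs ! i, ys ! i)) l i) ((\<lambda>(xs, ys) i. (xs ! i, ys ! i)) l' i))"
  unfolding gram_def
proof (intro ballI, clarify)
  fix cs bs cs' bs'
  let ?t = "\<lambda>i r a k. \<phi> k (r, a, bs ! i, cs ! i) * cnj (\<phi> k (r, a, bs' ! i, cs' ! i))"
  have "(\<Prod>i<n. \<Sum>r\<in>UNIV. \<Sum>a\<in>UNIV. \<Sum>k<d. ?t i r a k)
    = (\<Sum>rs\<in>nlists n UNIV. \<Sum>as\<in>nlists n UNIV. \<Sum>es\<in>nlists n {..<d}. \<Prod>i<n. ?t i (rs ! i) (as ! i) (es ! i))"
    by (rule sum_prod_nlists3[symmetric]) simp_all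
  then show "(\<Prod>i<n. ptrace_fst UNIV \<rho>RCB (cs ! i, bs ! i) (cs' ! i, bs' ! i))
    = (\<Sum>j\<in>nlists n UNIV \<times> nlists n UNIV \<times> nlists n {..<d}. (case j of (rs, as, es) \<Rightarrow> \<lambda>(cs, bs). power_branch n \<phi> es (rs, as, bs, cs)) (cs, bs)
      * cnj ((case j of (rs, as, es) \<Rightarrow> \<lambda>(cs, bs). power_branch n \<phi> es (rs, as, bs, cs)) (cs', bs')))"
    unfolding sum.cartesian_product' by (simp add: CB_eq power_branch_def cnj_prod prod.distrib)
qed

lemma gram_branch_RB:
  "gram (nlists n UNIV \<times> nlists n UNIV) (nlists n UNIV \<times> nlists n UNIV \<times> nlists n {..<d})
    (\<lambda>(as, cs, es) (rs, bs). power_branch n \<phi> es (rs, as, bs, cs))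
    (\<lambda>l l'. \<Prod>i<n. \<rho>RB ((\<lambda>(xs, ys) i. (xs ! i, ys ! i)) l i) ((\<lambda>(xs, ys) i. (xs ! i, ys ! i)) l' i))"
  unfolding gram_def
proof (intro ballI, clarify)
  fix rs bs rs' bs'
  let ?t = "\<lambda>i a c k. \<phi> k (rs ! i, a, bs ! i, c) * cnj (\<phi> k (rs' ! i, a, bs' ! i, c))"
  have "(\<Prod>i<n. \<Sum>a\<in>UNIV. \<Sum>c\<in>UNIV. \<Sum>k<d. ?t i a c k)
    = (\<Sum>as\<in>nlists n UNIV. \<Sum>cs\<in>nlists n UNIV. \<Sum>es\<in>nlists n {..<d}. \<Prod>i<n. ?t i (as ! i) (cs ! i) (es ! i))"
    by (rule sum_prod_nlists3[symmetric]) simp_all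
  also have "\<dots> = (\<Sum>j\<in>nlists n UNIV \<times> nlists n UNIV \<times> nlists n {..<d}. (case j of (as, cs, es) \<Rightarrow> \<lambda>(rs, bs). power_branch n \<phi> es (rs, as, bs, cs)) (rs, bs)
      * cnj ((case j of (as, cs, es) \<Rightarrow> \<lambda>(rs, bs). power_branch n \<phi> es (rs, as, bs, cs)) (rs', bs')))"
    unfolding sum.cartesian_product' by (simp add: power_branch_def cnj_prod prod.distrib)
  finally have key: "(\<Prod>i<n. \<rho>RB (rs ! i, bs ! i) (rs' ! i, bs' ! i))
    = (\<Sum>j\<in>nlists n UNIV \<times> nlists n UNIV \<times> nlists n {..<d}. (case j of (as, cs, es) \<Rightarrow> \<lambda>(rs, bs). power_branch n \<phi> es (rs, as, bs, cs)) (rs, bs)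
      * cnj ((case j of (as, cs, es) \<Rightarrow> \<lambda>(rs, bs). power_branch n \<phi> es (rs, as, bs, cs)) (rs', bs')))"
    by (simp only: RB_eq)
  show "(\<Prod>i<n. \<Sum>c\<in>UNIV. \<rho>RCB (rs ! i, c, bs ! i) (rs' ! i, c, bs' ! i))
    = (\<Sum>j\<in>nlists n UNIV \<times> nlists n UNIV \<times> nlists n {..<d}. (case j of (as, cs, es) \<Rightarrow> \<lambda>(rs, bs). power_branch n \<phi> es (rs, as, bs, cs)) (rs, bs)
      * cnj ((case j of (as, cs, es) \<Rightarrow> \<lambda>(rs, bs). power_branch n \<phi> es (rs, as, bs, cs)) (rs', bs')))"
    using key by (simp only: split_conv)
qed

lemma gram_branch_B:
  "gram (nlists n UNIV) (nlists n UNIV \<times> nlists n UNIV \<times> nlists n UNIV \<times> nlists n {..<d})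
    (\<lambda>(rs, as, cs, es) bs. power_branch n \<phi> es (rs, as, bs, cs))
    (\<lambda>l l'. \<Prod>i<n. ptrace_fst UNIV \<rho>RB (l ! i) (l' ! i))"
  unfolding gram_def
proof (intro ballI)
  fix bs bs'
  let ?t = "\<lambda>i r a c k. \<phi> k (r, a, bs ! i, c) * cnj (\<phi> k (r, a, bs' ! i, c))"
  have "(\<Prod>i<n. \<Sum>r\<in>UNIV. \<Sum>a\<in>UNIV. \<Sum>c\<in>UNIV. \<Sum>k<d. ?t i r a c k)
    = (\<Sum>rs\<in>nlists n UNIV. \<Sum>as\<in>nlists n UNIV. \<Sum>cs\<in>nlists n UNIV. \<Sum>es\<in>nlists n {..<d}. \<Prod>i<n. ?t i (rs ! i) (as ! i) (cs ! i) (es ! i))"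
    by (rule sum_prod_nlists4[symmetric]) simp_all
  also have "\<dots> = (\<Sum>j\<in>nlists n UNIV \<times> nlists n UNIV \<times> nlists n UNIV \<times> nlists n {..<d}. (case j of (rs, as, cs, es) \<Rightarrow> \<lambda>bs. power_branch n \<phi> es (rs, as, bs, cs)) bs
      * cnj ((case j of (rs, as, cs, es) \<Rightarrow> \<lambda>bs. power_branch n \<phi> es (rs, as, bs, cs)) bs'))"
    unfolding sum.cartesian_product' by (simp add: power_branch_def cnj_prod prod.distrib)
  finally show "(\<Prod>i<n. ptrace_fst UNIV \<rho>RB (bs ! i) (bs' ! i))
    = (\<Sum>j\<in>nlists n UNIV \<times> nlists n UNIV \<times> nlists n UNIV \<times> nlists n {..<d}. (case j of (rs, as, cs, es) \<Rightarrow> \<lambda>bs. power_branch n \<phi> es (rs, as, bs, cs)) bs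
      * cnj ((case j of (rs, as, cs, es) \<Rightarrow> \<lambda>bs. power_branch n \<phi> es (rs, as, bs, cs)) bs'))"
    by (simp only: B_eq)
qed

lemma marginals_positive:
  "positive_op UNIV \<rho>RCB" "positive_op UNIV (ptrace_fst UNIV \<rho>RCB)" "positive_op UNIV \<rho>RB" "positive_op UNIV (ptrace_fst UNIV \<rho>RB)"
proof -
  have "gram UNIV (UNIV \<times> {..<d}) (\<lambda>(a, k) (r, c, b). \<phi> k (r, a, b, c)) \<rho>RCB"
    unfolding gram_def by (simp only: split_paired_all split_conv RCB_eq sum.cartesian_product' ball_UNIV split_paired_All) simp
  then show "positive_op UNIV \<rho>RCB" by (rule gram_positive)
  have "gram UNIV (UNIV \<times> UNIV \<times> {..<d}) (\<lambda>(r, a, k) (c, b). \<phi> k (r, a, b, c)) (ptrace_fst UNIV \<rho>RCB)"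
    unfolding gram_def by (simp only: split_conv CB_eq sum.cartesian_product' ball_UNIV split_paired_All) simp
  then show "positive_op UNIV (ptrace_fst UNIV \<rho>RCB)" by (rule gram_positive)
  have "gram UNIV (UNIV \<times> UNIV \<times> {..<d}) (\<lambda>(a, c, k) (r, b). \<phi> k (r, a, b, c)) \<rho>RB"
    unfolding gram_def by (simp only: RB_eq sum.cartesian_product' ball_UNIV split_paired_All) simp
  then show "positive_op UNIV \<rho>RB" by (rule gram_positive)
  have "gram UNIV (UNIV \<times> UNIV \<times> UNIV \<times> {..<d}) (\<lambda>(r, a, c, k) b. \<phi> k (r, a, b, c)) (ptrace_fst UNIV \<rho>RB)"
    unfolding gram_def by (simp only: B_eq sum.cartesian_product' ball_UNIV) simp
  then show "positive_op UNIV (ptrace_fst UNIV \<rho>RB)" by (rule gram_positive)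
qed

lemma marginals_trace:
  "op_trace UNIV \<rho>RCB = 1" "op_trace UNIV (ptrace_fst UNIV \<rho>RCB) = 1" "op_trace UNIV \<rho>RB = 1" "op_trace UNIV (ptrace_fst UNIV \<rho>RB) = 1"
proof -
  let ?p = "\<lambda>r a b c. \<Psi> (r, a, b, c) (r, a, b, c)"
  have total: "(\<Sum>(r, a, b, c)\<in>UNIV. ?p r a b c) = 1"
    using tr by (simp add: op_trace_def split_def)
  have "op_trace UNIV \<rho>RCB = (\<Sum>((r, c, b), a)\<in>UNIV \<times> UNIV. ?p r a b c)"
    by (simp add: op_trace_def marg_RCB_def sum.cartesian_product split_def)
  also have "\<dots> = (\<Sum>(r, a, b, c)\<in>UNIV. ?p r a b c)"
    by (rule sum.reindex_bij_witness[of _ "\<lambda>(r, a, b, c). ((r, c, b), a)" "\<lambda>((r, c, b), a). (r, a, b, c)"]) auto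
  finally show RCB: "op_trace UNIV \<rho>RCB = 1" using total by simp
  have "op_trace UNIV (ptrace_fst UNIV \<rho>RCB) = op_trace UNIV \<rho>RCB"
    unfolding op_trace_def ptrace_fst_def UNIV_Times_UNIV[symmetric] sum.cartesian_product'[of _ "UNIV :: 'r set"]
    by (rule sum.swap)
  with RCB show "op_trace UNIV (ptrace_fst UNIV \<rho>RCB) = 1" by simp
  have "op_trace UNIV \<rho>RB = (\<Sum>((r, b), c)\<in>UNIV \<times> UNIV. \<rho>RCB (r, c, b) (r, c, b))"
    by (simp add: op_trace_def sum.cartesian_product split_def)
  also have "\<dots> = op_trace UNIV \<rho>RCB"
    unfolding op_trace_def
    by (rule sum.reindex_bij_witness[of _ "\<lambda>(r, c, b). ((r, b), c)" "\<lambda>((r, b), c). (r, c, b)"]) auto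
  finally show RB: "op_trace UNIV \<rho>RB = 1" using RCB by simp
  have "op_trace UNIV (ptrace_fst UNIV \<rho>RB) = op_trace UNIV \<rho>RB"
    unfolding op_trace_def ptrace_fst_def UNIV_Times_UNIV[symmetric] sum.cartesian_product'[of _ "UNIV :: 'r set"]
    by (rule sum.swap)
  with RB show "op_trace UNIV (ptrace_fst UNIV \<rho>RB) = 1" by simp
qed

end

section \<open>The choice of the constants and the theorem\<close>

lemma Max_messages_le: "real (Max (messages M) - 1) \<le> 2 powr M"
proof -
  let ?K = "max 1 (nat \<lfloor>2 powr M\<rfloor>)"
  have "Max (messages M) = ?K" unfolding messages_def by (intro Max_eqI) auto
  moreover have "real (nat \<lfloor>2 powr M\<rfloor>) \<le> 2 powr M" by simp
  moreover have "0 \<le> 2 powr M" by simp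
  \<comment> \<open>Where \<open>2 powr M < 1\<close> there is still one message, and it is the
    subtraction of 1 that saves the bound.\<close>
  ultimately show ?thesis by (simp add: max_def of_nat_diff split: if_splits) linarith
qed

text \<open>The six projections, two in \<open>N\<close> and four in
  \<open>L\<^sup>\<dagger> L\<close>, cost \<open>6 * t\<close>; \<open>t \<le> c / 6\<close> keeps
  \<open>s\<close> nonnegative, and \<open>t \<le> \<epsilon>\<^sup>2 / 12\<close> gives
  \<open>1 - s\<^sup>2 \<le> 2 * \<epsilon>\<^sup>2\<close>. By
  \<open>(x + y)\<^sup>2 \<le> 2 * (x\<^sup>2 + y\<^sup>2)\<close> the error is at most
  \<open>4 * \<epsilon>\<^sup>2 + 6 * sqrt E\<close>, and
  \<open>sqrt E \<le> \<epsilon>\<^sup>2 / 2\<close> makes this at most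
  \<open>7 * \<epsilon>\<^sup>2\<close>.\<close>

lemma error_bound:
  fixes \<epsilon> :: real
  assumes "0 < \<epsilon>" "\<epsilon> < 1"
  defines "c \<equiv> sqrt (1 - \<epsilon>\<^sup>2)"
  defines "t \<equiv> min (\<epsilon>\<^sup>2 / 12) (c / 6)"
  defines "s \<equiv> c - 6 * t"
  assumes E: "0 \<le> E" "E \<le> (\<epsilon>\<^sup>2 / 2)\<^sup>2"
  shows "0 < t" "0 \<le> s" "2 * sqrt E + (sqrt (1 - s\<^sup>2) + sqrt (2 * sqrt E))\<^sup>2 \<le> 8 * \<epsilon>"
proof -
  have e2: "\<epsilon>\<^sup>2 < 1" "\<epsilon>\<^sup>2 \<le> \<epsilon>" using assms(1,2)
    by (simp_all add: power_less_one_iff) (simp add: power2_eq_square mult_left_le)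
  have c: "0 < c" "c \<le> 1" "c\<^sup>2 = 1 - \<epsilon>\<^sup>2" using e2 assms(1) by (simp_all add: c_def)
  show t: "0 < t" using c assms(1) by (simp add: t_def)
  show s: "0 \<le> s" by (simp add: s_def t_def min_def)
  have "s\<^sup>2 = c\<^sup>2 - 12 * t * c + 36 * t\<^sup>2" by (simp add: s_def power2_eq_square algebra_simps)
  then have "1 - s\<^sup>2 = \<epsilon>\<^sup>2 + 12 * t * c - 36 * t\<^sup>2" using c(3) by linarith
  also have "\<dots> \<le> \<epsilon>\<^sup>2 + 12 * t * 1"
  proof -
    have "12 * t * c \<le> 12 * t * 1" using c t by (intro mult_left_mono) auto
    then show ?thesis using zero_le_power2[of t] by linarith
  qed
  also have "\<dots> \<le> 2 * \<epsilon>\<^sup>2" by (simp add: t_def min_def)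
  finally have a: "1 - s\<^sup>2 \<le> 2 * \<epsilon>\<^sup>2" .
  have sE: "sqrt E \<le> \<epsilon>\<^sup>2 / 2" using E by (intro real_le_lsqrt) auto
  have s1: "0 \<le> 1 - s\<^sup>2"
  proof -
    have "s \<le> 1" using c t by (simp add: s_def)
    then show ?thesis using s by (simp add: power_le_one)
  qed
  have sq: "(x + y)\<^sup>2 \<le> 2 * (x\<^sup>2 + y\<^sup>2)" for x y :: real
    using zero_le_power2[of "x - y"] by (simp add: power2_eq_square algebra_simps)
  have "(sqrt (1 - s\<^sup>2) + sqrt (2 * sqrt E))\<^sup>2 \<le> 2 * ((sqrt (1 - s\<^sup>2))\<^sup>2 + (sqrt (2 * sqrt E))\<^sup>2)"
    by (rule sq)
  also have "\<dots> = 2 * (1 - s\<^sup>2 + 2 * sqrt E)" using s1 E by simp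
  finally have square: "(sqrt (1 - s\<^sup>2) + sqrt (2 * sqrt E))\<^sup>2 \<le> 2 * (1 - s\<^sup>2 + 2 * sqrt E)" .
  have "2 * sqrt E + 2 * (1 - s\<^sup>2 + 2 * sqrt E) \<le> 7 * \<epsilon>\<^sup>2" using a sE by argo
  with square have "2 * sqrt E + (sqrt (1 - s\<^sup>2) + sqrt (2 * sqrt E))\<^sup>2 \<le> 7 * \<epsilon>\<^sup>2"
    by (meson add_left_mono order_trans)
  also have "\<dots> \<le> 8 * \<epsilon>" using e2 assms(1) by linarith
  finally show "2 * sqrt E + (sqrt (1 - s\<^sup>2) + sqrt (2 * sqrt E))\<^sup>2 \<le> 8 * \<epsilon>" .
qed

lemma exponential_small:
  fixes \<delta> \<beta> :: real
  assumes "0 < \<delta>" "0 < \<beta>"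
  shows "\<exists>n0. \<forall>n\<ge>n0. 2 powr (- (real n * \<delta>)) \<le> \<beta>"
proof -
  obtain n0 where n0: "- log 2 \<beta> / \<delta> \<le> real n0" using real_arch_simple by blast
  show ?thesis
  proof (intro exI[of _ n0] allI impI)
    fix n assume "n0 \<le> n"
    then have "- log 2 \<beta> / \<delta> \<le> real n" using n0 by linarith
    then have "- log 2 \<beta> \<le> real n * \<delta>" unfolding pos_divide_le_eq[OF assms(1)] .
    then have "- (real n * \<delta>) \<le> log 2 \<beta>" by linarith
    then have "2 powr (- (real n * \<delta>)) \<le> 2 powr (log 2 \<beta>)" by simp
    then show "2 powr (- (real n * \<delta>)) \<le> \<beta>" using assms(2) by simp
  qed
qed

theorem theorem11:
  fixes \<Psi> :: "('r::finite, 'a::finite, 'b::finite, 'c::finite) rabc_op"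
    and \<epsilon> \<delta> :: real
  assumes "density_op UNIV \<Psi>"
    and "0 < \<epsilon>" and "\<epsilon> < 1"
    and "0 < \<delta>" and "\<delta> < 1"
  shows "\<exists>n0. \<forall>n\<ge>n0. \<forall>q P.
    qsr_protocol (nlists n UNIV) (nlists n UNIV) (nlists n UNIV) (nlists n UNIV)
      (tensor_pow n \<Psi>) q \<epsilon> P \<longrightarrow>
    (\<forall>N. N \<le> info_R_C_given_B \<Psi> \<longrightarrow>
      (\<exists>S. qsr_simulation (nlists n UNIV) (nlists n UNIV)
             (marg_AC (nlists n UNIV) (nlists n UNIV) (tensor_pow n \<Psi>))
             P (real n * (N - \<delta>)) (8 * \<epsilon>) S))"
proof -
  define d where "d = card (UNIV :: ('r \<times> 'a \<times> 'b \<times> 'c) set)"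
  have pos: "positive_op UNIV \<Psi>" and tr: "op_trace UNIV \<Psi> = 1" using assms(1) by (simp_all add: density_op_def)
  obtain \<phi> where \<phi>: "gram UNIV {..<d} \<phi> \<Psi>"
    using positive_op_gram[OF finite_class.finite_UNIV pos] unfolding d_def by blast
  define RCB where "RCB = marg_RCB UNIV \<Psi>"
  define RB where "RB = (\<lambda>(r, b) (r', b'). \<Sum>c\<in>UNIV. RCB (r, c, b) (r', c, b'))"
  define CB where "CB = ptrace_fst UNIV RCB"
  define Bm where "Bm = ptrace_fst UNIV RB"
  note defs = RCB_def RB_def CB_def Bm_def
  note marg_pos = marginals_positive[OF \<phi> tr, folded RCB_def, folded RB_def CB_def, folded Bm_def]
  note marg_tr = marginals_trace[OF \<phi> tr, folded RCB_def, folded RB_def CB_def, folded Bm_def]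
  have info: "info_R_C_given_B \<Psi> = entropy UNIV CB - entropy UNIV RCB - entropy UNIV Bm + entropy UNIV RB"
    unfolding defs by (rule info_R_C_given_B_eq)
  define c where "c = sqrt (1 - \<epsilon>\<^sup>2)"
  define t where "t = min (\<epsilon>\<^sup>2 / 12) (c / 6)"
  have t: "0 < t" using error_bound(1)[OF assms(2,3), of 0] by (simp add: t_def c_def)
  \<comment> \<open>The atypical weight is a squared distance, hence \<open>t\<^sup>2\<close> for a
    distance of \<open>t\<close> per projection.\<close>
  define \<eta> where "\<eta> = t\<^sup>2"
  have \<eta>: "0 < \<eta>" using t by (simp add: \<eta>_def)
  \<comment> \<open>Each of the four typical bounds in \<open>\<kappa>1 * \<kappa>2\<close> loses a
    factor \<open>2 powr (n * \<gamma>)\<close>, together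
    \<open>2 powr (n * (\<delta> / 2))\<close>; the other half of \<open>\<delta>\<close> makes the
    error decay.\<close>
  define \<gamma> where "\<gamma> = \<delta> / 8"
  have \<gamma>: "0 < \<gamma>" using assms(4) by (simp add: \<gamma>_def)
  \<comment> \<open>One threshold for each of the marginals on \<open>R C B\<close>,
    \<open>C B\<close>, \<open>R B\<close> and \<open>B\<close>, all fixed before the protocol is
    given.\<close>
  obtain n1 where n1: "\<forall>n\<ge>n1. \<forall>(M :: ('r list \<times> 'c list \<times> 'b list) set) co (J :: ('a list \<times> nat list) set) f. power_labels n M co \<longrightarrow>
    gram M J f (\<lambda>l l'. \<Prod>i<n. RCB (co l i) (co l' i)) \<longrightarrow>
    (\<exists>F. typical_projection M J f (2 powr (n * (entropy UNIV RCB + \<gamma>))) (2 powr (- (n * (entropy UNIV RCB - \<gamma>)))) \<eta> F)"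
    using typical_projection_exists[OF marg_pos(1) marg_tr(1) \<gamma> \<eta>] by blast
  obtain n2 where n2: "\<forall>n\<ge>n2. \<forall>(M :: ('c list \<times> 'b list) set) co (J :: ('r list \<times> 'a list \<times> nat list) set) f. power_labels n M co \<longrightarrow>
    gram M J f (\<lambda>l l'. \<Prod>i<n. CB (co l i) (co l' i)) \<longrightarrow>
    (\<exists>F. typical_projection M J f (2 powr (n * (entropy UNIV CB + \<gamma>))) (2 powr (- (n * (entropy UNIV CB - \<gamma>)))) \<eta> F)"
    using typical_projection_exists[OF marg_pos(2) marg_tr(2) \<gamma> \<eta>] by blast
  obtain n3 where n3: "\<forall>n\<ge>n3. \<forall>(M :: ('r list \<times> 'b list) set) co (J :: ('a list \<times> 'c list \<times> nat list) set) f. power_labels n M co \<longrightarrow>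
    gram M J f (\<lambda>l l'. \<Prod>i<n. RB (co l i) (co l' i)) \<longrightarrow>
    (\<exists>F. typical_projection M J f (2 powr (n * (entropy UNIV RB + \<gamma>))) (2 powr (- (n * (entropy UNIV RB - \<gamma>)))) \<eta> F)"
    using typical_projection_exists[OF marg_pos(3) marg_tr(3) \<gamma> \<eta>] by blast
  obtain n4 where n4: "\<forall>n\<ge>n4. \<forall>(M :: 'b list set) co (J :: ('r list \<times> 'a list \<times> 'c list \<times> nat list) set) f. power_labels n M co \<longrightarrow>
    gram M J f (\<lambda>l l'. \<Prod>i<n. Bm (co l i) (co l' i)) \<longrightarrow>
    (\<exists>F. typical_projection M J f (2 powr (n * (entropy UNIV Bm + \<gamma>))) (2 powr (- (n * (entropy UNIV Bm - \<gamma>)))) \<eta> F)"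
    using typical_projection_exists[OF marg_pos(4) marg_tr(4) \<gamma> \<eta>] by blast
  have "0 < (\<epsilon>\<^sup>2 / 2)\<^sup>2" using assms(2) by simp
  then obtain n5 where n5: "\<forall>n\<ge>n5. 2 powr (- (real n * (\<delta> / 2))) \<le> (\<epsilon>\<^sup>2 / 2)\<^sup>2"
    using exponential_small[of "\<delta> / 2" "(\<epsilon>\<^sup>2 / 2)\<^sup>2"] assms(4) by auto
  show ?thesis
  proof (intro exI[of _ "Max {n1, n2, n3, n4, n5}"] allI impI)
    fix n q N and P :: "('a list, 'b list, 'c list) protocol"
    assume n: "Max {n1, n2, n3, n4, n5} \<le> n"
      and qsr: "qsr_protocol (nlists n UNIV) (nlists n UNIV) (nlists n UNIV) (nlists n UNIV) (tensor_pow n \<Psi>) q \<epsilon> P"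
      and N: "N \<le> info_R_C_given_B \<Psi>"
    let ?R = "nlists n (UNIV :: 'r set)" and ?A = "nlists n (UNIV :: 'a set)"
      and ?B = "nlists n (UNIV :: 'b set)" and ?C = "nlists n (UNIV :: 'c set)"
    let ?E = "nlists n {..<d}" and ?f = "power_branch n \<phi>"
    interpret redistribution ?R ?A ?B ?C ?E ?f "tensor_pow n \<Psi>" P q \<epsilon>
      by unfold_locales
        (simp_all add: finite_nlists gram_tensor_pow[OF \<phi> tr] power_branch_1[OF \<phi> tr] qsr assms(2))
    have nn: "n1 \<le> n" "n2 \<le> n" "n3 \<le> n" "n4 \<le> n" "n5 \<le> n" using n by simp_all
    let ?pw = "\<lambda>H. 2 powr (real n * (H + \<gamma>))" and ?pm = "\<lambda>H. 2 powr (- (real n * (H - \<gamma>)))"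
    let ?S1 = "entropy UNIV RCB" and ?S2 = "entropy UNIV CB" and ?S3 = "entropy UNIV RB" and ?S4 = "entropy UNIV Bm"
    have branch_CB: "(\<lambda>(rs, as, es) (cs, bs). ?f es (rs, as, bs, cs)) = (\<lambda>(r, j) x. branch_RCB j (r, x))"
      by (auto simp: branch_RCB_def fun_eq_iff)
    have branch_B: "branch_B = (\<lambda>(r, j) x. branch_RB j (r, x))"
      by (auto simp: branch_B_def branch_RB_def fun_eq_iff)
    have "gram (?R \<times> ?C \<times> ?B) (?A \<times> ?E) branch_RCB
      (\<lambda>l l'. \<Prod>i<n. RCB ((\<lambda>(xs, ys, zs) i. (xs ! i, ys ! i, zs ! i)) l i) ((\<lambda>(xs, ys, zs) i. (xs ! i, ys ! i, zs ! i)) l' i))"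
      using gram_branch_RCB[OF \<phi> tr, of n] unfolding branch_RCB_def RCB_def .
    from n1[rule_format, OF nn(1), OF power_labels_3, OF this] obtain F1
      where F1: "typical_projection (?R \<times> ?C \<times> ?B) (?A \<times> ?E) branch_RCB (?pw ?S1) (?pm ?S1) (t\<^sup>2) F1"
      unfolding \<eta>_def by blast
    have "gram (?C \<times> ?B) (?R \<times> ?A \<times> ?E) (\<lambda>(r, j) x. branch_RCB j (r, x))
      (\<lambda>l l'. \<Prod>i<n. CB ((\<lambda>(xs, ys) i. (xs ! i, ys ! i)) l i) ((\<lambda>(xs, ys) i. (xs ! i, ys ! i)) l' i))"
      using gram_branch_CB[OF \<phi> tr, of n] unfolding branch_CB CB_def RCB_def .
    from n2[rule_format, OF nn(2), OF power_labels_2, OF this] obtain F2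
      where F2: "typical_projection (?C \<times> ?B) (?R \<times> ?A \<times> ?E) (\<lambda>(r, j) x. branch_RCB j (r, x)) (?pw ?S2) (?pm ?S2) (t\<^sup>2) F2"
      unfolding \<eta>_def by blast
    have "gram (?R \<times> ?B) (?A \<times> ?C \<times> ?E) branch_RB
      (\<lambda>l l'. \<Prod>i<n. RB ((\<lambda>(xs, ys) i. (xs ! i, ys ! i)) l i) ((\<lambda>(xs, ys) i. (xs ! i, ys ! i)) l' i))"
      using gram_branch_RB[OF \<phi> tr, of n] unfolding branch_RB_def RB_def RCB_def .
    from n3[rule_format, OF nn(3), OF power_labels_2, OF this] obtain F3
      where F3: "typical_projection (?R \<times> ?B) (?A \<times> ?C \<times> ?E) branch_RB (?pw ?S3) (?pm ?S3) (t\<^sup>2) F3"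
      unfolding \<eta>_def by blast
    have "gram ?B (?R \<times> ?A \<times> ?C \<times> ?E) branch_B (\<lambda>l l'. \<Prod>i<n. Bm (l ! i) (l' ! i))"
      using gram_branch_B[OF \<phi> tr, of n] unfolding branch_B_def Bm_def RB_def RCB_def .
    from n4[rule_format, OF nn(4), OF power_labels_1, OF this] obtain F4
      where F4: "typical_projection ?B (?R \<times> ?A \<times> ?C \<times> ?E) (\<lambda>(r, j) x. branch_RB j (r, x)) (?pw ?S4) (?pm ?S4) (t\<^sup>2) F4"
      unfolding \<eta>_def branch_B by blast
    have p0: "0 \<le> (2::real) powr x" for x by simp
    note RB_ctx = fin(1) less_imp_le[OF t] F3 F4 p0 p0
    note RCB_ctx = fin(1) less_imp_le[OF t] F1 F2 p0 p0
    let ?N = "op_mult (?R \<times> ?B) (op_rlift F4) F3" and ?L = "op_mult (?R \<times> ?C \<times> ?B) F1 (op_rlift F2)"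
    interpret tested_redistribution ?R ?A ?B ?C ?E ?f "tensor_pow n \<Psi>" P q \<epsilon> ?N ?L "?pm ?S3 * ?pw ?S4" "?pw ?S1 * ?pm ?S2" "2 * t" "4 * t"
    proof
      show "norm_sq (?R \<times> ?B) (op_app (?R \<times> ?B) ?N v) \<le> norm_sq (?R \<times> ?B) v" for v
        by (rule GF_contraction[OF RB_ctx])
      show "norm_sq (?R \<times> ?C \<times> ?B) (op_app (?R \<times> ?C \<times> ?B) ?L w) \<le> norm_sq (?R \<times> ?C \<times> ?B) w" for w
        by (rule FG_contraction[OF RCB_ctx])
      show "0 \<le> ?pm ?S3 * ?pw ?S4" by simp
      show "(\<Sum>j\<in>?A \<times> ?C \<times> ?E. (cmod (\<Sum>x\<in>?R \<times> ?B. d x * op_app (?R \<times> ?B) ?N (branch_RB j) x))\<^sup>2)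
        \<le> ?pm ?S3 * ?pw ?S4 * (\<Sum>r\<in>?R. \<Sum>j\<in>?R \<times> ?A \<times> ?C \<times> ?E. (cmod (\<Sum>b\<in>?B. d (r, b) * branch_B j b))\<^sup>2)" for d
        unfolding branch_B by (rule GF_bound[OF RB_ctx])
      show "sqrt (\<Sum>j\<in>?A \<times> ?C \<times> ?E. norm_sq (?R \<times> ?B) (\<lambda>x. branch_RB j x - op_app (?R \<times> ?B) ?N (branch_RB j) x)) \<le> 2 * t"
        by (rule GF_close[OF RB_ctx])
      show "(\<Sum>r\<in>?R. norm_sq (?R \<times> ?C \<times> ?B) (op_app (?R \<times> ?C \<times> ?B) ?L (\<lambda>(r', x). of_bool (r = r') * k x)))
        \<le> ?pw ?S1 * ?pm ?S2 * norm_sq (?C \<times> ?B) k" for k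
        by (rule FG_bound[OF RCB_ctx])
      show "sqrt (\<Sum>j\<in>?A \<times> ?E. norm_sq (?R \<times> ?C \<times> ?B)
        (\<lambda>x. branch_RCB j x - op_app (?R \<times> ?C \<times> ?B) (adj ?L) (op_app (?R \<times> ?C \<times> ?B) ?L (branch_RCB j)) x)) \<le> 4 * t"
        by (rule FG_close[OF RCB_ctx])
    qed
    let ?M = "real n * (N - \<delta>)" and ?E0 = "2 powr (- (real n * (\<delta> / 2))) :: real"
    have "?pm ?S3 * ?pw ?S4 * (?pw ?S1 * ?pm ?S2) = 2 powr (- (real n * (info_R_C_given_B \<Psi> - 4 * \<gamma>)))"
      unfolding info powr_add[symmetric] by (simp add: algebra_simps)
    then have "real (Max (messages ?M) - 1) * (?pm ?S3 * ?pw ?S4 * (?pw ?S1 * ?pm ?S2))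
      \<le> 2 powr ?M * 2 powr (- (real n * (info_R_C_given_B \<Psi> - 4 * \<gamma>)))"
      using Max_messages_le[of ?M] by (simp only: mult_right_mono p0)
    also have "\<dots> = 2 powr (real n * (N - info_R_C_given_B \<Psi>) - real n * (\<delta> / 2))"
      unfolding powr_add[symmetric] \<gamma>_def by (simp add: algebra_simps)
    \<comment> \<open>\<open>N\<close> is compared only with the conditional mutual information
      here, so no threshold has to depend on it.\<close>
    also have "\<dots> \<le> ?E0"
      using N by (intro powr_mono) (simp_all add: mult_nonneg_nonpos)
    finally have E0: "real (Max (messages ?M) - 1) * (?pm ?S3 * ?pw ?S4 * (?pw ?S1 * ?pm ?S2)) \<le> ?E0" .
    note eb = error_bound[OF assms(2,3) p0 n5[rule_format, OF nn(5)], folded c_def, folded t_def]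
    show "\<exists>S. qsr_simulation ?A ?C (marg_AC ?R ?B (tensor_pow n \<Psi>)) P ?M (8 * \<epsilon>) S"
    proof (rule simulation[OF _ E0 eb(2) _ eb(3)])
      show "0 \<le> ?pw ?S1 * ?pm ?S2" by simp
      show "c - 6 * t \<le> sqrt (1 - \<epsilon>\<^sup>2) - 2 * t - 4 * t" by (simp add: c_def)
    qed
  qed
qed

end
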